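(* Let $q \in \mathbb{R}$ with $q^2 < 1/3$. Consider the system, for real-valued functions $r,\phi$ of $(x,t)$, $$\begin{aligned} \partial_t r &= \partial_x^2 r - 2q \partial_x \phi - (1-q^2)(\mathrm{e}^{2r} - 1) + (\partial_x r)^2 - (\partial_x \phi)^2, \\ \partial_t \phi &= \partial_x^2 \phi + 2q \partial_x r + 2(\partial_x r)(\partial_x\phi). \end{aligned}$$ Then there exist $M_0, \varepsilon_0 > 0$ such that for all $\varepsilon \in (0,\varepsilon_0)$ and $(r_0, \phi_0) \in C^2_{\mathrm{ub}}(\mathbb{R},\mathbb{R}^2)$ satisfying $$\|r_0\|_{W^{2,\infty}} + \|\phi_0\|_{W^{2,\infty}} < \varepsilon,$$ there exists a global mild solution $(r,\phi) \in C\big([0,\infty),C_{\mathrm{ub}}^2(\mathbb{R},\mathbb{R}^2)\big)$ of the system with initial condition $(r(0),\phi(0)) = (r_0,\phi_0)$ enjoying the estimates $$\|\phi(t)\|_{L^\infty} \leq M_0 \varepsilon, \qquad \|r(t)\|_{L^\infty} + \|\partial_x \phi(t)\|_{L^\infty} \leq \frac{M_0 \varepsilon}{\sqrt{1+t}}, \qquad \|\partial_x r(t)\|_{W^{1,\infty}} + \|\partial_x^2 \phi(t)\|_{L^\infty} \leq \frac{M_0 \varepsilon}{1+t},$$ for all $t \geq 0$.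
   Context: For $m \in \mathbb{N}_0$, $C^m_{\mathrm{ub}}(\mathbb{R},E)$ denotes the space of functions $\mathbb{R}\to E$ that are $m$ times differentiable and which, together with their first $m$ derivatives, are bounded and uniformly continuous, equipped with the $W^{m,\infty}$-norm. Mild solution means solution of the integrated (Duhamel) equations: with $\mathrm{e}^{t\partial_x^2}$ the heat semigroup, $r(t) = \mathrm{e}^{t\partial_x^2} r_0 + \int_0^t \mathrm{e}^{(t-s)\partial_x^2} F(s)\,\mathrm{d}s$ and $\phi(t) = \mathrm{e}^{t\partial_x^2}\phi_0 + \int_0^t \mathrm{e}^{(t-s)\partial_x^2}G(s)\,\mathrm{d}s$, where $F = - 2q \partial_x \phi - (1-q^2)(\mathrm{e}^{2r} - 1) + (\partial_x r)^2 - (\partial_x \phi)^2$ and $G = 2q \partial_x r + 2(\partial_x r)(\partial_x\phi)$. *)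

theory Defs
  imports "HOL-Analysis.Analysis"
begin

text \<open>Functions of space are maps \<^typ>\<open>real \<Rightarrow> 'a\<close>; functions of time and space
  take the time argument first, so that \<open>u t\<close> is the spatial profile at time \<open>t\<close>.\<close>

definition Dx :: "(real \<Rightarrow> 'a::real_normed_vector) \<Rightarrow> real \<Rightarrow> 'a" where
  "Dx f = (\<lambda>x. vector_derivative f (at x))"

definition Cub :: "nat \<Rightarrow> (real \<Rightarrow> 'a::real_normed_vector) set" where
  "Cub m = {f. (\<forall>k<m. \<forall>x. (Dx ^^ k) f differentiable (at x)) \<and>
               (\<forall>k\<le>m. bounded (range ((Dx ^^ k) f)) \<and>
                       uniformly_continuous_on UNIV ((Dx ^^ k) f))}"

text \<open>The supremum is the \<open>L\<^sup>\<infinity>\<close> norm for bounded continuous functions, the only ones to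
  which it is applied; on unbounded functions it is unspecified. The \<open>W\<^sup>m\<^sup>,\<^sup>\<infinity>\<close> norm is
  taken in its sum form.\<close>

definition Linf_norm :: "(real \<Rightarrow> 'a::real_normed_vector) \<Rightarrow> real" where
  "Linf_norm f = (SUP x. norm (f x))"

definition Winf_norm :: "nat \<Rightarrow> (real \<Rightarrow> 'a::real_normed_vector) \<Rightarrow> real" where
  "Winf_norm m f = (\<Sum>k\<le>m. Linf_norm ((Dx ^^ k) f))"

text \<open>The space \<open>C([0,\<infinity>), C\<^sup>m\<^sub>u\<^sub>b(\<real>,E))\<close>; values at negative times are irrelevant.\<close>

definition continuous_into_Cub :: "nat \<Rightarrow> (real \<Rightarrow> real \<Rightarrow> 'a::real_normed_vector) set" where
  "continuous_into_Cub m = {u. (\<forall>t\<ge>0. u t \<in> Cub m) \<and>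
     (\<forall>t\<ge>0. ((\<lambda>s. Winf_norm m (\<lambda>x. u s x - u t x)) \<longlongrightarrow> 0) (at t within {0..}))}"

text \<open>The semigroup generated by \<open>\<partial>\<^sub>x\<^sup>2\<close>, by convolution with the Gauss--Weierstrass kernel;
  it is the identity at time zero.\<close>

definition heat :: "real \<Rightarrow> (real \<Rightarrow> real) \<Rightarrow> real \<Rightarrow> real" where
  "heat t f = (if t > 0
     then (\<lambda>x. LINT y|lborel. exp (- (x - y)\<^sup>2 / (4 * t)) / sqrt (4 * pi * t) * f y)
     else f)"

definition nonlin_r :: "real \<Rightarrow> (real \<Rightarrow> real) \<Rightarrow> (real \<Rightarrow> real) \<Rightarrow> real \<Rightarrow> real" where
  "nonlin_r q r \<phi> = (\<lambda>x. - 2 * q * Dx \<phi> x - (1 - q\<^sup>2) * (exp (2 * r x) - 1)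
                          + (Dx r x)\<^sup>2 - (Dx \<phi> x)\<^sup>2)"

definition nonlin_phi :: "real \<Rightarrow> (real \<Rightarrow> real) \<Rightarrow> (real \<Rightarrow> real) \<Rightarrow> real \<Rightarrow> real" where
  "nonlin_phi q r \<phi> = (\<lambda>x. 2 * q * Dx r x + 2 * Dx r x * Dx \<phi> x)"

text \<open>\<open>duhamel w w0 H\<close> says that \<open>w(t) = exp(t \<partial>\<^sub>x\<^sup>2) w0 + \<integral>\<^sub>0\<^sup>t exp((t - s) \<partial>\<^sub>x\<^sup>2) H(s) ds\<close> for all
  \<open>t \<ge> 0\<close>, where the integral exists in the Banach space of bounded continuous functions.
  \<^const>\<open>Bcontfun\<close> only injects into that space: whenever \<open>w t\<close>, \<open>w0\<close>, \<open>H t\<close> are bounded and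
  uniformly continuous, so are all the functions it is applied to.\<close>

definition duhamel ::
  "(real \<Rightarrow> real \<Rightarrow> real) \<Rightarrow> (real \<Rightarrow> real) \<Rightarrow> (real \<Rightarrow> real \<Rightarrow> real) \<Rightarrow> bool" where
  "duhamel w w0 H \<longleftrightarrow> (\<forall>t\<ge>0.
     ((\<lambda>s. Bcontfun (heat (t - s) (H s))) has_integral
        (Bcontfun (w t) - Bcontfun (heat t w0))) {0..t})"

definition global_mild_solution ::
  "real \<Rightarrow> (real \<Rightarrow> real) \<Rightarrow> (real \<Rightarrow> real) \<Rightarrow>
   (real \<Rightarrow> real \<Rightarrow> real) \<Rightarrow> (real \<Rightarrow> real \<Rightarrow> real) \<Rightarrow> bool" where
  "global_mild_solution q r0 \<phi>0 r \<phi> \<longleftrightarrow>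
     (\<lambda>t x. (r t x, \<phi> t x)) \<in> continuous_into_Cub 2 \<and>
     r 0 = r0 \<and> \<phi> 0 = \<phi>0 \<and>
     duhamel r r0 (\<lambda>s. nonlin_r q (r s) (\<phi> s)) \<and>
     duhamel \<phi> \<phi>0 (\<lambda>s. nonlin_phi q (r s) (\<phi> s))"

end

theory Submission
  imports Defs "HOL-Probability.Probability"
begin

text \<open>Write \<open>a = 2 (1 - q\<^sup>2)\<close> for the damping of \<open>r\<close> in the linearized system. If the common factor
  \<open>exp(t \<partial>\<^sub>x\<^sup>2)\<close> is split off and \<open>r\<close> is eliminated, the entries of the Green matrix become series
  \<open>\<Sum>n. (- 4 q\<^sup>2)^n c\<^sub>n(t) \<partial>\<^sub>x^(2 n) exp(t \<partial>\<^sub>x\<^sup>2)\<close>, whose coefficients satisfy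
  \<open>0 \<le> c\<^sub>n(t) \<le> (n + 1) (t / a)^n / n!\<close> up to a constant and, for the entries involving \<open>r\<close>, a bounded
  factor that decays in time or vanishes at time zero. Hermite functions give
  \<open>\<parallel>\<partial>\<^sub>x^m exp(t \<partial>\<^sub>x\<^sup>2)\<parallel> \<le> sqrt(m!) / (2 t)^(m / 2)\<close> on bounded
  functions, and since \<open>(2 n)! \<le> (2^n n!)\<^sup>2\<close> each series is dominated, up to polynomial factors, by the
  geometric series of ratio \<open>4 q\<^sup>2 / a\<close>. This ratio is less than one exactly if \<open>q\<^sup>2 < 1 / 3\<close>, and
  then the Green matrix has the decay of the heat semigroup, with additional decay in the components that
  involve the damped variable \<open>r\<close>.

  The nonlinearities \<open>2 r' \<phi>'\<close> and \<open>- (1 - q\<^sup>2) (exp(2 r) - 1 - 2 r) + r'\<^sup>2 - \<phi>'\<^sup>2\<close> then decay like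
  \<open>(1 + t)^(- 3 / 2)\<close> and \<open>(1 + t)\<^sup>-\<^sup>1\<close>, and their derivatives like \<open>(1 + t)^(- 3 / 2)\<close>. This suffices for a
  contraction argument in the space defined by the asserted estimates. The fixed point solves
  the Duhamel equation of the linearized system; the equations with the heat semigroup
  follow, because the Dyson series satisfies them term by term.\<close>

section \<open>The Banach algebra of bounded uniformly continuous functions\<close>

text \<open>The threshold has a simple origin. For slowly varying profiles the damped variable is
  slaved to the phase, \<open>r = - (2 q / a) \<phi>'\<close>, and the phase then diffuses with
  coefficient \<open>1 - 4 q^2 / a = (1 - 3 q^2) / (1 - q^2)\<close>, which is positive exactly for
  \<open>q^2 < 1 / 3\<close>. To reach this range the bound on m-fold derivatives needs the sharp
  exponential rate: composing m one-derivative bounds would lose a factor \<open>C^n\<close> with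
  \<open>C > 1\<close>. Orthogonality of the Hermite polynomials loses only polynomial factors. The
  critical nonlinear term is \<open>\<phi>'^2\<close>: its decay is not integrable in time. It
  reaches the phase only through an off-diagonal entry, which carries a spatial derivative; put on
  the forcing, this derivative restores integrability. No regularity is lost: the state carries two
  derivatives of both unknowns, the forcing one derivative of each nonlinearity, and the missing
  derivative costs an integrable singularity \<open>1 / sqrt \<tau>\<close> of the kernel.\<close>

typedef buc = "{f :: real \<Rightarrow> real. bounded (range f) \<and> uniformly_continuous_on UNIV f}"
  morphisms app Buc
  by (rule exI[of _ "\<lambda>_. 0"]) (auto intro: uniformly_continuous_on_const)

setup_lifting type_definition_buc

lemma bounded_app: "bounded (range (app f))"
  and uc_app: "uniformly_continuous_on UNIV (app f)"
  using app[of f] by auto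

lemma continuous_app[continuous_intros]: "continuous_on S (app f)"
  using uc_app uniformly_continuous_imp_continuous continuous_on_subset by blast

lemma measurable_app[measurable]: "app f \<in> borel_measurable borel"
  by (intro borel_measurable_continuous_onI continuous_app)

lemma buc_eqI: "(\<And>x. app f x = app g x) \<Longrightarrow> f = g"
  by transfer auto

lemma bounded_times_comp:
  fixes f g :: "'a \<Rightarrow> real"
  assumes "bounded (f ` S)" "bounded (g ` S)"
  shows "bounded ((\<lambda>x. f x * g x) ` S)"
proof -
  obtain B C where "\<And>x. x \<in> S \<Longrightarrow> \<bar>f x\<bar> \<le> B" "\<And>x. x \<in> S \<Longrightarrow> \<bar>g x\<bar> \<le> C"
    using assms unfolding bounded_iff by fastforce
  then have "\<bar>f x * g x\<bar> \<le> B * C" if "x \<in> S" for x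
    using that unfolding abs_mult by (intro mult_mono') auto
  then show ?thesis unfolding bounded_iff by (intro exI[of _ "B * C"]) auto
qed

lemma uniformly_continuous_on_mult_bounded:
  fixes f g :: "'a::metric_space \<Rightarrow> real"
  assumes f: "uniformly_continuous_on S f" and g: "uniformly_continuous_on S g"
    and bf: "bounded (f ` S)" and bg: "bounded (g ` S)"
  shows "uniformly_continuous_on S (\<lambda>x. f x * g x)"
proof -
  obtain B where B: "B > 0" "\<And>x. x \<in> S \<Longrightarrow> \<bar>f x\<bar> \<le> B"
    using bf unfolding bounded_pos by auto
  obtain C where C: "C > 0" "\<And>x. x \<in> S \<Longrightarrow> \<bar>g x\<bar> \<le> C"
    using bg unfolding bounded_pos by auto
  show ?thesis
    unfolding uniformly_continuous_on_def
  proof (intro allI impI)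
    fix e :: real assume "e > 0"
    then have e: "e / (2 * C) > 0" "e / (2 * B) > 0" using B C by auto
    obtain d1 where d1: "d1 > 0" "\<And>x y. x \<in> S \<Longrightarrow> y \<in> S \<Longrightarrow> dist y x < d1 \<Longrightarrow> dist (f y) (f x) < e / (2 * C)"
      using f e(1) unfolding uniformly_continuous_on_def by blast
    obtain d2 where d2: "d2 > 0" "\<And>x y. x \<in> S \<Longrightarrow> y \<in> S \<Longrightarrow> dist y x < d2 \<Longrightarrow> dist (g y) (g x) < e / (2 * B)"
      using g e(2) unfolding uniformly_continuous_on_def by blast
    have "dist (f y * g y) (f x * g x) < e" if "x \<in> S" "y \<in> S" "dist y x < min d1 d2" for x y
    proof -
      have "f y * g y - f x * g x = (f y - f x) * g y + f x * (g y - g x)" by (simp add: algebra_simps)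
      then have "\<bar>f y * g y - f x * g x\<bar> \<le> \<bar>f y - f x\<bar> * \<bar>g y\<bar> + \<bar>f x\<bar> * \<bar>g y - g x\<bar>"
        by (metis abs_mult abs_triangle_ineq)
      also have "\<dots> \<le> \<bar>f y - f x\<bar> * C + B * \<bar>g y - g x\<bar>"
        using B C that by (intro add_mono mult_mono) auto
      also have "\<dots> < e / (2 * C) * C + B * (e / (2 * B))"
        using d1(2)[of x y] d2(2)[of x y] that B C
        by (intro add_strict_mono mult_strict_left_mono mult_strict_right_mono) (auto simp: dist_real_def)
      also have "\<dots> = e" using B C by simp
      finally show ?thesis by (simp add: dist_real_def)
    qed
    then show "\<exists>d>0. \<forall>x\<in>S. \<forall>x'\<in>S. dist x' x < d \<longrightarrow> dist (f x' * g x') (f x * g x) < e"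
      using d1 d2 by (intro exI[of _ "min d1 d2"]) auto
  qed
qed

text \<open>The algebra structure makes the abstract exponential and product estimates available for
  the nonlinearity. Uniform continuity, rather than continuity alone, is what makes the heat
  semigroup strongly continuous at time zero.\<close>

instantiation buc :: "{comm_ring_1, real_algebra_1}"
begin

lift_definition zero_buc :: buc is "\<lambda>_. 0"
  by (auto intro: uniformly_continuous_on_const)
lift_definition one_buc :: buc is "\<lambda>_. 1"
  by (auto intro: uniformly_continuous_on_const)
lift_definition plus_buc :: "buc \<Rightarrow> buc \<Rightarrow> buc" is "\<lambda>f g x. f x + g x"
  by (auto intro!: uniformly_continuous_on_add bounded_plus_comp)
lift_definition minus_buc :: "buc \<Rightarrow> buc \<Rightarrow> buc" is "\<lambda>f g x. f x - g x"
  by (auto intro!: uniformly_continuous_on_diff bounded_minus_comp)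
lift_definition uminus_buc :: "buc \<Rightarrow> buc" is "\<lambda>f x. - f x"
  by (auto intro!: uniformly_continuous_on_minus)
lift_definition times_buc :: "buc \<Rightarrow> buc \<Rightarrow> buc" is "\<lambda>f g x. f x * g x"
  by (auto intro!: uniformly_continuous_on_mult_bounded bounded_times_comp)
lift_definition scaleR_buc :: "real \<Rightarrow> buc \<Rightarrow> buc" is "\<lambda>c f x. c * f x"
  by (auto intro!: uniformly_continuous_on_mult_bounded bounded_times_comp uniformly_continuous_on_const)

instance
proof
  show "(0::buc) \<noteq> 1" by transfer (simp add: fun_eq_iff)
qed (transfer; simp add: algebra_simps fun_eq_iff)+

end

lemma app_simps[simp]:
  "app 0 x = 0" "app 1 x = 1" "app (f + g) x = app f x + app g x"
  "app (f - g) x = app f x - app g x" "app (- f) x = - app f x"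
  "app (f * g) x = app f x * app g x" "app (c *\<^sub>R f) x = c * app f x"
  by (transfer; simp)+

instantiation buc :: real_normed_algebra_1
begin

definition norm_buc :: "buc \<Rightarrow> real" where "norm_buc f = (SUP x. \<bar>app f x\<bar>)"
definition dist_buc :: "buc \<Rightarrow> buc \<Rightarrow> real" where "dist_buc f g = norm (f - g)"
definition sgn_buc :: "buc \<Rightarrow> buc" where "sgn_buc f = f /\<^sub>R norm f"
definition uniformity_buc :: "(buc \<times> buc) filter"
  where "uniformity_buc = (INF e\<in>{0 <..}. principal {(x, y). dist x y < e})"
definition open_buc :: "buc set \<Rightarrow> bool"
  where "open_buc S = (\<forall>x\<in>S. \<forall>\<^sub>F (x', y) in uniformity. x' = x \<longrightarrow> y \<in> S)"

lemma buc_bdd_above: "bdd_above (range (\<lambda>x. \<bar>app f x\<bar>))"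
proof -
  obtain B where "\<forall>x\<in>range (app f). norm x \<le> B"
    using bounded_app[of f] unfolding bounded_iff by blast
  then have "\<bar>app f x\<bar> \<le> B" for x by auto
  then show ?thesis by (intro bdd_aboveI[of _ B]) auto
qed

lemma abs_app_le_norm: "\<bar>app f x\<bar> \<le> norm f"
  unfolding norm_buc_def by (rule cSUP_upper[OF UNIV_I buc_bdd_above])

lemma norm_buc_le: "(\<And>x. \<bar>app f x\<bar> \<le> b) \<Longrightarrow> norm f \<le> b"
  unfolding norm_buc_def by (rule cSUP_least) auto

lemma norm_buc_nonneg: "0 \<le> norm (f::buc)"
  using abs_app_le_norm[of f 0] by linarith

instance
proof
  fix f g :: buc and a :: real
  show "dist f g = norm (f - g)" by (rule dist_buc_def)
  show "(norm f = 0) = (f = 0)"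
  proof
    assume "norm f = 0"
    then have "app f x = 0" for x using abs_app_le_norm[of f x] by auto
    then show "f = 0" by (intro buc_eqI) auto
  next
    assume f: "f = 0"
    have "norm f \<le> 0" unfolding f by (rule norm_buc_le) simp
    then show "norm f = 0" using norm_buc_nonneg[of f] by linarith
  qed
  show "norm (f + g) \<le> norm f + norm g"
  proof (rule norm_buc_le)
    fix x show "\<bar>app (f + g) x\<bar> \<le> norm f + norm g"
      using abs_app_le_norm[of f x] abs_app_le_norm[of g x] by simp
  qed
  have le: "norm (a *\<^sub>R f) \<le> \<bar>a\<bar> * norm f" for a :: real and f :: buc
  proof (rule norm_buc_le)
    fix x show "\<bar>app (a *\<^sub>R f) x\<bar> \<le> \<bar>a\<bar> * norm f"
      by (simp add: abs_mult abs_app_le_norm mult_left_mono)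
  qed
  show "norm (a *\<^sub>R f) = \<bar>a\<bar> * norm f"
  proof (cases "a = 0")
    case True
    then show ?thesis using le[of a f] norm_buc_nonneg[of "a *\<^sub>R f"] by simp
  next
    case False
    have "norm f \<le> \<bar>inverse a\<bar> * norm (a *\<^sub>R f)" using le[of "inverse a" "a *\<^sub>R f"] False by simp
    then have "\<bar>a\<bar> * norm f \<le> norm (a *\<^sub>R f)" using False by (simp add: field_simps abs_inverse)
    then show ?thesis using le[of a f] by linarith
  qed
  show "norm (f * g) \<le> norm f * norm g"
  proof (rule norm_buc_le)
    fix x show "\<bar>app (f * g) x\<bar> \<le> norm f * norm g"
      using abs_app_le_norm[of f x] abs_app_le_norm[of g x] by (simp add: abs_mult mult_mono)
  qed
  have "norm (1::buc) \<le> 1" by (rule norm_buc_le) simp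
  moreover have "1 \<le> norm (1::buc)" using abs_app_le_norm[of 1 0] by simp
  ultimately show "norm (1::buc) = 1" by linarith
qed (rule sgn_buc_def uniformity_buc_def open_buc_def)+

end

instance buc :: banach
proof
  fix X :: "nat \<Rightarrow> buc" assume C: "Cauchy X"
  have unif: "\<exists>N. \<forall>m\<ge>N. \<forall>n\<ge>N. \<forall>x. \<bar>app (X m) x - app (X n) x\<bar> < e" if e: "e > 0" for e
  proof -
    obtain N where N: "\<forall>m\<ge>N. \<forall>n\<ge>N. dist (X m) (X n) < e" using C e unfolding Cauchy_def by blast
    have "\<bar>app (X m) x - app (X n) x\<bar> < e" if "m \<ge> N" "n \<ge> N" for m n x
      using N that abs_app_le_norm[of "X m - X n" x] unfolding dist_buc_def by fastforce
    then show ?thesis by blast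
  qed
  have "\<forall>e>0. \<exists>N. \<forall>m n x. N \<le> m \<and> N \<le> n \<and> True \<longrightarrow> dist (app (X m) x) (app (X n) x) < e"
    using unif unfolding dist_real_def by metis
  then obtain l where l: "uniform_limit UNIV (\<lambda>n. app (X n)) l sequentially"
    using uniformly_convergent_eq_cauchy[of "\<lambda>_. True" "\<lambda>n. app (X n)"]
    unfolding uniform_limit_sequentially_iff by auto
  have lim: "\<exists>N. \<forall>n\<ge>N. \<forall>x. \<bar>app (X n) x - l x\<bar> < e" if "e > 0" for e
    using l that unfolding uniform_limit_sequentially_iff by (auto simp: dist_real_def)
  have "uniformly_continuous_on UNIV l"
    unfolding uniformly_continuous_on_def
  proof (intro allI impI)
    fix e :: real assume e: "e > 0"
    obtain N where N: "\<And>x. \<bar>app (X N) x - l x\<bar> < e / 3" using lim[of "e/3"] e by auto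
    obtain d where d: "d > 0" "\<And>x y. dist y x < d \<Longrightarrow> dist (app (X N) y) (app (X N) x) < e / 3"
      using uc_app[of "X N"] e unfolding uniformly_continuous_on_def
      by (metis UNIV_I zero_less_divide_iff zero_less_numeral)
    have "dist (l y) (l x) < e" if "dist y x < d" for x y
      using d(2)[OF that] N[of x] N[of y] unfolding dist_real_def by linarith
    then show "\<exists>d>0. \<forall>x\<in>UNIV. \<forall>x'\<in>UNIV. dist x' x < d \<longrightarrow> dist (l x') (l x) < e" using d(1) by blast
  qed
  moreover have "bounded (range l)"
  proof -
    obtain N where N: "\<And>x. \<bar>app (X N) x - l x\<bar> < 1" using lim[of 1] by auto
    have "norm (l x) \<le> norm (X N) + 1" for x
      using N[of x] abs_app_le_norm[of "X N" x] by auto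
    then show ?thesis unfolding bounded_iff by blast
  qed
  ultimately have al: "app (Buc l) = l" by (intro Buc_inverse) auto
  have "X \<longlonglongrightarrow> Buc l"
  proof (rule LIMSEQ_I)
    fix e :: real assume e: "e > 0"
    obtain N where N: "\<forall>n\<ge>N. \<forall>x. \<bar>app (X n) x - l x\<bar> < e / 2" using lim[of "e/2"] e by auto
    have "norm (X n - Buc l) \<le> e / 2" if "n \<ge> N" for n
      using N that by (intro norm_buc_le) (auto simp: al less_imp_le)
    then show "\<exists>no. \<forall>n\<ge>no. norm (X n - Buc l) < e" using e by (intro exI[of _ N]) fastforce
  qed
  then show "convergent X" by (rule convergentI)
qed

lemma app_Buc:
  "\<lbrakk>\<And>x. \<bar>f x\<bar> \<le> B; uniformly_continuous_on UNIV f\<rbrakk> \<Longrightarrow> app (Buc f) = f"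
  by (rule Buc_inverse) (auto simp: bounded_iff)

lemma bounded_linear_app: "bounded_linear (\<lambda>f. app f x)"
  by (rule bounded_linear_intro[where K=1]) (auto simp: abs_app_le_norm)

text \<open>Point evaluation is a continuous algebra homomorphism, hence commutes with the
  exponential series.\<close>

lemma app_exp: "app (exp f) x = exp (app f x)"
proof -
  have p: "app (f ^ n) x = app f x ^ n" for n by (induction n) auto
  have "(\<lambda>n. app (f ^ n /\<^sub>R fact n) x) sums app (exp f) x"
    using bounded_linear.sums[OF bounded_linear_app exp_converges[of f]] by simp
  then have "(\<lambda>n. app f x ^ n /\<^sub>R fact n) sums app (exp f) x" by (simp add: p)
  then show ?thesis using exp_converges[of "app f x"] sums_unique2 by blast
qed

subsection \<open>Derivatives\<close>

text \<open>A relation and not an operator, because differentiation is only partially defined on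
  this space.\<close>

definition bderiv :: "buc \<Rightarrow> buc \<Rightarrow> bool" where
  "bderiv f g \<longleftrightarrow> (\<forall>x. (app f has_real_derivative app g x) (at x))"

lemma integrable_app[intro, simp]: "app g integrable_on {x..y}"
  by (intro integrable_continuous_real continuous_app)

lemma bounded_linear_integral_app: "bounded_linear (\<lambda>g. integral {x..y} (app g))"
proof (rule bounded_linear_intro[where K="\<bar>y - x\<bar>"])
  fix f g :: buc and c :: real
  have "app (f + g) = (\<lambda>z. app f z + app g z)" "app (c *\<^sub>R f) = (\<lambda>z. c * app f z)" by (auto simp: fun_eq_iff)
  then show "integral {x..y} (app (f + g)) = integral {x..y} (app f) + integral {x..y} (app g)"
    "integral {x..y} (app (c *\<^sub>R f)) = c *\<^sub>R integral {x..y} (app f)"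
    by (simp_all add: integral_add)
  show "norm (integral {x..y} (app f)) \<le> norm f * \<bar>y - x\<bar>"
  proof (cases "x \<le> y")
    case True
    have "norm (integral {x..y} (app f)) \<le> norm f * (y - x)"
      by (rule integral_bound[OF True continuous_app]) (simp add: abs_app_le_norm)
    then show ?thesis using True by simp
  qed simp
qed

text \<open>In integrated form the relation is evidently closed under limits in norm.\<close>

lemma bderiv_iff_integral:
  "bderiv f g \<longleftrightarrow> (\<forall>x y. x \<le> y \<longrightarrow> integral {x..y} (app g) = app f y - app f x)"
proof
  assume "bderiv f g"
  then have "(app f has_vector_derivative app g x) (at x within S)" for x S
    unfolding bderiv_def has_real_derivative_iff_has_vector_derivative
    using has_vector_derivative_at_within by blast
  then have "(app g has_integral (app f y - app f x)) {x..y}" if "x \<le> y" for x y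
    using that by (intro fundamental_theorem_of_calculus) auto
  then show "\<forall>x y. x \<le> y \<longrightarrow> integral {x..y} (app g) = app f y - app f x"
    by (auto intro: integral_unique)
next
  assume I: "\<forall>x y. x \<le> y \<longrightarrow> integral {x..y} (app g) = app f y - app f x"
  show "bderiv f g"
    unfolding bderiv_def
  proof
    fix x
    have "((\<lambda>u. integral {x-1..u} (app g)) has_real_derivative app g x) (at x within {x-1..x+1})"
      by (intro integral_has_real_derivative continuous_app) auto
    then have "((\<lambda>u. app f u - app f (x-1)) has_real_derivative app g x) (at x within {x-1..x+1})"
      unfolding has_real_derivative_iff_has_vector_derivative
      by (rule has_vector_derivative_transform[rotated 2]) (use I in auto)
    then have "((\<lambda>u. app f u - app f (x-1)) has_real_derivative app g x) (at x)"
      by (simp add: at_within_interior[of x "{x-1..x+1}"])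
    then have "((\<lambda>u. (app f u - app f (x-1)) + app f (x - 1)) has_real_derivative app g x + 0) (at x)"
      by (intro DERIV_add) auto
    then show "(app f has_real_derivative app g x) (at x)" by simp
  qed
qed

lemma bderiv_unique: "bderiv f g \<Longrightarrow> bderiv f h \<Longrightarrow> g = h"
  unfolding bderiv_def by (blast intro: buc_eqI DERIV_unique)

lemma bderiv_0[intro, simp]: "bderiv 0 0"
  unfolding bderiv_iff_integral by (simp add: zero_buc.rep_eq)

lemma bderiv_add: "bderiv f f' \<Longrightarrow> bderiv g g' \<Longrightarrow> bderiv (f + g) (f' + g')"
  unfolding bderiv_def plus_buc.rep_eq by (auto intro!: DERIV_add)

lemma bderiv_diff: "bderiv f f' \<Longrightarrow> bderiv g g' \<Longrightarrow> bderiv (f - g) (f' - g')"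
  unfolding bderiv_def minus_buc.rep_eq by (auto intro!: DERIV_diff)

lemma bderiv_scaleR: "bderiv f f' \<Longrightarrow> bderiv (c *\<^sub>R f) (c *\<^sub>R f')"
  unfolding bderiv_def scaleR_buc.rep_eq by (auto intro!: DERIV_cmult)

lemma bderiv_mult: "bderiv f f' \<Longrightarrow> bderiv g g' \<Longrightarrow> bderiv (f * g) (f' * g + f * g')"
  unfolding bderiv_def times_buc.rep_eq app_simps
  by (auto intro!: derivative_eq_intros)

lemma bderiv_exp: "bderiv f f' \<Longrightarrow> bderiv (exp f) (f' * exp f)"
  unfolding bderiv_def by (simp add: app_exp[abs_def] app_exp) (auto intro!: derivative_eq_intros)

lemma bderiv_lim:
  assumes "\<And>n. bderiv (f n) (g n)" "f \<longlonglongrightarrow> F" "g \<longlonglongrightarrow> G"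
  shows "bderiv F G"
  unfolding bderiv_iff_integral
proof (intro allI impI)
  fix x y :: real assume xy: "x \<le> y"
  have "(\<lambda>n. integral {x..y} (app (g n))) \<longlonglongrightarrow> integral {x..y} (app G)"
    using bounded_linear.tendsto[OF bounded_linear_integral_app assms(3)] .
  moreover have "(\<lambda>n. integral {x..y} (app (g n))) = (\<lambda>n. app (f n) y - app (f n) x)"
    using assms(1) xy unfolding bderiv_iff_integral by auto
  moreover have "(\<lambda>n. app (f n) y - app (f n) x) \<longlonglongrightarrow> (app F y - app F x)"
    by (intro tendsto_diff bounded_linear.tendsto[OF bounded_linear_app assms(2)])
  ultimately show "integral {x..y} (app G) = app F y - app F x" using LIMSEQ_unique by metis
qed

lemma bderiv_sums:
  assumes "\<And>n. bderiv (f n) (g n)" "f sums F" "g sums G"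
  shows "bderiv F G"
proof -
  have "bderiv (\<Sum>i<n. f i) (\<Sum>i<n. g i)" for n
    by (induction n) (auto intro: bderiv_add assms(1))
  then show ?thesis using assms(2,3) unfolding sums_def by (rule bderiv_lim)
qed

lemma bderiv_integral:
  assumes "\<And>\<theta>. \<theta> \<in> {a..b} \<Longrightarrow> bderiv (f \<theta>) (g \<theta>)"
    and f: "f integrable_on {a..b}" and g: "g integrable_on {a..b::real}"
  shows "bderiv (integral {a..b} f) (integral {a..b} g)"
  unfolding bderiv_iff_integral
proof (intro allI impI)
  fix x y :: real assume xy: "x \<le> y"
  have "integral {x..y} (app (integral {a..b} g)) = integral {a..b} (\<lambda>\<theta>. integral {x..y} (app (g \<theta>)))"
    using integral_linear[OF g bounded_linear_integral_app[of x y]] by (simp add: o_def)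
  also have "\<dots> = integral {a..b} (\<lambda>\<theta>. app (f \<theta>) y - app (f \<theta>) x)"
    using assms(1) xy unfolding bderiv_iff_integral by (intro integral_cong) auto
  also have "\<dots> = integral {a..b} (\<lambda>\<theta>. app (f \<theta>) y) - integral {a..b} (\<lambda>\<theta>. app (f \<theta>) x)"
    using integrable_linear[OF f bounded_linear_app] by (intro integral_diff) (auto simp: o_def)
  also have "\<dots> = app (integral {a..b} f) y - app (integral {a..b} f) x"
    using integral_linear[OF f bounded_linear_app] by (simp add: o_def)
  finally show "integral {x..y} (app (integral {a..b} g)) = app (integral {a..b} f) y - app (integral {a..b} f) x" .
qed

section \<open>Hermite functions\<close>

text \<open>The probabilists' polynomials He_m, for which the m-th derivative of the standard normal
  density is \<open>(-1)^m\<close> He_m times that density.\<close>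

fun hermite :: "nat \<Rightarrow> real poly" where
  "hermite 0 = 1"
| "hermite (Suc m) = [:0, 1:] * hermite m - pderiv (hermite m)"

lemma pderiv_hermite: "pderiv (hermite (Suc m)) = smult (real (Suc m)) (hermite m)"
proof (induction m)
  case (Suc m)
  have "pderiv (hermite (Suc (Suc m))) = hermite (Suc m) + [:0, 1:] * pderiv (hermite (Suc m))
      - pderiv (pderiv (hermite (Suc m)))"
    by (simp only: hermite.simps(2)[of "Suc m"] pderiv_diff pderiv_mult) (simp add: pderiv_pCons)
  also have "\<dots> = hermite (Suc m) + smult (real (Suc m)) ([:0, 1:] * hermite m - pderiv (hermite m))"
    unfolding Suc.IH by (simp add: pderiv_smult smult_diff_right)
  also have "\<dots> = smult (real (Suc (Suc m))) (hermite (Suc m))"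
    unfolding hermite.simps(2)[symmetric]
    by (metis add.commute of_nat_Suc smult_1_left smult_add_left)
  finally show ?case .
qed (simp add: pderiv_pCons)

lemma integrable_gauss_poly: "integrable lborel (\<lambda>x. std_normal_density x * poly p x)"
proof -
  have "(\<lambda>x. std_normal_density x * poly p x)
      = (\<lambda>x. \<Sum>i\<le>degree p. coeff p i * (std_normal_density x * x ^ i))"
    by (simp add: fun_eq_iff poly_altdef sum_distrib_left mult_ac)
  then show ?thesis by (simp add: integrable_std_normal_moment)
qed

definition gauss_mean :: "real poly \<Rightarrow> real" where
  "gauss_mean p = (LINT x|lborel. std_normal_density x * poly p x)"

lemma gauss_mean_add: "gauss_mean (p + q) = gauss_mean p + gauss_mean q"
  and gauss_mean_diff: "gauss_mean (p - q) = gauss_mean p - gauss_mean q"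
  unfolding gauss_mean_def by (simp_all add: distrib_left right_diff_distrib integrable_gauss_poly)

lemma gauss_mean_smult: "gauss_mean (smult c p) = c * gauss_mean p"
  unfolding gauss_mean_def by (simp add: mult.left_commute)

lemma gauss_mean_sum: "gauss_mean (\<Sum>i\<in>A. p i) = (\<Sum>i\<in>A. gauss_mean (p i))"
  by (induction A rule: infinite_finite_induct) (auto simp: gauss_mean_add gauss_mean_def[of 0])

text \<open>Gaussian integration by parts, \<open>E[X p(X)] = E[p'(X)]\<close>, checked on monomials
  from the known moments; this avoids boundary terms at infinity.\<close>

lemma gauss_mean_monom_shift: "gauss_mean ([:0, 1:] * monom c i) = gauss_mean (pderiv (monom c i))"
proof -
  define \<mu> where "\<mu> k = (LINT x|lborel. std_normal_density x * x ^ k)" for k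
  have mu: "gauss_mean (monom c k) = c * \<mu> k" for c k
    unfolding gauss_mean_def \<mu>_def by (simp add: poly_monom mult.left_commute)
  have "\<mu> (Suc i) = real i * \<mu> (i - 1)"
  proof (cases "even i")
    case True
    then obtain j where j: "i = 2 * j" by blast
    show ?thesis
    proof (cases j)
      case 0
      then show ?thesis using integral_std_normal_moment_odd[of 0] j by (simp add: \<mu>_def)
    next
      case (Suc l)
      then have "i - 1 = 2 * l + 1" using j by simp
      then show ?thesis using integral_std_normal_moment_odd[of j] integral_std_normal_moment_odd[of l]
        unfolding \<mu>_def j by simp
    qed
  next
    case False
    then obtain j where j: "i = 2 * j + 1" using oddE by blast
    have e: "Suc i = 2 * Suc j" "i - 1 = 2 * j" using j by auto
    have "fact (2 * Suc j) / (2 ^ Suc j * fact (Suc j)) = real i * (fact (2 * j) / (2 ^ j * fact j :: real))"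
      unfolding j by (simp add: divide_simps)
    then show ?thesis
      unfolding \<mu>_def e integral_std_normal_moment_even .
  qed
  moreover have "[:0, 1:] * monom c i = monom c (Suc i)" by (simp add: monom_Suc)
  ultimately show ?thesis by (simp add: mu pderiv_monom)
qed

lemma gauss_mean_shift: "gauss_mean ([:0, 1:] * p) = gauss_mean (pderiv p)"
proof -
  have p: "p = (\<Sum>i\<le>degree p. monom (coeff p i) i)" by (simp add: poly_as_sum_of_monoms)
  show ?thesis
    by (subst (1 2) p)
      (simp only: sum_distrib_left gauss_mean_sum gauss_mean_monom_shift
        higher_pderiv_sum[of 1, simplified])
qed

text \<open>Multiplication by x minus differentiation, the operator that raises the index, is the
  adjoint of differentiation for the Gaussian measure.\<close>

lemma gauss_mean_hermite: "gauss_mean (hermite (Suc m) * p) = gauss_mean (hermite m * pderiv p)"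
proof -
  have "hermite (Suc m) * p = [:0, 1:] * (hermite m * p) - pderiv (hermite m) * p"
    by (simp add: algebra_simps)
  then show ?thesis
    by (simp only: gauss_mean_diff gauss_mean_shift pderiv_mult gauss_mean_add) (simp add: mult.commute)
qed

lemma gauss_mean_hermite_square: "gauss_mean (hermite m * hermite m) = fact m"
proof (induction m)
  case 0
  show ?case by (simp add: gauss_mean_def)
next
  case (Suc m)
  show ?case unfolding gauss_mean_hermite pderiv_hermite mult_smult_right gauss_mean_smult Suc.IH by simp
qed

text \<open>Up to the sign \<open>(-1)^m\<close> this is the m-th derivative of the Gaussian
  density; with the sign removed, differentiating the convolution in x produces no signs.\<close>

definition hfun :: "nat \<Rightarrow> real \<Rightarrow> real" where
  "hfun m x = std_normal_density x * poly (hermite m) x"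

lemma measurable_hfun[measurable]: "hfun m \<in> borel_measurable borel"
  unfolding hfun_def by (intro borel_measurable_continuous_onI)
    (auto intro!: continuous_intros simp: normal_density_def)

lemma integrable_hfun[simp, intro]: "integrable lborel (hfun m)"
  unfolding hfun_def by (rule integrable_gauss_poly)

lemma integrable_hfun_mult: "integrable lborel (\<lambda>z. hfun m z * z)"
  using integrable_gauss_poly[of "hermite m * [:0,1:]"] by (simp add: hfun_def mult_ac)

lemma integral_hfun_Suc: "(LINT x|lborel. hfun (Suc m) x) = 0"
  using gauss_mean_hermite[of m 1] by (simp add: gauss_mean_def hfun_def)

lemma hfun_deriv: "(hfun m has_real_derivative - hfun (Suc m) x) (at x)"
proof -
  have d: "(std_normal_density has_real_derivative - x * std_normal_density x) (at x)"
    unfolding std_normal_density_def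
    by (rule DERIV_cong[OF DERIV_cmult[OF DERIV_fun_exp[where m="- x"]]]) (auto intro!: derivative_eq_intros)
  show ?thesis unfolding hfun_def
    by (auto intro!: derivative_eq_intros d poly_DERIV simp: algebra_simps)
qed

text \<open>Cauchy-Schwarz for the Gaussian measure, in the form
  \<open>2 c |H| \<le> H^2 + c^2\<close> with the optimal \<open>c = sqrt (m!)\<close>, the norm of
  the Hermite polynomial.\<close>

lemma integral_abs_hfun_le: "(LINT x|lborel. \<bar>hfun m x\<bar>) \<le> sqrt (fact m)"
proof -
  define c :: real where "c = sqrt (fact m)"
  have c: "c > 0" "c\<^sup>2 = fact m" by (auto simp: c_def)
  have i2: "integrable lborel (\<lambda>x. std_normal_density x * poly (hermite m * hermite m) x)"
    by (rule integrable_gauss_poly)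
  have i1: "integrable lborel (\<lambda>x. \<bar>hfun m x\<bar>)" by (intro integrable_abs integrable_hfun)
  have "(LINT x|lborel. 2 * c * \<bar>hfun m x\<bar>)
      \<le> (LINT x|lborel. std_normal_density x * poly (hermite m * hermite m) x + c\<^sup>2 * std_normal_density x)"
  proof (rule integral_mono)
    fix x :: real
    have "0 \<le> std_normal_density x * (\<bar>poly (hermite m) x\<bar> - c)\<^sup>2" by simp
    also have "\<dots> = std_normal_density x * (poly (hermite m) x)\<^sup>2 + c\<^sup>2 * std_normal_density x
        - 2 * c * (std_normal_density x * \<bar>poly (hermite m) x\<bar>)"
      by (simp add: power2_diff algebra_simps)
    finally show "2 * c * \<bar>hfun m x\<bar>
        \<le> std_normal_density x * poly (hermite m * hermite m) x + c\<^sup>2 * std_normal_density x"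
      by (simp add: hfun_def abs_mult power2_eq_square)
  qed (use i1 i2 in auto)
  also have "\<dots> = fact m + c\<^sup>2"
    using i2 gauss_mean_hermite_square[of m] by (simp add: gauss_mean_def)
  also have "\<dots> = 2 * c * c" using c(2) by (simp add: power2_eq_square)
  finally show ?thesis using c(1) i1 unfolding c_def[symmetric] by simp
qed

section \<open>The derivatives of the heat semigroup\<close>

text \<open>This is \<open>sqrt (2 * t) ^ m\<close> times the m-th spatial derivative of the heat
  evolution of f, with the scale placed in the argument of f. In this normalization the operators
  are bounded uniformly in t and continuous down to t = 0, although the derivatives themselves blow
  up there.\<close>

definition hconv :: "nat \<Rightarrow> real \<Rightarrow> buc \<Rightarrow> buc" where
  "hconv m t f = Buc (\<lambda>x. LINT z|lborel. hfun m z * app f (x + sqrt (2 * t) * z))"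

lemma integrable_mult_app:
  assumes "integrable lborel g" "h \<in> borel_measurable borel"
  shows "integrable lborel (\<lambda>z. g z * app f (h z))"
proof (rule Bochner_Integration.integrable_bound[where f="\<lambda>z. norm f * g z"])
  show "AE z in lborel. norm (g z * app f (h z)) \<le> norm (norm f * g z)"
    by (intro AE_I2) (simp add: abs_mult mult.commute[of "norm f"] mult_left_mono abs_app_le_norm)
qed (use assms in \<open>auto intro!: borel_measurable_times measurable_compose[OF _ measurable_app]\<close>)

lemma integral_mult_app_le:
  assumes g: "integrable lborel g" and "h \<in> borel_measurable borel" "k \<in> borel_measurable borel"
    and b: "\<And>z. \<bar>app f (h z) - app f (k z)\<bar> \<le> B z" and i: "integrable lborel (\<lambda>z. \<bar>g z\<bar> * B z)"
  shows "\<bar>(LINT z|lborel. g z * app f (h z)) - (LINT z|lborel. g z * app f (k z))\<bar>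
    \<le> (LINT z|lborel. \<bar>g z\<bar> * B z)"
proof -
  have "(LINT z|lborel. g z * app f (h z)) - (LINT z|lborel. g z * app f (k z))
      = (LINT z|lborel. g z * app f (h z) - g z * app f (k z))"
    by (rule Bochner_Integration.integral_diff[symmetric]) (auto intro: integrable_mult_app assms)
  moreover have "norm (LINT z|lborel. g z * app f (h z) - g z * app f (k z)) \<le> (LINT z|lborel. \<bar>g z\<bar> * B z)"
  proof (rule Bochner_Integration.integral_norm_bound_integral[OF _ i])
    show "norm (g z * app f (h z) - g z * app f (k z)) \<le> \<bar>g z\<bar> * B z" for z
      unfolding right_diff_distrib[symmetric] real_norm_def abs_mult using b[of z] by (intro mult_left_mono) auto
  qed (intro Bochner_Integration.integrable_diff integrable_mult_app assms)
  ultimately show ?thesis by simp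
qed

lemma app_hconv: "app (hconv m t f) x = (LINT z|lborel. hfun m z * app f (x + sqrt (2 * t) * z))"
  and norm_hconv: "norm (hconv m t f) \<le> sqrt (fact m) * norm f"
proof -
  let ?h = "\<lambda>x. LINT z|lborel. hfun m z * app f (x + sqrt (2 * t) * z)"
  have ia: "integrable lborel (\<lambda>x. \<bar>hfun m x\<bar>)" by (intro integrable_abs integrable_hfun)
  have b: "\<bar>?h x\<bar> \<le> sqrt (fact m) * norm f" for x
  proof -
    have "norm (?h x) \<le> (LINT z|lborel. \<bar>hfun m z\<bar> * norm f)"
    proof (rule Bochner_Integration.integral_norm_bound_integral)
      show "norm (hfun m z * app f (x + sqrt (2 * t) * z)) \<le> \<bar>hfun m z\<bar> * norm f" for z
        by (simp add: abs_mult mult_left_mono abs_app_le_norm)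
    qed (use ia in \<open>auto intro: integrable_mult_app\<close>)
    also have "\<dots> \<le> sqrt (fact m) * norm f"
      using integral_abs_hfun_le[of m] by (simp add: mult_right_mono)
    finally show ?thesis by simp
  qed
  have uc: "uniformly_continuous_on UNIV ?h"
    unfolding uniformly_continuous_on_def
  proof (intro allI impI)
    fix e :: real assume e: "e > 0"
    define e' where "e' = e / (2 * sqrt (fact m))"
    have e': "e' > 0" using e by (simp add: e'_def)
    then obtain d where d: "d > 0" "\<And>x y. dist y x < d \<Longrightarrow> dist (app f y) (app f x) < e'"
      using uc_app[of f] unfolding uniformly_continuous_on_def by (meson UNIV_I)
    have "dist (?h y) (?h x) < e" if "dist y x < d" for x y
    proof -
      have "\<bar>?h y - ?h x\<bar> \<le> (LINT z|lborel. \<bar>hfun m z\<bar> * e')"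
      proof (rule integral_mult_app_le)
        show "\<bar>app f (y + sqrt (2 * t) * z) - app f (x + sqrt (2 * t) * z)\<bar> \<le> e'" for z
          using d(2)[of "y + sqrt (2 * t) * z" "x + sqrt (2 * t) * z"] that by (auto simp: dist_real_def)
      qed (use ia in auto)
      also have "\<dots> \<le> sqrt (fact m) * e'" using integral_abs_hfun_le[of m] e' by (simp add: mult_right_mono)
      also have "\<dots> < e" using e by (simp add: e'_def)
      finally show ?thesis by (simp add: dist_real_def)
    qed
    then show "\<exists>d>0. \<forall>x\<in>UNIV. \<forall>x'\<in>UNIV. dist x' x < d \<longrightarrow> dist (?h x') (?h x) < e" using d(1) by blast
  qed
  have a: "app (hconv m t f) = ?h" unfolding hconv_def using b uc by (rule app_Buc)
  then show "app (hconv m t f) x = ?h x" by simp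
  show "norm (hconv m t f) \<le> sqrt (fact m) * norm f"
    by (rule norm_buc_le) (use a b in auto)
qed

lemma bounded_linear_hconv: "bounded_linear (hconv m t)"
proof (rule bounded_linear_intro[where K="sqrt (fact m)"])
  fix f g :: buc and c :: real
  show "hconv m t (f + g) = hconv m t f + hconv m t g"
    by (rule buc_eqI) (simp add: app_hconv ring_distribs integrable_mult_app)
  show "hconv m t (c *\<^sub>R f) = c *\<^sub>R hconv m t f"
    by (rule buc_eqI) (simp add: app_hconv mult.left_commute[of _ c])
  show "norm (hconv m t f) \<le> norm f * sqrt (fact m)" using norm_hconv[of m t f] by (simp add: mult.commute)
qed

lemma hconv_0: "hconv 0 0 f = f"
  by (rule buc_eqI) (simp add: app_hconv hfun_def)

lemma hconv_Suc_0: "hconv (Suc m) 0 f = 0"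
  by (rule buc_eqI) (simp add: app_hconv integral_hfun_Suc)

text \<open>Uniform continuity and boundedness of f together give the affine modulus
  \<open>e' + C * \<bar>y - x\<bar>\<close>. It can be integrated directly against the kernel, whose
  first absolute moment is finite, so that the integral need not be split into a bounded part and
  tails.\<close>

lemma continuous_hconv: "continuous_on {0..} (\<lambda>t. hconv m t f)"
  unfolding continuous_on_iff
proof (intro ballI allI impI)
  fix t e :: real assume t: "t \<in> {0..}" and e: "e > 0"
  define e' where "e' = e / (4 * sqrt (fact m))"
  have e': "e' > 0" using e by (simp add: e'_def)
  then obtain d where d: "d > 0" "\<And>x y. dist y x < d \<Longrightarrow> dist (app f y) (app f x) < e'"
    using uc_app[of f] unfolding uniformly_continuous_on_def by (meson UNIV_I)
  define C where "C = 2 * norm f / d"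
  have C: "C \<ge> 0" using d by (simp add: C_def)
  have mod: "\<bar>app f y - app f x\<bar> \<le> e' + C * \<bar>y - x\<bar>" for x y
  proof (cases "\<bar>y - x\<bar> < d")
    case True
    then have "\<bar>app f y - app f x\<bar> \<le> e'" using d(2)[of y x] by (simp add: dist_real_def)
    then show ?thesis using C by (meson abs_ge_zero add_increasing2 mult_nonneg_nonneg)
  next
    case False
    have "\<bar>app f y - app f x\<bar> \<le> 2 * norm f" using abs_app_le_norm[of f x] abs_app_le_norm[of f y] by linarith
    also have "\<dots> = C * d" using d by (simp add: C_def)
    also have "\<dots> \<le> C * \<bar>y - x\<bar>" using False C by (intro mult_left_mono) auto
    finally show ?thesis using e' by linarith
  qed
  define A where "A = (LINT z|lborel. \<bar>hfun m z * z\<bar>)"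
  have ia: "integrable lborel (\<lambda>x. \<bar>hfun m x\<bar>)" "integrable lborel (\<lambda>x. \<bar>hfun m x * x\<bar>)"
    by (intro integrable_abs integrable_hfun integrable_hfun_mult)+
  have A: "A \<ge> 0" by (simp add: A_def)
  have est: "norm (hconv m s f - hconv m t f) \<le> e / 4 + C * A * \<bar>sqrt (2 * s) - sqrt (2 * t)\<bar>" for s
  proof (rule norm_buc_le)
    fix x
    let ?D = "\<bar>sqrt (2 * s) - sqrt (2 * t)\<bar>"
    have eq: "\<bar>hfun m z\<bar> * (e' + C * ?D * \<bar>z\<bar>) = e' * \<bar>hfun m z\<bar> + C * ?D * \<bar>hfun m z * z\<bar>" for z
      by (simp add: abs_mult algebra_simps)
    have "\<bar>app (hconv m s f - hconv m t f) x\<bar> \<le> (LINT z|lborel. \<bar>hfun m z\<bar> * (e' + C * ?D * \<bar>z\<bar>))"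
      unfolding app_simps app_hconv
    proof (rule integral_mult_app_le)
      show "\<bar>app f (x + sqrt (2 * s) * z) - app f (x + sqrt (2 * t) * z)\<bar> \<le> e' + C * ?D * \<bar>z\<bar>" for z
        using mod[of "x + sqrt (2 * s) * z" "x + sqrt (2 * t) * z"]
        by (simp add: left_diff_distrib[symmetric] abs_mult mult.assoc)
      show "integrable lborel (\<lambda>z. \<bar>hfun m z\<bar> * (e' + C * ?D * \<bar>z\<bar>))"
        unfolding eq using ia by simp
    qed auto
    also have "\<dots> = e' * (LINT z|lborel. \<bar>hfun m z\<bar>) + C * ?D * A"
      unfolding eq A_def using ia by simp
    also have "e' * (LINT z|lborel. \<bar>hfun m z\<bar>) \<le> e' * sqrt (fact m)"
      using integral_abs_hfun_le[of m] e' by (simp add: mult_left_mono)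
    also have "\<dots> = e / 4" by (simp add: e'_def)
    finally show "\<bar>app (hconv m s f - hconv m t f) x\<bar> \<le> e / 4 + C * A * ?D" by (simp add: mult_ac)
  qed
  have "((\<lambda>s. C * A * \<bar>sqrt (2 * s) - sqrt (2 * t)\<bar>) \<longlongrightarrow> C * A * \<bar>sqrt (2 * t) - sqrt (2 * t)\<bar>) (at t)"
    by (intro tendsto_intros)
  then obtain \<delta> where \<delta>: "\<delta> > 0"
    "\<And>s. s \<noteq> t \<Longrightarrow> dist s t < \<delta> \<Longrightarrow> dist (C * A * \<bar>sqrt (2 * s) - sqrt (2 * t)\<bar>) (C * A * \<bar>sqrt (2 * t) - sqrt (2 * t)\<bar>) < e / 2"
    using e unfolding tendsto_iff eventually_at by (metis half_gt_zero UNIV_I)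
  have "dist (hconv m s f) (hconv m t f) < e" if "dist s t < \<delta>" for s
  proof (cases "s = t")
    case False
    then have "C * A * \<bar>sqrt (2 * s) - sqrt (2 * t)\<bar> < e / 2" using \<delta>(2)[of s] that by (simp add: dist_real_def)
    then show ?thesis using est[of s] e unfolding dist_norm by linarith
  qed (use e in simp)
  then show "\<exists>d>0. \<forall>x'\<in>{0..}. dist x' t < d \<longrightarrow> dist (hconv m x' f) (hconv m t f) < e"
    using \<delta>(1) by blast
qed

lemma Fubini_lborel:
  fixes F :: "real \<Rightarrow> real \<Rightarrow> real"
  assumes meas: "case_prod F \<in> borel_measurable (lborel \<Otimes>\<^sub>M lborel)"
    and i: "\<And>s. integrable lborel (F s)"
    and b: "\<And>s. (LINT w|lborel. \<bar>F s w\<bar>) \<le> C s" and C: "integrable lborel C"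
  shows "(LINT w|lborel. LINT s|lborel. F s w) = (LINT s|lborel. LINT w|lborel. F s w)"
proof (rule lborel_pair.Fubini_integral, rule lborel_pair.Fubini_integrable[OF meas])
  show "integrable lborel (\<lambda>s. LINT w|lborel. norm (case (s, w) of (x, y) \<Rightarrow> F x y))"
  proof (rule Bochner_Integration.integrable_bound[OF C])
    have "(\<lambda>z. norm (case_prod F z)) \<in> borel_measurable (lborel \<Otimes>\<^sub>M lborel)" using meas by measurable
    then show "(\<lambda>s. LINT w|lborel. norm (case (s, w) of (x, y) \<Rightarrow> F x y)) \<in> borel_measurable lborel"
      by (intro lborel.borel_measurable_lebesgue_integral) (simp add: case_prod_beta')
    show "AE s in lborel. norm (LINT w|lborel. norm (case (s, w) of (x, y) \<Rightarrow> F x y)) \<le> norm (C s)"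
      using b by (intro AE_I2) (simp add: order_trans[OF b])
  qed
qed (use i in auto)

lemma abs_mult_app_le: "\<bar>c * app f y\<bar> \<le> norm f * \<bar>c\<bar>"
  by (metis abs_app_le_norm abs_ge_zero abs_mult mult.commute mult_left_mono)

lemma isCont_app: "isCont (app f) x"
  using continuous_app[of UNIV f] by (simp add: continuous_on_eq_continuous_at)

lemma integral_app_eq_LINT:
  "integral {x..y} (app g) = (LINT s|lborel. indicator {x..y} s * app g s)"
  using set_borel_integral_eq_integral(2)[OF borel_integrable_atLeastAtMost'[OF continuous_app], of x y g]
  by (simp add: set_lebesgue_integral_def)

text \<open>In the integrated form of \<open>bderiv\<close> one needs only Fubini and the
  fundamental theorem in x, and no differentiation under the integral sign.\<close>

lemma bderiv_hconv_commute:
  assumes "bderiv f f'"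
  shows "bderiv (hconv m t f) (hconv m t f')"
  unfolding bderiv_iff_integral
proof (intro allI impI)
  fix x y :: real assume xy: "x \<le> y"
  define \<sigma> where "\<sigma> = sqrt (2 * t)"
  define F where "F s z = indicator {x..y} s * (hfun m z * app f' (s + \<sigma> * z))" for s z :: real
  have ih: "integrable lborel (\<lambda>z. hfun m z * app f' (s + \<sigma> * z))" for s
    by (intro integrable_mult_app) auto
  have "integral {x..y} (app (hconv m t f')) = (LINT s|lborel. LINT z|lborel. F s z)"
    unfolding integral_app_eq_LINT app_hconv F_def \<sigma>_def[symmetric] by simp
  also have "\<dots> = (LINT z|lborel. LINT s|lborel. F s z)"
  proof (rule Fubini_lborel[symmetric])
    show "case_prod F \<in> borel_measurable (lborel \<Otimes>\<^sub>M lborel)"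
      unfolding F_def by measurable
    show "integrable lborel (F s)" for s using ih[of s] unfolding F_def by simp
    show "(LINT w|lborel. \<bar>F s w\<bar>) \<le> indicator {x..y} s * (norm f' * (LINT w|lborel. \<bar>hfun m w\<bar>))" for s
    proof -
      have "(LINT w|lborel. \<bar>hfun m w * app f' (s + \<sigma> * w)\<bar>) \<le> (LINT w|lborel. norm f' * \<bar>hfun m w\<bar>)"
        using ih[of s] by (intro integral_mono integrable_abs integrable_mult_right integrable_hfun)
          (assumption, rule abs_mult_app_le)
      then show ?thesis by (auto simp: F_def indicator_def)
    qed
    show "integrable lborel (\<lambda>s. indicator {x..y} s * (norm f' * (LINT w|lborel. \<bar>hfun m w\<bar>)))"
      by (intro integrable_mult_left) (simp add: emeasure_lborel_Icc_eq)
  qed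
  also have "\<dots> = (LINT z|lborel. hfun m z * app f (y + \<sigma> * z) - hfun m z * app f (x + \<sigma> * z))"
  proof (rule Bochner_Integration.integral_cong[OF refl])
    fix z
    have "(LINT s|lborel. app f' (s + \<sigma> * z) * indicator {x..y} s) = app f (y + \<sigma> * z) - app f (x + \<sigma> * z)"
    proof (rule integral_FTC_Icc_real[OF xy])
      show "DERIV (\<lambda>s. app f (s + \<sigma> * z)) s :> app f' (s + \<sigma> * z)" for s
        using assms unfolding bderiv_def by (subst DERIV_shift[symmetric]) blast
      show "isCont (\<lambda>s. app f' (s + \<sigma> * z)) s" for s
        by (rule isCont_o2[where g="app f'", OF _ isCont_app]) simp
    qed
    moreover have "F s z = hfun m z * (app f' (s + \<sigma> * z) * indicator {x..y} s)" for s
      by (simp add: F_def mult_ac)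
    ultimately show "(LINT s|lborel. F s z) = hfun m z * app f (y + \<sigma> * z) - hfun m z * app f (x + \<sigma> * z)"
      by (simp add: right_diff_distrib)
  qed
  also have "\<dots> = app (hconv m t f) y - app (hconv m t f) x"
    unfolding app_hconv \<sigma>_def[symmetric]
    by (rule Bochner_Integration.integral_diff) (auto intro: integrable_mult_app)
  finally show "integral {x..y} (app (hconv m t f')) = app (hconv m t f) y - app (hconv m t f) x" .
qed

text \<open>Here f need not be differentiable. The shift \<open>w = z + x / \<sigma>\<close> moves x
  from the argument of f into the smooth kernel, and then Fubini and the fundamental theorem apply
  to the kernel.\<close>

lemma bderiv_hconv:
  assumes t: "t > 0"
  shows "bderiv (hconv m t f) ((1 / sqrt (2 * t)) *\<^sub>R hconv (Suc m) t f)"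
  unfolding bderiv_iff_integral
proof (intro allI impI)
  fix x y :: real assume xy: "x \<le> y"
  define \<sigma> where "\<sigma> = sqrt (2 * t)"
  have \<sigma>: "\<sigma> > 0" using t by (simp add: \<sigma>_def)
  define k where "k s w = hfun (Suc m) (w - s / \<sigma>) * app f (\<sigma> * w)" for s w
  define F where "F s w = indicator {x..y} s * k s w" for s w :: real
  have shift: "integrable lborel (\<lambda>w. hfun n (w - c))" for n c
    using lborel_integrable_real_affine[OF integrable_hfun[of n], of 1 "-c"] by simp
  have ih: "integrable lborel (k s)" for s
    unfolding k_def by (intro integrable_mult_app shift) auto
  have conv: "(LINT w|lborel. hfun n (w - s / \<sigma>) * app f (\<sigma> * w)) = app (hconv n t f) s" for n s
    using \<sigma> lborel_integral_real_affine[of 1 "\<lambda>w. hfun n (w - s / \<sigma>) * app f (\<sigma> * w)" "s / \<sigma>"]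
    unfolding app_hconv \<sigma>_def[symmetric] by (simp add: distrib_left)
  have "integral {x..y} (app (hconv (Suc m) t f)) = (LINT s|lborel. LINT w|lborel. F s w)"
    unfolding integral_app_eq_LINT F_def k_def by (simp add: conv)
  also have "\<dots> = (LINT w|lborel. LINT s|lborel. F s w)"
  proof (rule Fubini_lborel[symmetric])
    show "case_prod F \<in> borel_measurable (lborel \<Otimes>\<^sub>M lborel)"
      unfolding F_def k_def by measurable
    show "integrable lborel (F s)" for s using ih[of s] unfolding F_def by simp
    show "(LINT w|lborel. \<bar>F s w\<bar>) \<le> indicator {x..y} s * (norm f * (LINT w|lborel. \<bar>hfun (Suc m) w\<bar>))" for s
    proof -
      have "(LINT w|lborel. \<bar>k s w\<bar>) \<le> (LINT w|lborel. norm f * \<bar>hfun (Suc m) (w - s / \<sigma>)\<bar>)"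
        using ih[of s] unfolding k_def by (intro integral_mono integrable_abs integrable_mult_right shift)
          (assumption, rule abs_mult_app_le)
      also have "\<dots> = norm f * (LINT w|lborel. \<bar>hfun (Suc m) w\<bar>)"
        using lborel_integral_real_affine[of 1 "\<lambda>w. \<bar>hfun (Suc m) (w - s / \<sigma>)\<bar>" "s / \<sigma>"] by simp
      finally show ?thesis by (auto simp: F_def indicator_def)
    qed
    show "integrable lborel (\<lambda>s. indicator {x..y} s * (norm f * (LINT w|lborel. \<bar>hfun (Suc m) w\<bar>)))"
      by (intro integrable_mult_left) (simp add: emeasure_lborel_Icc_eq)
  qed
  also have "\<dots> = (LINT w|lborel. \<sigma> * (hfun m (w - y / \<sigma>) * app f (\<sigma> * w) - hfun m (w - x / \<sigma>) * app f (\<sigma> * w)))"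
  proof (rule Bochner_Integration.integral_cong[OF refl])
    fix w
    have "(LINT s|lborel. hfun (Suc m) (w - s / \<sigma>) * indicator {x..y} s)
        = \<sigma> * hfun m (w - y / \<sigma>) - \<sigma> * hfun m (w - x / \<sigma>)"
    proof (rule integral_FTC_Icc_real[OF xy])
      show "DERIV (\<lambda>s. \<sigma> * hfun m (w - s / \<sigma>)) s :> hfun (Suc m) (w - s / \<sigma>)" for s
        using \<sigma> by (auto intro!: derivative_eq_intros DERIV_chain2[OF hfun_deriv])
      show "isCont (\<lambda>s. hfun (Suc m) (w - s / \<sigma>)) s" for s
        using \<sigma> by (intro isCont_o2[where g="hfun (Suc m)", OF _ DERIV_isCont[OF hfun_deriv]]) simp
    qed
    moreover have "F s w = app f (\<sigma> * w) * (hfun (Suc m) (w - s / \<sigma>) * indicator {x..y} s)" for s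
      by (simp add: F_def k_def mult_ac)
    ultimately show "(LINT s|lborel. F s w) = \<sigma> * (hfun m (w - y / \<sigma>) * app f (\<sigma> * w) - hfun m (w - x / \<sigma>) * app f (\<sigma> * w))"
      by (simp only: integral_mult_right_zero) (simp add: right_diff_distrib mult_ac)
  qed
  also have "\<dots> = \<sigma> * (app (hconv m t f) y - app (hconv m t f) x)"
    unfolding conv[symmetric] by (simp add: Bochner_Integration.integral_diff integrable_mult_app shift)
  finally show "integral {x..y} (app ((1 / sqrt (2 * t)) *\<^sub>R hconv (Suc m) t f))
      = app (hconv m t f) y - app (hconv m t f) x"
    using \<sigma> unfolding \<sigma>_def[symmetric] by (simp add: scaleR_buc.rep_eq)
qed

section \<open>The semigroup law for the heat operators and their derivatives\<close>

lemma app_hconv_density: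
  assumes "t > 0"
  shows "app (hconv 0 t f) x = (LINT y|lborel. normal_density 0 (sqrt (2 * t)) y * app f (x + y))"
proof -
  define \<sigma> where "\<sigma> = sqrt (2 * t)"
  have \<sigma>: "\<sigma> > 0" using assms by (simp add: \<sigma>_def)
  have "\<sigma> * normal_density 0 \<sigma> (\<sigma> * z) = hfun 0 z" for z
    using \<sigma> by (simp add: normal_density_def hfun_def power_mult_distrib real_sqrt_mult)
  then show ?thesis
    using \<sigma> lborel_integral_real_affine[of \<sigma> "\<lambda>y. normal_density 0 \<sigma> y * app f (x + y)" 0]
    unfolding app_hconv \<sigma>_def[symmetric] by (simp flip: integral_mult_right_zero add: mult.assoc[symmetric])
qed

text \<open>Variances of independent normal variables add: 2 s and 2 t give 2 (t + s). Time zero is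
  treated apart, since the density degenerates there.\<close>

lemma hconv_semigroup:
  assumes "s \<ge> 0" "t \<ge> 0"
  shows "hconv 0 t (hconv 0 s f) = hconv 0 (t + s) f"
proof (cases "s = 0 \<or> t = 0")
  case False
  then have st: "s > 0" "t > 0" using assms by auto
  show ?thesis
  proof (rule buc_eqI)
    fix x
    let ?n = "\<lambda>t. normal_density 0 (sqrt (2 * t))"
    define F where "F y u = ?n t y * (?n s (u - y) * app f (x + u))" for y u
    have shift: "integrable lborel (\<lambda>u. ?n s (u - y))" for y
      using lborel_integrable_real_affine[OF integrable_normal_density[where \<sigma>="sqrt (2 * s)" and \<mu>=0], of 1 "-y"] st by simp
    have shift2: "(LINT u|lborel. ?n s (u - y) * h u) = (LINT u|lborel. ?n s u * h (u + y))" for y and h :: "real \<Rightarrow> real"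
      using lborel_integral_real_affine[of 1 "\<lambda>u. ?n s (u - y) * h u" y] by (simp add: add.commute)
    have ih: "integrable lborel (\<lambda>u. ?n s (u - y) * app f (x + u))" for y
      by (intro integrable_mult_app shift) auto
    have "app (hconv 0 t (hconv 0 s f)) x = (LINT y|lborel. LINT u|lborel. F y u)"
      unfolding app_hconv_density[OF st(1)] app_hconv_density[OF st(2)] F_def
      by (simp add: shift2 add_ac)
    also have "\<dots> = (LINT u|lborel. LINT y|lborel. F y u)"
    proof (rule Fubini_lborel[symmetric])
      show "case_prod F \<in> borel_measurable (lborel \<Otimes>\<^sub>M lborel)"
        unfolding F_def by measurable
      show "integrable lborel (F y)" for y using ih[of y] unfolding F_def by simp
      show "(LINT u|lborel. \<bar>F y u\<bar>) \<le> ?n t y * norm f" for y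
      proof -
        have "(LINT u|lborel. \<bar>?n s (u - y) * app f (x + u)\<bar>) \<le> (LINT u|lborel. norm f * ?n s (u - y))"
          using ih[of y] by (intro integral_mono integrable_abs integrable_mult_right shift)
            (assumption, rule order_trans[OF abs_mult_app_le], simp)
        also have "\<dots> = norm f" using shift2[of y "\<lambda>_. 1"] st by simp
        finally show ?thesis unfolding F_def by (simp add: abs_mult mult_left_mono)
      qed
      show "integrable lborel (\<lambda>y. ?n t y * norm f)" using st by simp
    qed
    also have "\<dots> = (LINT u|lborel. ?n (t + s) u * app f (x + u))"
    proof (rule Bochner_Integration.integral_cong[OF refl])
      fix u
      have c: "(\<integral>\<^sup>+y. ennreal (?n s (u - y) * ?n t y) \<partial>lborel) = ennreal (?n (t + s) u)"
        using fun_cong[OF conv_normal_density_zero_mean[of "sqrt (2 * s)" "sqrt (2 * t)"], of u] st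
        by (simp add: algebra_simps)
      have "(LINT y|lborel. ?n s (u - y) * ?n t y) = ?n (t + s) u"
        by (subst integral_eq_nn_integral) (auto simp: c)
      moreover have "F y u = app f (x + u) * (?n s (u - y) * ?n t y)" for y
        by (simp add: F_def mult_ac)
      ultimately show "(LINT y|lborel. F y u) = ?n (t + s) u * app f (x + u)" by (simp add: mult.commute)
    qed
    also have "\<dots> = app (hconv 0 (t + s) f) x" using st app_hconv_density[of "t + s"] by simp
    finally show "app (hconv 0 t (hconv 0 s f)) x = app (hconv 0 (t + s) f) x" .
  qed
qed (auto simp: hconv_0)

text \<open>Since \<open>1 / 0 = 0\<close>, this is zero for \<open>t = 0\<close> and \<open>m > 0\<close>, in accordance with the limit at \<open>t = 0\<close> of
  the corresponding terms of the Dyson series.\<close>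

definition dheat :: "nat \<Rightarrow> real \<Rightarrow> buc \<Rightarrow>\<^sub>L buc" where
  "dheat m t = (1 / sqrt (2 * t) ^ m) *\<^sub>R Blinfun (hconv m t)"

lemma dheat_apply: "dheat m t f = (1 / sqrt (2 * t) ^ m) *\<^sub>R hconv m t f"
  by (simp add: dheat_def scaleR_blinfun.rep_eq bounded_linear_Blinfun_apply[OF bounded_linear_hconv])

lemma norm_dheat: "norm (dheat m t) \<le> sqrt (fact m) / sqrt (2 * \<bar>t\<bar>) ^ m"
proof (rule norm_blinfun_bound)
  fix f
  \<comment> \<open>\<open>sqrt\<close> is extended as an odd function to negative arguments, so the
    bound needs no sign condition on t.\<close>
  have "\<bar>sqrt (2 * t)\<bar> = sqrt (2 * \<bar>t\<bar>)"
    by (cases "t \<ge> 0") (auto simp: abs_if simp flip: real_sqrt_minus)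
  then have "norm (dheat m t f) = norm (hconv m t f) / sqrt (2 * \<bar>t\<bar>) ^ m"
    by (simp add: dheat_apply power_abs)
  also have "\<dots> \<le> sqrt (fact m) * norm f / sqrt (2 * \<bar>t\<bar>) ^ m"
    by (intro divide_right_mono norm_hconv) auto
  finally show "norm (dheat m t f) \<le> sqrt (fact m) / sqrt (2 * \<bar>t\<bar>) ^ m * norm f" by simp
qed auto

lemma dheat_0: "dheat 0 t f = hconv 0 t f"
  by (simp add: dheat_apply)

lemma dheat_0_0 [simp]: "dheat 0 0 f = f"
  by (simp add: dheat_0 hconv_0)

lemma dheat_Suc_0 [simp]: "dheat (Suc m) 0 = 0"
  by (simp add: dheat_def)

lemma bderiv_dheat: "t > 0 \<Longrightarrow> bderiv (dheat m t f) (dheat (Suc m) t f)"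
  using bderiv_scaleR[OF bderiv_hconv[of t m f], of "1 / sqrt (2 * t) ^ m"]
  by (simp add: dheat_apply mult.commute)

lemma bderiv_dheat_commute: "bderiv f f' \<Longrightarrow> bderiv (dheat m t f) (dheat m t f')"
  unfolding dheat_apply by (intro bderiv_scaleR bderiv_hconv_commute)

text \<open>Both sides for n + 1 are derivatives of the common function for n, and derivatives are
  unique. Positive s is essential: at s = 0 the value of \<open>dheat\<close> is a default for n >
  0.\<close>

lemma dheat_semigroup:
  assumes "s > 0" "t \<ge> 0"
  shows "dheat 0 t (dheat n s f) = dheat n (t + s) f"
proof (induction n)
  case 0
  then show ?case using hconv_semigroup[of s t f] assms by (simp add: dheat_0)
next
  case (Suc n)
  have "bderiv (dheat 0 t (dheat n s f)) (dheat 0 t (dheat (Suc n) s f))"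
    by (intro bderiv_dheat_commute bderiv_dheat assms)
  moreover have "bderiv (dheat n (t + s) f) (dheat (Suc n) (t + s) f)"
    using assms by (intro bderiv_dheat) auto
  ultimately show ?case unfolding Suc.IH by (rule bderiv_unique)
qed

lemma continuous_dheat_pos: "continuous_on {0<..} (\<lambda>t. dheat m t f)"
  unfolding dheat_apply
  by (intro continuous_intros continuous_on_subset[OF continuous_hconv]) auto

section \<open>Coefficients of the Dyson series\<close>

lemma integral_has_derivative_half_line:
  fixes g :: "real \<Rightarrow> real"
  assumes "continuous_on {0..} g" "t \<ge> 0"
  shows "((\<lambda>t. integral {0..t} g) has_real_derivative g t) (at t within {0..})"
proof -
  have "((\<lambda>t. integral {0..t} g) has_real_derivative g t) (at t within {0..t+1})"
    using assms by (intro integral_has_real_derivative continuous_on_subset[OF assms(1)]) auto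
  moreover have "at t within {0..t+1} = at t within {0..}"
    by (rule at_within_nhd[of _ "{t-1<..<t+1}"]) (use assms in auto)
  ultimately show ?thesis by simp
qed

text \<open>Used with the integrating factor \<open>exp (a * t)\<close>, this turns every bound on
  the coefficients into an inequality between derivatives. At the left end point only one-sided
  derivatives exist.\<close>

lemma half_line_comparison:
  fixes u v :: "real \<Rightarrow> real"
  assumes "\<And>t. t \<ge> 0 \<Longrightarrow> (u has_real_derivative u' t) (at t within {0..})"
    and "\<And>t. t \<ge> 0 \<Longrightarrow> (v has_real_derivative v' t) (at t within {0..})"
    and "\<And>t. t \<ge> 0 \<Longrightarrow> u' t \<le> v' t" and "u 0 \<le> v 0" "t \<ge> 0"
  shows "u t \<le> v t"
proof -
  have d: "((\<lambda>t. v t - u t) has_real_derivative v' t - u' t) (at t within {0..})" if "t \<ge> 0" for t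
    by (rule DERIV_diff[OF assms(2)[OF that] assms(1)[OF that]])
  have "(\<lambda>t. v t - u t) 0 \<le> (\<lambda>t. v t - u t) t"
  proof (rule DERIV_nonneg_imp_increasing_open[where f="\<lambda>t. v t - u t", OF assms(5)])
    fix x :: real assume "0 < x"
    then have "at x within {0..} = at x"
      by (intro at_within_open_subset[of x "{0<..}"]) auto
    then have "((\<lambda>t. v t - u t) has_real_derivative v' x - u' x) (at x)"
      using d[of x] \<open>0 < x\<close> by simp
    moreover have "0 \<le> v' x - u' x" using assms(3)[of x] \<open>0 < x\<close> by simp
    ultimately show "\<exists>y. ((\<lambda>t. v t - u t) has_real_derivative y) (at x) \<and> 0 \<le> y"
      by blast
  next
    have "continuous_on {0..} (\<lambda>t. v t - u t)"
      by (rule DERIV_continuous_on[OF d]) simp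
    then show "continuous_on {0..t} (\<lambda>t. v t - u t)" by (rule continuous_on_subset) auto
  qed
  then show ?thesis using assms(4) by simp
qed

text \<open>Without the heat factor the linearized system is \<open>\<psi>' = 2 q \<partial>\<^sub>x \<rho>\<close>, \<open>\<rho>' = - a \<rho> - 2 q \<partial>\<^sub>x \<psi>\<close>. The
  coefficients of \<open>(- 4 q\<^sup>2 \<partial>\<^sub>x\<^sup>2)^n\<close> in its Green matrix are \<open>dco\<close> for \<open>\<psi>\<close> in terms of \<open>\<psi>\<close>, \<open>fco\<close> for
  \<open>\<rho>\<close> in terms of \<open>\<rho>\<close>, and, up to a factor \<open>\<plusminus> 2 q \<partial>\<^sub>x\<close>, \<open>eco\<close> for the mixed entries.\<close>

fun dco :: "real \<Rightarrow> nat \<Rightarrow> real \<Rightarrow> real" where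
  "dco a 0 t = 1"
| "dco a (Suc n) t = integral {0..t} (\<lambda>s. exp (- (a * s)) * integral {0..s} (\<lambda>r. exp (a * r) * dco a n r))"

definition eco :: "real \<Rightarrow> nat \<Rightarrow> real \<Rightarrow> real" where
  "eco a n t = exp (- (a * t)) * integral {0..t} (\<lambda>r. exp (a * r) * dco a n r)"

definition fco :: "real \<Rightarrow> nat \<Rightarrow> real \<Rightarrow> real" where
  "fco a n t = dco a n t - a * eco a n t"

lemma dco_Suc: "dco a (Suc n) t = integral {0..t} (eco a n)"
  unfolding eco_def[abs_def] by simp

lemma continuous_dco: "continuous_on {0..} (dco a n)"
  and continuous_eco: "continuous_on {0..} (eco a n)"
proof -
  have e: "continuous_on {0..} (eco a n)" if "continuous_on {0..} (dco a n)" for n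
    unfolding eco_def
    by (intro continuous_on_mult that continuous_on_exp continuous_on_minus continuous_on_mult_left continuous_on_id
        DERIV_continuous_on[OF integral_has_derivative_half_line]) auto
  show d: "continuous_on {0..} (dco a n)"
  proof (induction n)
    case (Suc n)
    have "continuous_on {0..} (\<lambda>t. integral {0..t} (eco a n))"
      by (intro DERIV_continuous_on[OF integral_has_derivative_half_line] e Suc.IH) auto
    then show ?case by (simp add: dco_Suc[abs_def] del: dco.simps)
  qed (simp add: continuous_on_const)
  then show "continuous_on {0..} (eco a n)" by (rule e)
qed

lemma continuous_fco: "continuous_on {0..} (fco a n)"
  unfolding fco_def by (intro continuous_intros continuous_dco continuous_eco)

lemma dco_Suc_deriv:
  "t \<ge> 0 \<Longrightarrow> (dco a (Suc n) has_real_derivative eco a n t) (at t within {0..})"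
  using integral_has_derivative_half_line[OF continuous_eco, of t a n] by (simp add: dco_Suc[abs_def] del: dco.simps)

lemma exp_eco_deriv:
  assumes "t \<ge> 0"
  shows "((\<lambda>t. exp (a * t) * eco a n t) has_real_derivative exp (a * t) * dco a n t) (at t within {0..})"
proof -
  have "(\<lambda>t. exp (a * t) * eco a n t) = (\<lambda>t. integral {0..t} (\<lambda>r. exp (a * r) * dco a n r))"
    by (simp add: eco_def exp_minus fun_eq_iff)
  moreover have "continuous_on {0..} (\<lambda>r. exp (a * r) * dco a n r)"
    by (intro continuous_on_mult continuous_dco continuous_on_exp continuous_on_mult_left continuous_on_id)
  ultimately show ?thesis
    using integral_has_derivative_half_line[of "\<lambda>r. exp (a * r) * dco a n r" t] assms by (simp only:)
qed

lemma exp_times_deriv: "((\<lambda>t. exp (c * t)) has_real_derivative c * exp (c * t)) (at t within S)" for c :: real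
  by (auto intro!: derivative_eq_intros)

lemma exp_minus_deriv: "((\<lambda>t. exp (- (c * t))) has_real_derivative - c * exp (- (c * t))) (at t within S)" for c :: real
  by (auto intro!: derivative_eq_intros)

lemma eco_deriv:
  assumes "t \<ge> 0"
  shows "(eco a n has_real_derivative fco a n t) (at t within {0..})"
proof -
  have "((\<lambda>t. exp (- (a * t)) * (exp (a * t) * eco a n t)) has_real_derivative fco a n t) (at t within {0..})"
    by (rule DERIV_cong[OF DERIV_mult[OF exp_minus_deriv exp_eco_deriv[OF assms]]])
      (simp add: fco_def exp_minus field_simps)
  moreover have "(\<lambda>t. exp (- (a * t)) * (exp (a * t) * eco a n t)) = eco a n"
    by (simp add: exp_minus fun_eq_iff)
  ultimately show ?thesis by simp
qed

lemma eco_0: "eco a n 0 = 0"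
  by (simp add: eco_def)

lemma dco_0: "dco a (Suc n) 0 = 0"
  by (simp add: dco_Suc del: dco.simps)

context
  fixes a :: real
  assumes a: "a > 0"
begin

text \<open>These solve the recursion of \<open>dco\<close> with the second time derivative dropped,
  \<open>a p' = p\<close> with shifted index. They are the coefficients of the slow mode, in which
  the damped variable follows the phase instantaneously.\<close>

definition pco :: "nat \<Rightarrow> real \<Rightarrow> real" where "pco n t = (t / a) ^ n / fact n"

lemma pco_nonneg: "t \<ge> 0 \<Longrightarrow> pco n t \<ge> 0"
  using a by (simp add: pco_def)

lemma pco_Suc_deriv: "(pco (Suc n) has_real_derivative pco n t / a) (at t within S)"
proof -
  have "((\<lambda>t. (t / a) ^ Suc n / fact (Suc n)) has_real_derivative (real (Suc n) * (t / a) ^ n * (1 / a)) / fact (Suc n)) (at t within S)"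
    by (intro DERIV_cdivide DERIV_cong[OF DERIV_power_Suc[OF DERIV_cdivide[OF DERIV_ident]]]) (simp add: mult_ac)
  moreover have "(real (Suc n) * (t / a) ^ n * (1 / a)) / fact (Suc n) = pco n t / a"
    by (simp add: pco_def fact_Suc[of n, where 'a=real] del: of_nat_Suc)
  ultimately show ?thesis unfolding pco_def[abs_def] by (simp only:)
qed

lemma pco_deriv: "\<exists>p. p \<ge> 0 \<and> (pco n has_real_derivative p) (at t within S)" if "t \<ge> 0"
proof (cases n)
  case 0
  then show ?thesis by (intro exI[of _ 0]) (auto simp: pco_def[abs_def])
next
  case (Suc m)
  then show ?thesis using pco_Suc_deriv pco_nonneg[OF that, of m] a by (intro exI[of _ "pco m t / a"]) auto
qed

lemma exp_pco_deriv:
  obtains p where "\<And>t. t \<ge> 0 \<Longrightarrow> p t \<ge> 0"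
    "\<And>t. t \<ge> 0 \<Longrightarrow> ((\<lambda>t. exp (a * t) * pco n t) has_real_derivative exp (a * t) * (a * pco n t + p t)) (at t within {0..})"
    "\<And>t. t \<ge> 0 \<Longrightarrow> ((\<lambda>t. exp (a * t) * (t * pco n t)) has_real_derivative
        exp (a * t) * (a * t * pco n t + pco n t + t * p t)) (at t within {0..})"
proof -
  have "\<forall>t. \<exists>p. t \<ge> 0 \<longrightarrow> p \<ge> 0 \<and> (pco n has_real_derivative p) (at t within {0..})"
    using pco_deriv by blast
  then obtain p where p: "\<And>t. t \<ge> 0 \<Longrightarrow> p t \<ge> 0"
    "\<And>t. t \<ge> 0 \<Longrightarrow> (pco n has_real_derivative p t) (at t within {0..})"
    by metis
  show thesis
  proof (rule that[of p, OF p(1)])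
    fix t :: real assume t: "t \<ge> 0"
    show "((\<lambda>t. exp (a * t) * pco n t) has_real_derivative exp (a * t) * (a * pco n t + p t)) (at t within {0..})"
      by (rule DERIV_cong[OF DERIV_mult[OF exp_times_deriv p(2)[OF t]]]) (simp add: algebra_simps)
    show "((\<lambda>t. exp (a * t) * (t * pco n t)) has_real_derivative
        exp (a * t) * (a * t * pco n t + pco n t + t * p t)) (at t within {0..})"
      by (rule DERIV_cong[OF DERIV_mult[OF exp_times_deriv DERIV_mult[OF DERIV_ident p(2)[OF t]]]]) (simp add: algebra_simps)
  qed
qed

text \<open>Induction on n through \<open>eco\<close>: its form with integrating factor is compared
  with the two supersolutions \<open>exp (a t) p / a\<close> and \<open>exp (a t) t p\<close>. The
  first bound expresses the damping and is good for large t, the second that \<open>eco\<close>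
  vanishes at time zero. Integrating the first bounds the next \<open>dco\<close>.\<close>

lemma dco_bounds:
  assumes "t \<ge> 0"
  shows "0 \<le> dco a n t" "dco a n t \<le> pco n t"
    and eco_nonneg: "0 \<le> eco a n t" and eco_le: "eco a n t \<le> pco n t / a" "eco a n t \<le> t * pco n t"
proof -
  have e: "0 \<le> eco a n t \<and> eco a n t \<le> pco n t / a \<and> eco a n t \<le> t * pco n t"
    if d: "\<And>t. t \<ge> 0 \<Longrightarrow> 0 \<le> dco a n t \<and> dco a n t \<le> pco n t" and t: "t \<ge> 0" for n t
  proof -
    obtain p where p: "\<And>t. t \<ge> 0 \<Longrightarrow> p t \<ge> 0"
      "\<And>t. t \<ge> 0 \<Longrightarrow> ((\<lambda>t. exp (a * t) * pco n t) has_real_derivative exp (a * t) * (a * pco n t + p t)) (at t within {0..})"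
      "\<And>t. t \<ge> 0 \<Longrightarrow> ((\<lambda>t. exp (a * t) * (t * pco n t)) has_real_derivative
        exp (a * t) * (a * t * pco n t + pco n t + t * p t)) (at t within {0..})"
      using exp_pco_deriv by blast
    have "exp (a * t) * eco a n t \<le> exp (a * t) * pco n t / a"
    proof (rule half_line_comparison[where v="\<lambda>t. exp (a * t) * pco n t / a", OF exp_eco_deriv _ _ _ t])
      show "((\<lambda>t. exp (a * t) * pco n t / a) has_real_derivative exp (a * t) * (a * pco n t + p t) / a) (at t within {0..})"
        if "t \<ge> 0" for t using p(2)[OF that] by (rule DERIV_cdivide)
      show "exp (a * t) * dco a n t \<le> exp (a * t) * (a * pco n t + p t) / a" if "t \<ge> 0" for t
      proof -
        have "dco a n t \<le> pco n t + p t / a" using d[OF that] p(1)[OF that] a by (simp add: add_increasing2)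
        then have "exp (a * t) * dco a n t \<le> exp (a * t) * (pco n t + p t / a)" by (intro mult_left_mono) auto
        then show ?thesis using a by (simp add: field_simps)
      qed
    qed (use a pco_nonneg[of 0 n] in \<open>auto simp: eco_0\<close>)
    moreover have "exp (a * t) * eco a n t \<le> exp (a * t) * (t * pco n t)"
    proof (rule half_line_comparison[OF exp_eco_deriv p(3) _ _ t])
      show "exp (a * t) * dco a n t \<le> exp (a * t) * (a * t * pco n t + pco n t + t * p t)" if "t \<ge> 0" for t
      proof -
        have "0 \<le> a * t * pco n t" "0 \<le> t * p t" using a that pco_nonneg[OF that, of n] p(1)[OF that] by auto
        then show ?thesis using d[OF that] by (intro mult_left_mono) auto
      qed
    qed (auto simp: eco_0)
    moreover have "0 \<le> eco a n t"
      unfolding eco_def using d t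
      by (intro mult_nonneg_nonneg integral_nonneg integrable_continuous_real continuous_intros
          continuous_on_subset[OF continuous_dco]) auto
    moreover have "x \<le> y" if "exp (a * t) * x \<le> exp (a * t) * y" for x y using that by simp
    ultimately show ?thesis by (metis times_divide_eq_right)
  qed
  have d: "0 \<le> dco a n t \<and> dco a n t \<le> pco n t" if "t \<ge> 0" for t
    using that
  proof (induction n arbitrary: t)
    case 0
    then show ?case by (simp add: pco_def)
  next
    case (Suc n)
    have "0 \<le> eco a n t" if "t \<ge> 0" for t using e[OF Suc.IH that] by blast
    then have 1: "0 \<le> dco a (Suc n) t"
      unfolding dco_Suc
      by (intro integral_nonneg integrable_continuous_real continuous_on_subset[OF continuous_eco]) auto
    have "dco a (Suc n) t \<le> pco (Suc n) t"
    proof (rule half_line_comparison[OF dco_Suc_deriv pco_Suc_deriv _ _ Suc.prems])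
      show "eco a n t \<le> pco n t / a" if "t \<ge> 0" for t using e[OF Suc.IH that] by blast
      show "dco a (Suc n) 0 \<le> pco (Suc n) 0" unfolding dco_0 by (simp add: pco_def)
    qed
    with 1 show ?case by blast
  qed
  show "0 \<le> dco a n t" "dco a n t \<le> pco n t" using d[OF assms] by blast+
  show "0 \<le> eco a n t" "eco a n t \<le> pco n t / a" "eco a n t \<le> t * pco n t" using e[OF d assms] by blast+
qed

text \<open>For n = 0 this is \<open>exp (- a t)\<close>. For n = m + 1 the recursions give
  \<open>fco' + a fco = eco\<close> with \<open>eco\<close> taken at index m, so the damping yields
  \<open>fco \<le> p / a^2\<close> with p also at index m. Lowering the index by one is what gives
  the factor 1 / t.\<close>

lemma fco_bounds:
  assumes t: "t \<ge> 0"
  shows "0 \<le> fco a n t" "fco a n t \<le> pco n t" "a * t * fco a n t \<le> real (Suc n) * pco n t"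
proof -
  have "0 \<le> a * eco a n t" using a eco_nonneg[OF t] by simp
  then show "fco a n t \<le> pco n t" using dco_bounds(2)[OF t, of n] by (simp add: fco_def)
  show "0 \<le> fco a n t" unfolding fco_def using eco_le(1)[OF t, of n] a
  proof (cases n)
    case 0
    have "exp (a * t) * eco a 0 t \<le> exp (a * t) / a"
      by (rule half_line_comparison[where v="\<lambda>t. exp (a * t) / a" and v'="\<lambda>t. exp (a * t)", OF exp_eco_deriv _ _ _ t])
        (use a in \<open>auto intro!: DERIV_cong[OF DERIV_cdivide[OF exp_times_deriv]] simp: eco_0\<close>)
    then show "0 \<le> dco a n t - a * eco a n t" using a 0 by (simp add: field_simps)
  next
    case (Suc m)
    have "exp (a * t) * eco a (Suc m) t \<le> exp (a * t) * dco a (Suc m) t / a"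
    proof (rule half_line_comparison[where v="\<lambda>t. exp (a * t) * dco a (Suc m) t / a", OF exp_eco_deriv _ _ _ t])
      show "((\<lambda>t. exp (a * t) * dco a (Suc m) t / a) has_real_derivative
          exp (a * t) * dco a (Suc m) t + exp (a * t) * eco a m t / a) (at t within {0..})" if "t \<ge> 0" for t
        using a by (intro DERIV_cong[OF DERIV_cdivide[OF DERIV_mult[OF exp_times_deriv dco_Suc_deriv[OF that]]]])
          (simp add: field_simps del: dco.simps)
    qed (use a eco_nonneg in \<open>auto simp: eco_0 dco_0 simp del: dco.simps\<close>)
    then show "0 \<le> dco a n t - a * eco a n t" using a Suc by (simp add: field_simps del: dco.simps)
  qed
  show "a * t * fco a n t \<le> real (Suc n) * pco n t"
  proof (cases n)
    case 0
    have "exp (a * t) / a - 1 / a \<le> exp (a * t) * eco a 0 t"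
      by (rule half_line_comparison[where u="\<lambda>t. exp (a * t) / a - 1 / a" and u'="\<lambda>t. exp (a * t)", OF _ exp_eco_deriv _ _ t])
        (use a in \<open>auto intro!: DERIV_cong[OF DERIV_diff[OF DERIV_cdivide[OF exp_times_deriv] DERIV_const]] simp: eco_0\<close>)
    then have "exp (a * t) * (a * eco a 0 t) \<ge> exp (a * t) - 1" using a by (simp add: field_simps)
    then have "exp (a * t) * fco a 0 t \<le> 1" by (simp add: fco_def algebra_simps)
    then have "fco a 0 t \<le> exp (- (a * t))" by (simp add: exp_minus field_simps)
    then have "a * t * fco a 0 t \<le> a * t * exp (- (a * t))" using a t by (intro mult_left_mono) auto
    also have "\<dots> \<le> 1" using order_trans[OF _ exp_ge_add_one_self, of "a * t" "a * t"] by (simp add: exp_minus field_simps)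
    finally show ?thesis using 0 by (simp add: pco_def)
  next
    case (Suc m)
    obtain p where p: "\<And>t. t \<ge> 0 \<Longrightarrow> p t \<ge> 0"
      "\<And>t. t \<ge> 0 \<Longrightarrow> ((\<lambda>t. exp (a * t) * pco m t) has_real_derivative exp (a * t) * (a * pco m t + p t)) (at t within {0..})"
      "\<And>t. t \<ge> 0 \<Longrightarrow> ((\<lambda>t. exp (a * t) * (t * pco m t)) has_real_derivative
        exp (a * t) * (a * t * pco m t + pco m t + t * p t)) (at t within {0..})"
      using exp_pco_deriv by blast
    have "exp (a * t) * fco a (Suc m) t \<le> exp (a * t) * pco m t / a\<^sup>2"
    proof (rule half_line_comparison[where u="\<lambda>t. exp (a * t) * fco a (Suc m) t"
          and v="\<lambda>t. exp (a * t) * pco m t / a\<^sup>2", OF _ _ _ _ t])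
      show "((\<lambda>t. exp (a * t) * fco a (Suc m) t) has_real_derivative exp (a * t) * eco a m t) (at t within {0..})"
        if "t \<ge> 0" for t
        unfolding fco_def
        by (rule DERIV_cong[OF DERIV_mult[OF exp_times_deriv DERIV_diff[OF dco_Suc_deriv[OF that] DERIV_cmult[OF eco_deriv[OF that]]]]])
          (simp add: fco_def algebra_simps del: dco.simps)
      show "((\<lambda>t. exp (a * t) * pco m t / a\<^sup>2) has_real_derivative exp (a * t) * (a * pco m t + p t) / a\<^sup>2) (at t within {0..})"
        if "t \<ge> 0" for t using p(2)[OF that] by (rule DERIV_cdivide)
      show "exp (a * t) * eco a m t \<le> exp (a * t) * (a * pco m t + p t) / a\<^sup>2" if "t \<ge> 0" for t
      proof -
        have "eco a m t \<le> pco m t / a + p t / a\<^sup>2" using eco_le(1)[OF that, of m] p(1)[OF that] by (simp add: add_increasing2)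
        then have "exp (a * t) * eco a m t \<le> exp (a * t) * (pco m t / a + p t / a\<^sup>2)" by (intro mult_left_mono) auto
        also have "\<dots> = exp (a * t) * (a * pco m t + p t) / a\<^sup>2" using a by (simp add: field_simps power2_eq_square)
        finally show ?thesis .
      qed
      show "exp (a * 0) * fco a (Suc m) 0 \<le> exp (a * 0) * pco m 0 / a\<^sup>2"
        using pco_nonneg[of 0 m] by (simp add: fco_def eco_0 dco_0 del: dco.simps)
    qed
    moreover have "x \<le> y" if "exp (a * t) * x \<le> exp (a * t) * y" for x y using that by simp
    ultimately have "fco a (Suc m) t \<le> pco m t / a\<^sup>2" by (metis times_divide_eq_right)
    then have "a * t * fco a (Suc m) t \<le> a * t * (pco m t / a\<^sup>2)" using a t by (intro mult_left_mono) auto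
    \<comment> \<open>Raising the index back to m + 1 uses up the factor t and leaves m + 1; this is
      why \<open>dominated\<close> admits the factor n + 1.\<close>
    also have "\<dots> = real (Suc m) * pco (Suc m) t" using a by (simp add: pco_def power2_eq_square divide_simps)
    also have "\<dots> \<le> real (Suc n) * pco n t" using Suc pco_nonneg[OF t, of n] by (intro mult_mono) auto
    finally show ?thesis using Suc by simp
  qed
qed

end

section \<open>The Dyson series\<close>

lemma fact_even_le: "(fact (2 * n) :: real) \<le> (2 ^ n * fact n)\<^sup>2"
proof (induction n)
  case (Suc n)
  have "(fact (2 * Suc n) :: real) = (2 * real n + 2) * (2 * real n + 1) * fact (2 * n)"
    by (simp add: algebra_simps)
  also have "\<dots> \<le> (2 * real n + 2) * (2 * real n + 2) * (2 ^ n * fact n)\<^sup>2"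
    using Suc by (intro mult_mono) auto
  also have "\<dots> = (2 ^ Suc n * fact (Suc n))\<^sup>2" by (simp add: power2_eq_square algebra_simps)
  finally show ?case .
qed simp

lemma sqrt_fact_le:
  assumes "j \<le> 2"
  shows "sqrt (fact (2 * n + j)) \<le> 2 * real (Suc n) * 2 ^ n * fact n"
proof (rule real_le_lsqrt)
  have "(fact (2 * n + j) :: real) \<le> fact (2 * n + 2)" using assms by (intro fact_mono) simp
  also have "\<dots> = (2 * real n + 2) * (2 * real n + 1) * fact (2 * n)"
    by (simp add: algebra_simps)
  also have "\<dots> \<le> (2 * real n + 2) * (2 * real n + 2) * (2 ^ n * fact n)\<^sup>2"
    using fact_even_le[of n] by (intro mult_mono) auto
  also have "\<dots> = (2 * real (Suc n) * 2 ^ n * fact n)\<^sup>2" by (simp add: power2_eq_square algebra_simps)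
  finally show "(fact (2 * n + j) :: real) \<le> (2 * real (Suc n) * 2 ^ n * fact n)\<^sup>2" .
qed auto

locale dyson =
  fixes a bt :: real
  assumes a_pos: "0 < a" and bt_nonneg: "0 \<le> bt" and bt_less: "bt < a"
begin

text \<open>The weight w collects the time dependence beyond the slow mode and is common to all n,
  so that it factors out of the series.\<close>

definition dominated :: "(nat \<Rightarrow> real \<Rightarrow> real) \<Rightarrow> (real \<Rightarrow> real) \<Rightarrow> bool" where
  "dominated c w \<longleftrightarrow> (\<forall>n. continuous_on {0..} (c n)) \<and>
    (\<forall>n. \<forall>t\<ge>0. 0 \<le> c n t \<and> c n t \<le> real (Suc n) * pco a n t * w t \<and> 0 \<le> w t)"

text \<open>One factor n + 1 comes from \<open>dominated\<close>, the other, with the 2, from the at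
  most two additional derivatives in \<open>sqrt_fact_le\<close>.\<close>

definition majorant :: "nat \<Rightarrow> real" where
  "majorant n = 2 * (real (Suc n))\<^sup>2 * (bt / a) ^ n"

definition K :: real where "K = (\<Sum>n. majorant n)"

lemma majorant_nonneg: "0 \<le> majorant n"
  using a_pos bt_nonneg by (simp add: majorant_def)

lemma summable_majorant: "summable majorant"
proof -
  define b where "b = bt / a"
  have b: "0 \<le> b" "b < 1" using a_pos bt_nonneg bt_less by (auto simp: b_def)
  have "(\<lambda>n. b * (1 + 1 / real (Suc n))\<^sup>2) \<longlonglongrightarrow> b * (1 + 0)\<^sup>2"
    by (intro tendsto_intros LIMSEQ_Suc[OF lim_1_over_n])
  then have "eventually (\<lambda>n. b * (1 + 1 / real (Suc n))\<^sup>2 < (1 + b) / 2) sequentially"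
    by (rule order_tendstoD) (use b in simp)
  then obtain N where N: "\<And>n. n \<ge> N \<Longrightarrow> b * (1 + 1 / real (Suc n))\<^sup>2 < (1 + b) / 2"
    unfolding eventually_sequentially by blast
  show ?thesis
  proof (rule summable_ratio_test[of "(1 + b) / 2" N])
    fix n assume n: "N \<le> n"
    have "real (Suc (Suc n)) = real (Suc n) * (1 + 1 / real (Suc n))" by (simp add: field_simps)
    then have "majorant (Suc n) = (b * (1 + 1 / real (Suc n))\<^sup>2) * majorant n"
      unfolding majorant_def b_def[symmetric] by (simp only: power_mult_distrib power_Suc mult_ac)
    also have "\<dots> \<le> (1 + b) / 2 * majorant n"
      using N[OF n] majorant_nonneg by (intro mult_right_mono) auto
    finally show "norm (majorant (Suc n)) \<le> (1 + b) / 2 * norm (majorant n)"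
      using majorant_nonneg by simp
  qed (use b in simp)
qed

lemma K_nonneg: "0 \<le> K"
  unfolding K_def by (rule suminf_nonneg[OF summable_majorant majorant_nonneg])

text \<open>Coefficient and heat operator have separate times because the heat flow over t - s
  advances only the operator: it turns the term at (s, s) into the term at (s, t).\<close>

definition gterm :: "(nat \<Rightarrow> real \<Rightarrow> real) \<Rightarrow> nat \<Rightarrow> nat \<Rightarrow> real \<Rightarrow> real \<Rightarrow> buc \<Rightarrow>\<^sub>L buc" where
  "gterm c j n s t = ((- bt) ^ n * c n s) *\<^sub>R dheat (2 * n + j) t"

definition GS :: "(nat \<Rightarrow> real \<Rightarrow> real) \<Rightarrow> nat \<Rightarrow> real \<Rightarrow> buc \<Rightarrow>\<^sub>L buc" where
  "GS c j t = (\<Sum>n. gterm c j n t t)"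

text \<open>Everything cancels: the coefficient contributes \<open>t^n / (a^n n!)\<close>, the
  derivatives of the heat kernel at most \<open>n! / t^n\<close> up to a factor linear in n, and
  \<open>(bt / a)^n\<close> remains. At t = 0 division by zero gives zero on both sides, except for
  n = j = 0.\<close>

lemma norm_gterm_le:
  assumes c: "dominated c w" and j: "j \<le> 2" and s: "0 \<le> s" "s \<le> t"
  shows "norm (gterm c j n s t) \<le> majorant n * w s / sqrt t ^ j"
proof (cases "t = 0")
  case True
  then have [simp]: "s = 0" "t = 0" using s by auto
  have w: "0 \<le> w 0" and c0: "0 \<le> c n 0" "c n 0 \<le> real (Suc n) * pco a n 0 * w 0"
    using c unfolding dominated_def by auto
  show ?thesis
  proof (cases "2 * n + j")
    case 0
    then have [simp]: "n = 0" "j = 0" by auto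
    have "norm (dheat 0 0) \<le> 1" using norm_dheat[of 0 0] by simp
    moreover have "c 0 0 \<le> w 0" using c0 by (simp add: pco_def[OF a_pos])
    ultimately have "\<bar>c 0 0\<bar> * norm (dheat 0 0) \<le> w 0 * 1"
      using c0 w by (intro mult_mono) auto
    then show ?thesis using w by (simp add: gterm_def majorant_def)
  next
    case (Suc m)
    then show ?thesis unfolding gterm_def using majorant_nonneg[of n] w by simp
  qed
next
  case False
  then have t: "t > 0" using s by simp
  have w: "0 \<le> w s" and c0: "0 \<le> c n s" "c n s \<le> real (Suc n) * pco a n s * w s"
    using c s unfolding dominated_def by auto
  \<comment> \<open>The powers of time cancel only if coefficient and kernel have the same time;
    monotonicity permits replacing s by t.\<close>
  have "pco a n s \<le> pco a n t"
    unfolding pco_def[OF a_pos] using s a_pos by (intro divide_right_mono power_mono) auto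
  then have c1: "c n s \<le> real (Suc n) * pco a n t * w s"
    using c0(2) w by (meson mult_left_mono mult_right_mono of_nat_0_le_iff order_trans)
  have sq: "sqrt t ^ j \<le> sqrt (2 * t) ^ j" using t by (intro power_mono) auto
  have "norm (gterm c j n s t) = bt ^ n * c n s * norm (dheat (2 * n + j) t)"
    using c0 bt_nonneg by (simp add: gterm_def abs_mult power_abs)
  also have "\<dots> \<le> bt ^ n * (real (Suc n) * pco a n t * w s) * (sqrt (fact (2 * n + j)) / sqrt (2 * t) ^ (2 * n + j))"
    using c1 c0 norm_dheat[of "2 * n + j" t] t bt_nonneg by (intro mult_mono) auto
  also have "\<dots> \<le> bt ^ n * (real (Suc n) * pco a n t * w s) *
      (2 * real (Suc n) * 2 ^ n * fact n / ((2 * t) ^ n * sqrt t ^ j))"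
  proof -
    have "sqrt (2 * t) ^ (2 * n + j) = (2 * t) ^ n * sqrt (2 * t) ^ j"
      using t by (simp add: power_add power_mult)
    then have "sqrt (fact (2 * n + j)) / sqrt (2 * t) ^ (2 * n + j)
        \<le> 2 * real (Suc n) * 2 ^ n * fact n / ((2 * t) ^ n * sqrt t ^ j)"
      using t sq sqrt_fact_le[OF j, of n] by (intro frac_le) auto
    then show ?thesis using bt_nonneg w t a_pos pco_nonneg[OF a_pos, of t n] by (intro mult_left_mono mult_nonneg_nonneg) auto
  qed
  also have "\<dots> = majorant n * w s / sqrt t ^ j"
    using t a_pos by (simp add: majorant_def pco_def[OF a_pos] power_mult_distrib power_divide field_simps power2_eq_square)
  finally show ?thesis .
qed

lemma
  assumes c: "dominated c w" and j: "j \<le> 2" and s: "0 \<le> s" "s \<le> t"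
  shows summable_norm_gterm: "summable (\<lambda>n. norm (gterm c j n s t))"
    and norm_suminf_gterm: "norm (\<Sum>n. gterm c j n s t) \<le> K * w s / sqrt t ^ j"
proof -
  have sm: "summable (\<lambda>n. majorant n * w s / sqrt t ^ j)"
    by (intro summable_divide summable_mult2 summable_majorant)
  show sn: "summable (\<lambda>n. norm (gterm c j n s t))"
    by (rule summable_comparison_test'[OF sm]) (use norm_gterm_le[OF assms] in auto)
  have "norm (\<Sum>n. gterm c j n s t) \<le> (\<Sum>n. majorant n * w s / sqrt t ^ j)"
    by (rule order_trans[OF summable_norm[OF sn] suminf_le[OF norm_gterm_le[OF assms] sn sm]])
  also have "\<dots> = K * w s / sqrt t ^ j"
    unfolding K_def using suminf_mult2[OF summable_majorant, of "w s / sqrt t ^ j"] by (simp add: mult.assoc)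
  finally show "norm (\<Sum>n. gterm c j n s t) \<le> K * w s / sqrt t ^ j" .
qed

lemma norm_GS:
  assumes "dominated c w" "j \<le> 2" "0 \<le> t"
  shows "norm (GS c j t) \<le> K * w t / sqrt t ^ j"
  unfolding GS_def using norm_suminf_gterm[OF assms(1,2,3) order_refl] .

lemma gterm_sums:
  assumes "dominated c w" "j \<le> 2" "0 \<le> s" "s \<le> t"
  shows "(\<lambda>n. gterm c j n s t f) sums ((\<Sum>n. gterm c j n s t) f)"
  using bounded_linear.sums[OF blinfun.bounded_linear_left
      summable_sums[OF summable_norm_cancel[OF summable_norm_gterm[OF assms]]], of f] .

lemma GS_sums:
  assumes "dominated c w" "j \<le> 2" "0 \<le> t"
  shows "(\<lambda>n. gterm c j n t t f) sums GS c j t f"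
  unfolding GS_def using gterm_sums[OF assms order_refl] .

lemma gterm_apply: "gterm c j n s t f = ((- bt) ^ n * c n s) *\<^sub>R dheat (2 * n + j) t f"
  by (simp add: gterm_def scaleR_blinfun.rep_eq)

lemma GS_at_0:
  assumes "dominated c w" "0 < j" "j \<le> 2"
  shows "GS c j 0 = 0"
proof -
  have "gterm c j n 0 0 = 0" for n
    using assms(2) by (cases "2 * n + j") (auto simp: gterm_def)
  then show ?thesis by (simp add: GS_def)
qed

lemma GS_0_at_0:
  assumes "dominated c w"
  shows "GS c 0 0 f = c 0 0 *\<^sub>R f"
proof -
  have g: "gterm c 0 n 0 0 f = (if n = 0 then c 0 0 *\<^sub>R f else 0)" for n
    by (cases n) (auto simp: gterm_apply)
  have "(\<lambda>n. gterm c 0 n 0 0 f) sums (c 0 0 *\<^sub>R f)"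
    unfolding g by (rule sums_single)
  then show ?thesis using GS_sums[OF assms, of 0 0 f] sums_unique2 by auto
qed

lemma bderiv_GS:
  assumes c: "dominated c w" and j: "j < 2" and t: "0 < t"
  shows "bderiv (GS c j t f) (GS c (Suc j) t f)"
proof (rule bderiv_sums)
  show "(\<lambda>n. gterm c j n t t f) sums GS c j t f" using GS_sums[OF c] j t by simp
  show "(\<lambda>n. gterm c (Suc j) n t t f) sums GS c (Suc j) t f" using GS_sums[OF c] j t by simp
  show "bderiv (gterm c j n t t f) (gterm c (Suc j) n t t f)" for n
    unfolding gterm_apply using bderiv_dheat[OF t, of "2 * n + j" f] by (auto intro: bderiv_scaleR)
qed

lemma bderiv_GS_commute:
  assumes c: "dominated c w" and j: "j \<le> 2" and t: "0 \<le> t" and f: "bderiv f f'"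
  shows "bderiv (GS c j t f) (GS c j t f')"
proof (rule bderiv_sums[OF _ GS_sums[OF c j t] GS_sums[OF c j t]])
  show "bderiv (gterm c j n t t f) (gterm c j n t t f')" for n
    unfolding gterm_apply by (intro bderiv_scaleR bderiv_dheat_commute f)
qed

text \<open>Differentiating the image of f once through the datum and once through the kernel gives
  the same function.\<close>

lemma GS_deriv:
  assumes c: "dominated c w" and j: "j < 2" and t: "0 < t" and f: "bderiv f f'"
  shows "GS c j t f' = GS c (Suc j) t f"
  using bderiv_unique[OF bderiv_GS_commute[OF c _ _ f] bderiv_GS[OF c j t]] j t by auto

text \<open>The M-test reduces the claim to single terms; the factor \<open>sqrt t ^ k\<close> is
  there to absorb a singularity at zero. For a term with derivatives the bounds alone give only
  boundedness near t = 0. Convergence to zero comes from the continuity of \<open>hconv\<close>,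
  which vanishes at t = 0 because Hermite functions of positive index have mean zero.\<close>

lemma continuous_GS:
  assumes c: "dominated c w" and j: "j \<le> 2"
    and C: "\<And>t. t \<ge> 0 \<Longrightarrow> sqrt t ^ k * w t / sqrt t ^ j \<le> C"
  shows "continuous_on {0..} (\<lambda>t. sqrt t ^ k *\<^sub>R GS c j t f)"
proof -
  define \<tau> where "\<tau> n t = sqrt t ^ k *\<^sub>R gterm c j n t t f" for n t
  have w: "0 \<le> w t" if "t \<ge> 0" for t using c that unfolding dominated_def by auto
  have bound: "norm (\<tau> n t) \<le> majorant n * (C * norm f)" if t: "t \<in> {0..}" for n t
  proof -
    have "norm (\<tau> n t) \<le> sqrt t ^ k * (norm (gterm c j n t t) * norm f)"
      using norm_blinfun[of "gterm c j n t t" f] t by (simp add: \<tau>_def mult_left_mono)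
    also have "\<dots> \<le> sqrt t ^ k * ((majorant n * w t / sqrt t ^ j) * norm f)"
      using norm_gterm_le[OF c j, of t t n] t by (intro mult_left_mono mult_right_mono) auto
    also have "\<dots> = majorant n * ((sqrt t ^ k * w t / sqrt t ^ j) * norm f)" by simp
    also have "\<dots> \<le> majorant n * (C * norm f)"
      using C t majorant_nonneg by (intro mult_left_mono mult_right_mono) auto
    finally show ?thesis .
  qed
  have cont: "continuous_on {0..} (\<tau> n)" for n
  proof (cases "2 * n + j")
    case 0
    then have "n = 0" "j = 0" by auto
    then show ?thesis unfolding \<tau>_def gterm_apply
      using c continuous_hconv[of 0 f] unfolding dominated_def
      by (auto simp: dheat_0 intro!: continuous_intros)
  next
    case (Suc m)
    \<comment> \<open>Constant in t: the n-th power of time in the coefficient cancels that of the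
      kernel, and C bounds the rest.\<close>
    define B where "B t = (bt / (2 * a)) ^ n * (real (Suc n) / fact n) * C" for t :: real
    show ?thesis
      unfolding continuous_on_def
    proof
      fix t :: real assume t: "t \<in> {0..}"
      show "(\<tau> n \<longlongrightarrow> \<tau> n t) (at t within {0..})"
      proof (cases "t = 0")
        case False
        then have t: "t > 0" using t by simp
        have "continuous_on {0<..} (\<tau> n)"
          unfolding \<tau>_def gterm_apply using c unfolding dominated_def
          by (intro continuous_intros continuous_dheat_pos) (auto intro: continuous_on_subset)
        then have "isCont (\<tau> n) t" using t by (simp add: continuous_on_eq_continuous_at)
        then show ?thesis unfolding isCont_def by (rule tendsto_within_subset) simp
      next
        case True
        have z: "\<tau> n t = 0" using True Suc by (simp add: \<tau>_def gterm_def)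
        have hb: "norm (\<tau> n s) \<le> B s * norm (hconv (Suc m) s f)" if s: "s \<in> {0..}" for s
        proof (cases "s = 0")
          case True
          then show ?thesis using Suc by (simp add: \<tau>_def gterm_def hconv_Suc_0)
        next
          case False
          then have s: "s > 0" using s by simp
          have cn: "0 \<le> c n s" "c n s \<le> real (Suc n) * pco a n s * w s"
            using c s unfolding dominated_def by auto
          have sq: "sqrt (2 * s) ^ (2 * n + j) = (2 * s) ^ n * sqrt (2 * s) ^ j"
            using s by (simp add: power_add power_mult)
          have "norm (\<tau> n s) = bt ^ n * (sqrt s ^ k * c n s / sqrt (2 * s) ^ (2 * n + j)) * norm (hconv (Suc m) s f)"
            unfolding \<tau>_def gterm_apply dheat_apply Suc[symmetric] using s cn bt_nonneg by (simp add: abs_mult power_abs)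
          also have "\<dots> \<le> bt ^ n * ((1 / (2 * a)) ^ n * (real (Suc n) / fact n) * C) * norm (hconv (Suc m) s f)"
          proof (intro mult_right_mono mult_left_mono)
            have "sqrt s ^ k * c n s / sqrt (2 * s) ^ (2 * n + j)
                \<le> sqrt s ^ k * (real (Suc n) * pco a n s * w s) / ((2 * s) ^ n * sqrt s ^ j)"
              unfolding sq using s cn w[of s] pco_nonneg[OF a_pos, of s n] by (intro frac_le mult_left_mono mult_nonneg_nonneg) (auto intro!: power_mono)
            also have "\<dots> = (1 / (2 * a)) ^ n * (real (Suc n) / fact n) * (sqrt s ^ k * w s / sqrt s ^ j)"
              using s a_pos by (simp add: pco_def[OF a_pos] power_divide power_mult_distrib mult_ac)
            also have "\<dots> \<le> (1 / (2 * a)) ^ n * (real (Suc n) / fact n) * C"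
              using C[of s] s a_pos by (intro mult_left_mono) auto
            finally show "sqrt s ^ k * c n s / sqrt (2 * s) ^ (2 * n + j) \<le> (1 / (2 * a)) ^ n * (real (Suc n) / fact n) * C" .
          qed (use bt_nonneg in auto)
          also have "\<dots> = B s * norm (hconv (Suc m) s f)" by (simp add: B_def power_divide)
          finally show ?thesis .
        qed
        have "((\<lambda>s. hconv (Suc m) s f) \<longlongrightarrow> hconv (Suc m) 0 f) (at t within {0..})"
          using continuous_hconv[of "Suc m" f] True unfolding continuous_on_def by auto
        then have "((\<lambda>s. B s * norm (hconv (Suc m) s f)) \<longlongrightarrow> B t * norm (0::buc)) (at t within {0..})"
          unfolding hconv_Suc_0 B_def by (intro tendsto_intros)
        then have "((\<lambda>s. B s * norm (hconv (Suc m) s f)) \<longlongrightarrow> 0) (at t within {0..})" by simp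
        then have "(\<tau> n \<longlongrightarrow> 0) (at t within {0..})"
          by (rule Lim_null_comparison[rotated]) (use hb in \<open>auto simp: eventually_at_filter\<close>)
        then show ?thesis unfolding z .
      qed
    qed
  qed
  have ul: "uniform_limit {0..} (\<lambda>N t. \<Sum>n<N. \<tau> n t) (\<lambda>t. \<Sum>n. \<tau> n t) sequentially"
    by (rule Weierstrass_m_test[OF bound summable_mult2[OF summable_majorant]])
  have "continuous_on {0..} (\<lambda>t. \<Sum>n. \<tau> n t)"
    by (rule uniform_limit_theorem[OF _ ul]) (auto intro!: always_eventually continuous_intros cont)
  moreover have "(\<Sum>n. \<tau> n t) = sqrt t ^ k *\<^sub>R GS c j t f" if "t \<in> {0..}" for t
    unfolding \<tau>_def using sums_scaleR_right[OF GS_sums[OF c j, of t f], of "sqrt t ^ k"] that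
    by (simp add: sums_iff)
  ultimately show ?thesis by (rule continuous_on_eq)
qed

lemma dheat_GS:
  assumes c: "dominated c w" and j: "j \<le> 2" and s: "0 < s" "s \<le> t"
  shows "dheat 0 (t - s) (GS c j s f) = (\<Sum>n. gterm c j n s t) f"
proof -
  have "(\<lambda>n. dheat 0 (t - s) (gterm c j n s s f)) sums dheat 0 (t - s) (GS c j s f)"
    using s by (intro bounded_linear.sums[OF blinfun.bounded_linear_right] GS_sums[OF c j]) auto
  moreover have "dheat 0 (t - s) (gterm c j n s s f) = gterm c j n s t f" for n
    unfolding gterm_apply using dheat_semigroup[of s "t - s" "2 * n + j" f] s
    by (simp add: blinfun.scaleR_right)
  ultimately show ?thesis using gterm_sums[OF c j _ s(2), of f] s by (auto intro: sums_unique2)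
qed

text \<open>The semigroup law turns \<open>exp((t - s) \<partial>\<^sub>x\<^sup>2) \<partial>\<^sub>x\<^sup>m exp(s \<partial>\<^sub>x\<^sup>2)\<close> into \<open>\<partial>\<^sub>x\<^sup>m exp(t \<partial>\<^sub>x\<^sup>2)\<close>, so that only the
  scalar coefficients have to be integrated.\<close>

lemma heat_convolution_GS:
  assumes c: "dominated c w" and j: "j \<le> 2" and t: "0 < t"
    and W: "\<And>s. 0 \<le> s \<Longrightarrow> s \<le> t \<Longrightarrow> w s \<le> W"
    and C: "\<And>n s. 0 \<le> s \<Longrightarrow> (C n has_real_derivative c n s) (at s within {0..})"
  obtains J where "(\<lambda>n. ((- bt) ^ n * (C n t - C n 0)) *\<^sub>R dheat (2 * n + j) t f) sums J"
    "((\<lambda>s. dheat 0 (t - s) (GS c j s f)) has_integral J) {0..t}"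
proof -
  define h where "h n s = gterm c j n s t f" for n s
  have bound: "norm (h n s) \<le> majorant n * (W / sqrt t ^ j * norm f)" if s: "s \<in> {0..t}" for n s
  proof -
    have "norm (h n s) \<le> norm (gterm c j n s t) * norm f" unfolding h_def by (rule norm_blinfun)
    also have "\<dots> \<le> (majorant n * w s / sqrt t ^ j) * norm f"
      using norm_gterm_le[OF c j, of s t n] s by (intro mult_right_mono) auto
    also have "\<dots> \<le> (majorant n * W / sqrt t ^ j) * norm f"
      using W s t majorant_nonneg by (intro mult_right_mono divide_right_mono mult_left_mono) auto
    finally show ?thesis by (simp add: mult.assoc)
  qed
  have ul: "uniform_limit {0..t} (\<lambda>N s. \<Sum>n<N. h n s) (\<lambda>s. \<Sum>n. h n s) sequentially"
    by (rule Weierstrass_m_test[OF bound summable_mult2[OF summable_majorant]])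
  have cc: "continuous_on {0..t} (c n)" for n
    using c unfolding dominated_def by (auto intro: continuous_on_subset)
  have ch: "continuous_on {0..t} (\<lambda>s. \<Sum>n<N. h n s)" for N
    unfolding h_def gterm_apply by (intro continuous_intros cc)
  obtain I J where IJ: "\<And>N. ((\<lambda>s. \<Sum>n<N. h n s) has_integral I N) {0..t}"
    "((\<lambda>s. \<Sum>n. h n s) has_integral J) {0..t}" "I \<longlonglongrightarrow> J"
    using uniform_limit_integral[OF ul ch sequentially_bot] by metis
  have "(c n has_integral (C n t - C n 0)) {0..t}" for n
  proof (rule fundamental_theorem_of_calculus)
    show "(C n has_vector_derivative c n s) (at s within {0..t})" if "s \<in> {0..t}" for s
      using C[of s n] that unfolding has_real_derivative_iff_has_vector_derivative
      by (auto intro: has_vector_derivative_within_subset)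
  qed (use t in simp)
  then have "(h n has_integral ((- bt) ^ n * (C n t - C n 0)) *\<^sub>R dheat (2 * n + j) t f) {0..t}" for n
    unfolding h_def gterm_apply by (intro has_integral_scaleR_left has_integral_mult_right)
  then have "((\<lambda>s. \<Sum>n<N. h n s) has_integral (\<Sum>n<N. ((- bt) ^ n * (C n t - C n 0)) *\<^sub>R dheat (2 * n + j) t f)) {0..t}" for N
    by (intro has_integral_sum) auto
  then have "I = (\<lambda>N. \<Sum>n<N. ((- bt) ^ n * (C n t - C n 0)) *\<^sub>R dheat (2 * n + j) t f)"
    using IJ(1) has_integral_unique by blast
  then have "(\<lambda>n. ((- bt) ^ n * (C n t - C n 0)) *\<^sub>R dheat (2 * n + j) t f) sums J"
    using IJ(3) unfolding sums_def by simp
  moreover have "((\<lambda>s. dheat 0 (t - s) (GS c j s f)) has_integral J) {0..t}"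
  proof (rule has_integral_spike_finite[OF _ _ IJ(2), of "{0}"])
    fix s assume "s \<in> {0..t} - {0}"
    then have s: "0 < s" "s \<le> t" by auto
    show "dheat 0 (t - s) (GS c j s f) = (\<Sum>n. h n s)"
      using dheat_GS[OF c j s, of f] gterm_sums[OF c j _ s(2), of f] s by (simp add: h_def sums_iff)
  qed simp
  ultimately show thesis by (rule that)
qed

section \<open>The three coefficient families and their convolutions with the heat semigroup\<close>

lemma dominated_dco: "dominated (dco a) (\<lambda>_. 1)"
  unfolding dominated_def
proof (intro conjI allI impI continuous_dco)
  fix n and t :: real assume t: "0 \<le> t"
  have "dco a n t \<le> pco a n t" using dco_bounds(2)[OF a_pos t] .
  moreover have "0 \<le> real n * pco a n t" using pco_nonneg[OF a_pos t] by simp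
  ultimately show "dco a n t \<le> real (Suc n) * pco a n t * 1" by (simp add: algebra_simps)
qed (auto intro: dco_bounds[OF a_pos])

text \<open>Adding \<open>eco \<le> t p\<close> and \<open>a t eco \<le> t p\<close> gives the
  weight: it is linear at time zero and bounded at infinity.\<close>

lemma dominated_eco: "dominated (eco a) (\<lambda>t. 2 * t / (1 + a * t))"
  unfolding dominated_def
proof (intro conjI allI impI continuous_eco)
  fix n and t :: real assume t: "0 \<le> t"
  have p: "0 \<le> pco a n t" by (rule pco_nonneg[OF a_pos t])
  have at: "0 < 1 + a * t" using a_pos t by (simp add: add_pos_nonneg)
  have "a * eco a n t \<le> pco a n t" using eco_le(1)[OF a_pos t, of n] a_pos by (simp add: field_simps)
  then have "t * (a * eco a n t) \<le> t * pco a n t" using t by (intro mult_left_mono)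
  then have "(1 + a * t) * eco a n t \<le> pco a n t * (2 * t)"
    using eco_le(2)[OF a_pos t, of n] by (simp add: algebra_simps)
  then have "eco a n t \<le> pco a n t * (2 * t / (1 + a * t))" using at by (simp add: field_simps)
  also have "\<dots> \<le> real (Suc n) * (pco a n t * (2 * t / (1 + a * t)))"
    using mult_right_mono[of 1 "real (Suc n)" "pco a n t * (2 * t / (1 + a * t))"] p t at by simp
  finally show "eco a n t \<le> real (Suc n) * pco a n t * (2 * t / (1 + a * t))" by (simp only: mult.assoc)
  show "0 \<le> 2 * t / (1 + a * t)" using t at by simp
qed (auto intro: eco_nonneg[OF a_pos])

text \<open>Again two bounds are added, one without and one with the factor a t; the resulting
  weight decays like 1 / t.\<close>

lemma dominated_fco: "dominated (fco a) (\<lambda>t. 2 / (1 + a * t))"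
  unfolding dominated_def
proof (intro conjI allI impI continuous_fco)
  fix n and t :: real assume t: "0 \<le> t"
  have p: "0 \<le> pco a n t" by (rule pco_nonneg[OF a_pos t])
  have at: "0 < 1 + a * t" using a_pos t by (simp add: add_pos_nonneg)
  have "0 \<le> real n * pco a n t" using p by simp
  then have "fco a n t + a * t * fco a n t \<le> 2 * (real (Suc n) * pco a n t)"
    using fco_bounds(2,3)[OF a_pos t, of n] by (simp add: algebra_simps)
  then have "(1 + a * t) * fco a n t \<le> 2 * (real (Suc n) * pco a n t)" by (simp add: algebra_simps)
  then show "fco a n t \<le> real (Suc n) * pco a n t * (2 / (1 + a * t))" using at by (simp add: field_simps)
  show "0 \<le> 2 / (1 + a * t)" using at by simp
qed (auto intro: fco_bounds[OF a_pos])

lemma GS_fco: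
  assumes "j \<le> 2" "0 \<le> t"
  shows "GS (fco a) j t f = GS (dco a) j t f - a *\<^sub>R GS (eco a) j t f"
proof -
  have "(\<lambda>n. gterm (dco a) j n t t f - a *\<^sub>R gterm (eco a) j n t t f) sums
      (GS (dco a) j t f - a *\<^sub>R GS (eco a) j t f)"
    by (intro sums_diff sums_scaleR_right GS_sums[OF dominated_dco] GS_sums[OF dominated_eco] assms)
  moreover have "gterm (dco a) j n t t f - a *\<^sub>R gterm (eco a) j n t t f = gterm (fco a) j n t t f" for n
    by (simp add: gterm_apply fco_def right_diff_distrib scaleR_left_diff_distrib mult_ac)
  ultimately show ?thesis using GS_sums[OF dominated_fco assms, of f] by (auto intro: sums_unique2)
qed

text \<open>\<open>eco\<close> is the antiderivative of \<open>fco\<close> that vanishes at zero, so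
  the terms integrate one by one to those of the mixed entry.\<close>

lemma heat_convolution_fco:
  assumes t: "0 \<le> t"
  shows "((\<lambda>s. dheat 0 (t - s) (GS (fco a) 0 s f)) has_integral GS (eco a) 0 t f) {0..t}"
proof (cases "t = 0")
  case True
  then show ?thesis by (simp add: GS_0_at_0[OF dominated_eco] eco_0 has_integral_refl)
next
  case False
  then have t: "0 < t" using t by simp
  obtain J where J: "(\<lambda>n. ((- bt) ^ n * (eco a n t - eco a n 0)) *\<^sub>R dheat (2 * n + 0) t f) sums J"
    "((\<lambda>s. dheat 0 (t - s) (GS (fco a) 0 s f)) has_integral J) {0..t}"
  proof (rule heat_convolution_GS[OF dominated_fco _ t])
    show "2 / (1 + a * s) \<le> 2" if "0 \<le> s" for s
      using a_pos that by (simp add: divide_le_eq add_pos_nonneg)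
  qed (auto intro: eco_deriv)
  have "J = GS (eco a) 0 t f"
    using sums_unique2[OF J(1)] GS_sums[OF dominated_eco, of 0 t f] t by (simp add: gterm_apply eco_0)
  then show ?thesis using J(2) by simp
qed

text \<open>Integrating \<open>eco\<close> raises the index of \<open>dco\<close> by one, and the
  factor bt with two derivatives supplies the missing power up to sign. The result is minus the
  \<open>dco\<close> series without its zeroth term, and that term is the heat semigroup.\<close>

lemma heat_convolution_eco:
  assumes t: "0 \<le> t"
  shows "((\<lambda>s. bt *\<^sub>R dheat 0 (t - s) (GS (eco a) 2 s f)) has_integral (dheat 0 t f - GS (dco a) 0 t f)) {0..t}"
proof (cases "t = 0")
  case True
  then show ?thesis by (simp add: GS_0_at_0[OF dominated_dco] has_integral_refl)
next
  case False
  then have t: "0 < t" using t by simp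
  obtain J where J: "(\<lambda>n. ((- bt) ^ n * (dco a (Suc n) t - dco a (Suc n) 0)) *\<^sub>R dheat (2 * n + 2) t f) sums J"
    "((\<lambda>s. dheat 0 (t - s) (GS (eco a) 2 s f)) has_integral J) {0..t}"
  proof (rule heat_convolution_GS[where f=f and C="\<lambda>n. dco a (Suc n)" and W="2 * t" and j=2, OF dominated_eco _ t])
    show "2 * s / (1 + a * s) \<le> 2 * t" if "0 \<le> s" "s \<le> t" for s
    proof -
      have "2 * s / (1 + a * s) \<le> 2 * s / 1"
        using a_pos that add_pos_nonneg[of 1 "a * s"] by (intro divide_left_mono) auto
      then show ?thesis using that by simp
    qed
  qed (auto intro: dco_Suc_deriv simp del: dco.simps)
  have g0: "gterm (dco a) 0 0 t t f = dheat 0 t f" by (simp add: gterm_apply)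
  have "(\<lambda>n. gterm (dco a) 0 (Suc n) t t f) sums (GS (dco a) 0 t f - dheat 0 t f)"
    unfolding g0[symmetric] using GS_sums[OF dominated_dco, of 0 t f] t
    by (subst sums_Suc_iff) simp
  then have "(\<lambda>n. - gterm (dco a) 0 (Suc n) t t f) sums - (GS (dco a) 0 t f - dheat 0 t f)"
    by (rule sums_minus)
  moreover have "- gterm (dco a) 0 (Suc n) t t f
      = bt *\<^sub>R (((- bt) ^ n * (dco a (Suc n) t - dco a (Suc n) 0)) *\<^sub>R dheat (2 * n + 2) t f)" for n
    by (simp add: gterm_apply dco_0 del: dco.simps)
  ultimately have "bt *\<^sub>R J = dheat 0 t f - GS (dco a) 0 t f"
    using sums_unique2[OF sums_scaleR_right[OF J(1), of bt]] by simp
  then show ?thesis using has_integral_cmul[OF J(2), of bt] by simp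
qed

end

section \<open>Convolution in time\<close>

text \<open>Continuity is required vector by vector, since the heat semigroup is not norm continuous
  at time zero; the local bound makes up for this in joint limits.\<close>

definition strong_cont :: "(real \<Rightarrow> 'b::banach \<Rightarrow>\<^sub>L 'c::banach) \<Rightarrow> bool" where
  "strong_cont Q \<longleftrightarrow> (\<forall>f. continuous_on {0..} (\<lambda>t. Q t f)) \<and>
     (\<forall>T. \<exists>B. \<forall>t\<in>{0..T}. norm (Q t) \<le> B)"

text \<open>Split the vector into its limit and a remainder: strong continuity handles the first,
  the local bound the second.\<close>

lemma strong_cont_apply:
  fixes p :: "'a::metric_space \<Rightarrow> real"
  assumes Q: "strong_cont Q" and p: "continuous_on A p" "\<And>x. x \<in> A \<Longrightarrow> 0 \<le> p x"
    and m: "continuous_on A m"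
  shows "continuous_on A (\<lambda>x. Q (p x) (m x))"
  unfolding continuous_on_def
proof
  fix x0 assume x0: "x0 \<in> A"
  obtain B where B: "\<And>t. 0 \<le> t \<Longrightarrow> t \<le> p x0 + 1 \<Longrightarrow> norm (Q t) \<le> B"
    using Q unfolding strong_cont_def by (metis atLeastAtMost_iff)
  have pl: "(p \<longlongrightarrow> p x0) (at x0 within A)" and ml: "(m \<longlongrightarrow> m x0) (at x0 within A)"
    using p m x0 unfolding continuous_on_def by auto
  have "((\<lambda>t. Q t (m x0)) \<longlongrightarrow> Q (p x0) (m x0)) (at (p x0) within {0..})"
    using Q p(2)[OF x0] unfolding strong_cont_def continuous_on_def by auto
  then have "continuous (at (p x0) within {0..}) (\<lambda>t. Q t (m x0))" by (simp add: continuous_within)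
  then have "((\<lambda>x. Q (p x) (m x0)) \<longlongrightarrow> Q (p x0) (m x0)) (at x0 within A)"
    by (rule continuous_within_tendsto_compose[OF _ _ pl])
      (use p(2) in \<open>auto simp: eventually_at_filter\<close>)
  moreover have "((\<lambda>x. Q (p x) (m x - m x0)) \<longlongrightarrow> 0) (at x0 within A)"
  proof (rule Lim_null_comparison)
    have "eventually (\<lambda>x. p x < p x0 + 1) (at x0 within A)"
      by (rule order_tendstoD[OF pl]) simp
    moreover have "eventually (\<lambda>x. x \<in> A) (at x0 within A)" by (simp add: eventually_at_filter)
    ultimately show "eventually (\<lambda>x. norm (Q (p x) (m x - m x0)) \<le> B * norm (m x - m x0)) (at x0 within A)"
    proof eventually_elim
      case (elim x)
      then have "norm (Q (p x)) \<le> B" using B p(2) by simp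
      then show ?case by (meson mult_right_mono norm_blinfun norm_ge_zero order_trans)
    qed
    show "((\<lambda>x. B * norm (m x - m x0)) \<longlongrightarrow> 0) (at x0 within A)"
      using ml by (intro tendsto_mult_right_zero tendsto_norm_zero) (simp add: LIM_zero)
  qed
  ultimately have "((\<lambda>x. Q (p x) (m x0) + Q (p x) (m x - m x0)) \<longlongrightarrow> Q (p x0) (m x0) + 0) (at x0 within A)"
    by (rule tendsto_add)
  then show "((\<lambda>x. Q (p x) (m x)) \<longlongrightarrow> Q (p x0) (m x0)) (at x0 within A)"
    by (simp add: blinfun.diff_right)
qed

lemma strong_cont_sqrt: "strong_cont P \<Longrightarrow> strong_cont (\<lambda>t. sqrt t *\<^sub>R P t)"
  unfolding strong_cont_def
proof (intro conjI allI)
  assume P: "(\<forall>f. continuous_on {0..} (\<lambda>t. P t f)) \<and> (\<forall>T. \<exists>B. \<forall>t\<in>{0..T}. norm (P t) \<le> B)"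
  show "continuous_on {0..} (\<lambda>t. (sqrt t *\<^sub>R P t) f)" for f
    unfolding scaleR_blinfun.rep_eq
    by (intro continuous_on_scaleR continuous_on_real_sqrt continuous_on_id) (use P in blast)
  show "\<exists>B. \<forall>t\<in>{0..T}. norm (sqrt t *\<^sub>R P t) \<le> B" for T
  proof -
    obtain B where B: "\<forall>t\<in>{0..T}. norm (P t) \<le> B" using P by blast
    have "norm (sqrt t *\<^sub>R P t) \<le> sqrt T * B" if "t \<in> {0..T}" for t
      using B that by (auto intro!: mult_mono)
    then show ?thesis by blast
  qed
qed

text \<open>The substitution \<open>\<tau> = t \<theta>\<^sup>2\<close> makes the convolution of \<open>P\<close> with \<open>n\<close> over \<open>[0, t]\<close> an integral of a
  continuous function even if \<open>P \<tau>\<close> has a singularity \<open>1 / sqrt \<tau>\<close>.\<close>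

definition tconv :: "(real \<Rightarrow> buc \<Rightarrow>\<^sub>L buc) \<Rightarrow> (real \<Rightarrow> buc) \<Rightarrow> real \<Rightarrow> buc" where
  "tconv P n t = integral {0..1} (\<lambda>\<theta>. (2 * sqrt t) *\<^sub>R (sqrt (t * \<theta>\<^sup>2) *\<^sub>R P (t * \<theta>\<^sup>2)) (n (t * (1 - \<theta>\<^sup>2))))"

definition weak_singular :: "(real \<Rightarrow> buc \<Rightarrow>\<^sub>L buc) \<Rightarrow> bool" where
  "weak_singular P \<longleftrightarrow> strong_cont (\<lambda>t. sqrt t *\<^sub>R P t)"

lemma continuous_tconv_integrand:
  assumes P: "weak_singular P" and n: "continuous_on {0..} n"
  shows "continuous_on ({0..} \<times> {0..1})
    (\<lambda>(t, \<theta>). (2 * sqrt t) *\<^sub>R (sqrt (t * \<theta>\<^sup>2) *\<^sub>R P (t * \<theta>\<^sup>2)) (n (t * (1 - \<theta>\<^sup>2))))"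
  unfolding case_prod_beta'
proof (intro continuous_on_scaleR strong_cont_apply[OF P[unfolded weak_singular_def]])
  show "continuous_on ({0..} \<times> {0..1}) (\<lambda>p. n (fst p * (1 - (snd p)\<^sup>2)))"
    by (rule continuous_on_compose2[OF n])
      (auto intro!: continuous_intros mult_nonneg_nonneg simp: power_le_one)
qed (auto intro!: continuous_intros)

lemma integrable_tconv_integrand:
  assumes P: "weak_singular P" and n: "continuous_on {0..} n" and t: "0 \<le> t"
  shows "(\<lambda>\<theta>. (2 * sqrt t) *\<^sub>R (sqrt (t * \<theta>\<^sup>2) *\<^sub>R P (t * \<theta>\<^sup>2)) (n (t * (1 - \<theta>\<^sup>2)))) integrable_on {0..1}"
proof (rule integrable_continuous_real)
  show "continuous_on {0..1} (\<lambda>\<theta>. (2 * sqrt t) *\<^sub>R (sqrt (t * \<theta>\<^sup>2) *\<^sub>R P (t * \<theta>\<^sup>2)) (n (t * (1 - \<theta>\<^sup>2))))"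
    using continuous_on_compose2[OF continuous_tconv_integrand[OF P n], of "{0..1}" "\<lambda>\<theta>. (t, \<theta>)",
        OF continuous_on_Pair[OF continuous_on_const continuous_on_id]] t by auto
qed

lemma continuous_tconv:
  assumes "weak_singular P" "continuous_on {0..} n"
  shows "continuous_on {0..} (tconv P n)"
  using integral_continuous_on_param[of "{0..}" 0 1
      "\<lambda>t \<theta>. (2 * sqrt t) *\<^sub>R (sqrt (t * \<theta>\<^sup>2) *\<^sub>R P (t * \<theta>\<^sup>2)) (n (t * (1 - \<theta>\<^sup>2)))"]
    continuous_tconv_integrand[OF assms]
  by (simp add: tconv_def[abs_def])

lemma tconv_0 [simp]: "tconv P n 0 = 0"
  by (simp add: tconv_def)

lemma tconv_diff:
  assumes P: "weak_singular P" and n: "continuous_on {0..} n" and m: "continuous_on {0..} m" and t: "0 \<le> t"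
  shows "tconv P (\<lambda>s. n s - m s) t = tconv P n t - tconv P m t"
  unfolding tconv_def blinfun.diff_right scaleR_diff_right
  by (rule Henstock_Kurzweil_Integration.integral_diff) (intro integrable_tconv_integrand assms)+

text \<open>The two model kernels, one in s and one in \<tau>, are integrable over the half line
  with explicit primitives: in total at most \<open>2 + 2 arctan (sqrt t)\<close>, which is below 6.
  All decay estimates are reduced to this pair.\<close>

lemma norm_tconv_le:
  assumes P: "weak_singular P" and n: "continuous_on {0..} n" and t: "0 \<le> t" and D: "0 \<le> D"
    and b: "\<And>s \<tau>. 0 \<le> s \<Longrightarrow> 0 < \<tau> \<Longrightarrow> s + \<tau> = t \<Longrightarrow>
      norm (P \<tau> (n s)) \<le> D * (1 / sqrt (1 + s) ^ 3 + 1 / (sqrt \<tau> * (1 + \<tau>)))"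
  shows "norm (tconv P n t) \<le> 6 * D"
proof (cases "t = 0")
  case True
  then show ?thesis using D by simp
next
  case False
  then have t: "0 < t" using t by simp
  define \<Phi> where "\<Phi> \<theta> = D * (2 / sqrt (1 + t * (1 - \<theta>\<^sup>2)) + 2 * arctan (sqrt t * \<theta>))" for \<theta>
  define \<phi> where "\<phi> \<theta> = D * (2 * t * \<theta> / sqrt (1 + t * (1 - \<theta>\<^sup>2)) ^ 3 + 2 * sqrt t / (1 + t * \<theta>\<^sup>2))" for \<theta>
  have pos: "0 < 1 + t * (1 - \<theta>\<^sup>2)" if "\<theta> \<in> {0..1}" for \<theta> :: real
    using t that by (intro add_pos_nonneg mult_nonneg_nonneg) (auto simp: power_le_one)
  have "(\<Phi> has_vector_derivative \<phi> \<theta>) (at \<theta> within {0..1})" if \<theta>: "\<theta> \<in> {0..1}" for \<theta>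
  proof -
    define r where "r = sqrt (1 + t * (1 - \<theta>\<^sup>2))"
    have r: "r > 0" "r * r = 1 + t * (1 - \<theta>\<^sup>2)" using pos[OF \<theta>] by (auto simp: r_def)
    have d1: "((\<lambda>\<theta>. 2 / sqrt (1 + t * (1 - \<theta>\<^sup>2))) has_real_derivative 2 * t * \<theta> / r ^ 3) (at \<theta>)"
      using pos[OF \<theta>] r unfolding r_def[symmetric]
      by (auto intro!: derivative_eq_intros simp: r_def[symmetric] power3_eq_cube divide_simps)
    have d2: "((\<lambda>\<theta>. 2 * arctan (sqrt t * \<theta>)) has_real_derivative 2 * sqrt t / (1 + t * \<theta>\<^sup>2)) (at \<theta>)"
      using t by (auto intro!: derivative_eq_intros simp: power_mult_distrib divide_simps)
    have "(\<Phi> has_real_derivative \<phi> \<theta>) (at \<theta>)"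
      unfolding \<Phi>_def \<phi>_def r_def[symmetric] by (intro DERIV_cmult DERIV_add d1 d2)
    then show ?thesis
      unfolding has_real_derivative_iff_has_vector_derivative by (rule has_vector_derivative_at_within)
  qed
  then have I: "(\<phi> has_integral (\<Phi> 1 - \<Phi> 0)) {0..1}"
    by (intro fundamental_theorem_of_calculus) auto
  have "norm (tconv P n t) \<le> integral {0..1} \<phi>"
    unfolding tconv_def
  proof (rule integral_norm_bound_integral[OF integrable_tconv_integrand[OF P n]])
    fix \<theta> :: real assume \<theta>: "\<theta> \<in> {0..1}"
    show "norm ((2 * sqrt t) *\<^sub>R (sqrt (t * \<theta>\<^sup>2) *\<^sub>R P (t * \<theta>\<^sup>2)) (n (t * (1 - \<theta>\<^sup>2)))) \<le> \<phi> \<theta>"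
    proof (cases "\<theta> = 0")
      case True
      then show ?thesis using D t by (simp add: \<phi>_def)
    next
      case False
      then have \<theta>0: "0 < \<theta>" using \<theta> by simp
      define s where "s = t * (1 - \<theta>\<^sup>2)"
      define \<tau> where "\<tau> = t * \<theta>\<^sup>2"
      have st: "0 \<le> s" "0 < \<tau>" "s + \<tau> = t"
        using t \<theta> \<theta>0 by (auto simp: s_def \<tau>_def power_le_one algebra_simps)
      have sq: "sqrt \<tau> = sqrt t * \<theta>" using \<theta>0 by (simp add: \<tau>_def real_sqrt_mult)
      have "norm ((2 * sqrt t) *\<^sub>R (sqrt \<tau> *\<^sub>R P \<tau>) (n s)) = 2 * sqrt t * (sqrt \<tau> * norm (P \<tau> (n s)))"
        using t st by (simp add: scaleR_blinfun.rep_eq abs_mult)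
      also have "\<dots> \<le> 2 * sqrt t * (sqrt \<tau> * (D * (1 / sqrt (1 + s) ^ 3 + 1 / (sqrt \<tau> * (1 + \<tau>)))))"
        using b[OF st] t st by (intro mult_left_mono) auto
      also have "\<dots> = D * (2 * (sqrt t * sqrt t) * \<theta> / sqrt (1 + s) ^ 3 + 2 * sqrt t / (1 + \<tau>))"
      proof -
        have e1: "sqrt \<tau> * (1 / (sqrt \<tau> * (1 + \<tau>))) = 1 / (1 + \<tau>)" using st by simp
        have e2: "2 * sqrt t * (sqrt \<tau> * (D * (A + B))) = D * (2 * sqrt t * (sqrt \<tau> * A) + 2 * sqrt t * (sqrt \<tau> * B))" for A B
          by (simp add: algebra_simps)
        show ?thesis unfolding e2 e1 by (simp add: sq mult_ac)
      qed
      also have "\<dots> = \<phi> \<theta>" using t by (simp add: \<phi>_def s_def \<tau>_def)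
      finally show ?thesis unfolding s_def \<tau>_def .
    qed
  qed (use t I in auto)
  also have "\<dots> = \<Phi> 1 - \<Phi> 0" using I by (rule integral_unique)
  also have "\<dots> = D * (2 + 2 * arctan (sqrt t) - 2 / sqrt (1 + t))" by (simp add: \<Phi>_def algebra_simps)
  also have "\<dots> \<le> D * 6"
  proof (rule mult_left_mono[OF _ D])
    have "0 \<le> 2 / sqrt (1 + t)" using t by simp
    then show "2 + 2 * arctan (sqrt t) - 2 / sqrt (1 + t) \<le> 6"
      using arctan_ubound[of "sqrt t"] pi_less_4 by linarith
  qed
  finally show ?thesis by (simp add: mult.commute)
qed

lemma bderiv_tconv:
  assumes P: "weak_singular P" "continuous_on {0..} n" and P': "weak_singular P'" "continuous_on {0..} n'"
    and t: "0 \<le> t"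
    and d: "\<And>s \<tau>. 0 \<le> s \<Longrightarrow> 0 < \<tau> \<Longrightarrow> bderiv (P \<tau> (n s)) (P' \<tau> (n' s))"
  shows "bderiv (tconv P n t) (tconv P' n' t)"
  unfolding tconv_def
proof (rule bderiv_integral[OF _ integrable_tconv_integrand[OF P t] integrable_tconv_integrand[OF P' t]])
  fix \<theta> :: real assume \<theta>: "\<theta> \<in> {0..1}"
  then have s: "0 \<le> t * (1 - \<theta>\<^sup>2)" using t by (auto simp: power_le_one)
  show "bderiv ((2 * sqrt t) *\<^sub>R (sqrt (t * \<theta>\<^sup>2) *\<^sub>R P (t * \<theta>\<^sup>2)) (n (t * (1 - \<theta>\<^sup>2))))
      ((2 * sqrt t) *\<^sub>R (sqrt (t * \<theta>\<^sup>2) *\<^sub>R P' (t * \<theta>\<^sup>2)) (n' (t * (1 - \<theta>\<^sup>2))))"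
  proof (cases "t * \<theta>\<^sup>2 = 0")
    case False
    then have "0 < t * \<theta>\<^sup>2" using t by (simp add: less_le)
    then show ?thesis unfolding scaleR_blinfun.rep_eq by (intro bderiv_scaleR d s)
  qed (auto simp: bderiv_scaleR)
qed

text \<open>Agreement at positive \<tau> suffices, since the factor
  \<open>sqrt (t * \<theta>\<^sup>2)\<close> in the integrand removes time zero, where the series
  take default values.\<close>

lemma tconv_cong:
  fixes P P' :: "real \<Rightarrow> buc \<Rightarrow>\<^sub>L buc"
  assumes "0 \<le> t" "\<And>s \<tau>. 0 \<le> s \<Longrightarrow> 0 < \<tau> \<Longrightarrow> P \<tau> (n s) = P' \<tau> (n' s)"
  shows "tconv P n t = tconv P' n' t"
  unfolding tconv_def
proof (rule integral_cong)
  fix \<theta> :: real assume \<theta>: "\<theta> \<in> {0..1}"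
  then have s: "0 \<le> t * (1 - \<theta>\<^sup>2)" using assms(1) by (auto simp: power_le_one)
  show "(2 * sqrt t) *\<^sub>R (sqrt (t * \<theta>\<^sup>2) *\<^sub>R P (t * \<theta>\<^sup>2)) (n (t * (1 - \<theta>\<^sup>2)))
      = (2 * sqrt t) *\<^sub>R (sqrt (t * \<theta>\<^sup>2) *\<^sub>R P' (t * \<theta>\<^sup>2)) (n' (t * (1 - \<theta>\<^sup>2)))"
  proof (cases "t * \<theta>\<^sup>2 = 0")
    case False
    then have "0 < t * \<theta>\<^sup>2" using assms(1) by (simp add: less_le)
    then show ?thesis unfolding scaleR_blinfun.rep_eq using assms(2)[OF s] by simp
  qed auto
qed

text \<open>For a nonsingular kernel the substitution can be undone by composing the primitive with
  \<open>t - t * \<theta>\<^sup>2\<close>. This runs from t down to 0, hence the change of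
  sign.\<close>

lemma tconv_has_integral:
  assumes P: "strong_cont P" and n: "continuous_on {0..} n" and t: "0 \<le> t"
  shows "((\<lambda>s. P (t - s) (n s)) has_integral tconv P n t) {0..t}"
proof -
  define F where "F s = P (t - s) (n s)" for s
  have F: "continuous_on {0..t} F"
    unfolding F_def by (intro strong_cont_apply[OF P] continuous_intros continuous_on_subset[OF n]) auto
  define g where "g \<theta> = t - t * \<theta>\<^sup>2" for \<theta> :: real
  have I: "((\<lambda>\<theta>. (- 2 * t * \<theta>) *\<^sub>R F (g \<theta>)) has_integral
      (((\<lambda>u. integral {0..u} F) \<circ> g) 1 - ((\<lambda>u. integral {0..u} F) \<circ> g) 0)) {0..1}"
  proof (rule fundamental_theorem_of_calculus)
    fix \<theta> :: real assume \<theta>: "\<theta> \<in> {0..1}"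
    have gim: "g ` {0..1} \<subseteq> {0..t}" using t by (auto simp: g_def mult_left_le power_le_one)
    have "(g has_real_derivative - 2 * t * \<theta>) (at \<theta> within {0..1})"
      unfolding g_def by (auto intro!: derivative_eq_intros)
    moreover have "((\<lambda>u. integral {0..u} F) has_vector_derivative F (g \<theta>)) (at (g \<theta>) within {0..t})"
      by (rule integral_has_vector_derivative[OF F]) (use gim \<theta> in blast)
    then have "((\<lambda>u. integral {0..u} F) has_vector_derivative F (g \<theta>)) (at (g \<theta>) within g ` {0..1})"
      using gim by (rule has_vector_derivative_within_subset)
    ultimately show "(((\<lambda>u. integral {0..u} F) \<circ> g) has_vector_derivative (- 2 * t * \<theta>) *\<^sub>R F (g \<theta>)) (at \<theta> within {0..1})"
      unfolding has_real_derivative_iff_has_vector_derivative by (rule vector_diff_chain_within)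
  qed simp
  have "((\<lambda>\<theta>. - ((- 2 * t * \<theta>) *\<^sub>R F (t - t * \<theta>\<^sup>2))) has_integral integral {0..t} F) {0..1}"
    using has_integral_neg[OF I] by (simp add: g_def)
  then have "((\<lambda>\<theta>. (2 * sqrt t) *\<^sub>R (sqrt (t * \<theta>\<^sup>2) *\<^sub>R P (t * \<theta>\<^sup>2)) (n (t * (1 - \<theta>\<^sup>2)))) has_integral integral {0..t} F) {0..1}"
  proof (rule has_integral_eq[rotated])
    fix \<theta> :: real assume "\<theta> \<in> {0..1}"
    then have "2 * sqrt t * sqrt (t * \<theta>\<^sup>2) = 2 * t * \<theta>" using t by (simp add: real_sqrt_mult)
    moreover have "t * (1 - \<theta>\<^sup>2) = t - t * \<theta>\<^sup>2" by (simp add: algebra_simps)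
    ultimately show "- ((- 2 * t * \<theta>) *\<^sub>R F (t - t * \<theta>\<^sup>2))
        = (2 * sqrt t) *\<^sub>R (sqrt (t * \<theta>\<^sup>2) *\<^sub>R P (t * \<theta>\<^sup>2)) (n (t * (1 - \<theta>\<^sup>2)))"
      by (simp add: F_def scaleR_blinfun.rep_eq)
  qed
  then have "tconv P n t = integral {0..t} F" unfolding tconv_def by (rule integral_unique)
  then show ?thesis using integrable_integral[OF integrable_continuous_real[OF F]] unfolding F_def by simp
qed

section \<open>Fubini on a triangle and associativity of the convolution in time\<close>

lemma integral_triangle_swap:
  fixes g :: "real \<Rightarrow> real \<Rightarrow> 'a::banach"
  assumes t: "0 \<le> t" and g: "continuous_on {(s, \<sigma>). 0 \<le> \<sigma> \<and> \<sigma> \<le> s \<and> s \<le> t} (\<lambda>(s, \<sigma>). g s \<sigma>)"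
  shows "integral {0..t} (\<lambda>s. integral {0..s} (g s)) = integral {0..t} (\<lambda>\<sigma>. integral {\<sigma>..t} (\<lambda>s. g s \<sigma>))"
proof -
  \<comment> \<open>a continuous extension of \<open>g\<close> to the square; it contributes the same to both sides\<close>
  define G where "G s \<sigma> = g (max s \<sigma>) \<sigma>" for s \<sigma>
  define h where "h \<sigma> = g \<sigma> \<sigma>" for \<sigma>
  have "continuous_on ({0..t} \<times> {0..t}) (\<lambda>p::real \<times> real. (max (fst p) (snd p), snd p))"
    by (intro continuous_intros)
  moreover have "(\<lambda>p::real \<times> real. (max (fst p) (snd p), snd p)) ` ({0..t} \<times> {0..t})
      \<subseteq> {(s, \<sigma>). 0 \<le> \<sigma> \<and> \<sigma> \<le> s \<and> s \<le> t}"
    by (rule image_subsetI) auto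
  ultimately have G2: "continuous_on ({0..t} \<times> {0..t}) (\<lambda>p. G (fst p) (snd p))"
    unfolding G_def using continuous_on_compose2[OF g] by fastforce
  have Gs: "continuous_on {0..t} (G s)" if "s \<in> {0..t}" for s
    using continuous_on_compose2[OF G2, of "{0..t}" "\<lambda>\<sigma>. (s, \<sigma>)",
        OF continuous_on_Pair[OF continuous_on_const continuous_on_id]] that by (simp add: image_subset_iff)
  have G\<sigma>: "continuous_on {0..t} (\<lambda>s. G s \<sigma>)" if "\<sigma> \<in> {0..t}" for \<sigma>
    using continuous_on_compose2[OF G2, of "{0..t}" "\<lambda>s. (s, \<sigma>)",
        OF continuous_on_Pair[OF continuous_on_id continuous_on_const]] that by (simp add: image_subset_iff)
  have h: "continuous_on {0..t} h"
    unfolding h_def using continuous_on_compose2[OF g, of "{0..t}" "\<lambda>\<sigma>. (\<sigma>, \<sigma>)",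
        OF continuous_on_Pair[OF continuous_on_id continuous_on_id]] by (simp add: image_subset_iff)
  define E where "E s = integral {s..t} h" for s
  have dE: "(E has_vector_derivative - h s) (at s within {0..t})" if "s \<in> {0..t}" for s
    unfolding E_def by (rule integral_has_vector_derivative'[OF h that])
  have cE: "continuous_on {0..t} E"
    by (rule continuous_on_vector_derivative[OF dE])
  \<comment> \<open>Integration by parts: \<open>s *\<^sub>R E s\<close> vanishes at both ends, so
    the integral of E equals that of \<open>s *\<^sub>R h s\<close>. These are the contributions of
    the added triangle in the two orders of integration, as the extension is constant in s
    there.\<close>
  have EE: "((\<lambda>s. s *\<^sub>R (- h s) + 1 *\<^sub>R E s) has_integral (t *\<^sub>R E t - 0 *\<^sub>R E 0)) {0..t}"
  proof (rule fundamental_theorem_of_calculus[OF t])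
    show "((\<lambda>s. s *\<^sub>R E s) has_vector_derivative s *\<^sub>R (- h s) + 1 *\<^sub>R E s) (at s within {0..t})"
      if "s \<in> {0..t}" for s
      by (rule has_vector_derivative_scaleR[OF DERIV_ident dE[OF that]])
  qed
  have sh: "(\<lambda>s. s *\<^sub>R h s) integrable_on {0..t}" and iE: "E integrable_on {0..t}"
    by (intro integrable_continuous_real continuous_intros h cE)+
  have "integral {0..t} E - integral {0..t} (\<lambda>s. s *\<^sub>R h s) = 0"
    using integral_unique[OF EE] by (simp add: E_def integral_diff[OF iE sh, symmetric] add.commute)
  then have tri: "integral {0..t} E = integral {0..t} (\<lambda>\<sigma>. \<sigma> *\<^sub>R h \<sigma>)" by simp
  define A where "A s = integral {0..t} (G s)" for s
  define B where "B \<sigma> = integral {0..t} (\<lambda>s. G s \<sigma>)" for \<sigma>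
  have A: "integral {0..s} (g s) = A s - E s" if "s \<in> {0..t}" for s
  proof -
    have "integral {0..s} (G s) + integral {s..t} (G s) = A s"
      unfolding A_def using that by (intro Henstock_Kurzweil_Integration.integral_combine integrable_continuous_real Gs) auto
    moreover have "integral {0..s} (G s) = integral {0..s} (g s)"
      by (rule integral_cong) (simp add: G_def max_absorb1)
    moreover have "integral {s..t} (G s) = E s"
      unfolding E_def by (rule integral_cong) (simp add: G_def h_def max_absorb2)
    ultimately show ?thesis by (simp add: eq_diff_eq)
  qed
  have B: "integral {\<sigma>..t} (\<lambda>s. g s \<sigma>) = B \<sigma> - \<sigma> *\<^sub>R h \<sigma>" if "\<sigma> \<in> {0..t}" for \<sigma>
  proof -
    have "integral {0..\<sigma>} (\<lambda>s. G s \<sigma>) + integral {\<sigma>..t} (\<lambda>s. G s \<sigma>) = B \<sigma>"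
      unfolding B_def using that by (intro Henstock_Kurzweil_Integration.integral_combine integrable_continuous_real G\<sigma>) auto
    moreover have "integral {\<sigma>..t} (\<lambda>s. G s \<sigma>) = integral {\<sigma>..t} (\<lambda>s. g s \<sigma>)"
      by (rule integral_cong) (simp add: G_def max_absorb1)
    moreover have "integral {0..\<sigma>} (\<lambda>s. G s \<sigma>) = integral {0..\<sigma>} (\<lambda>s. h \<sigma>)"
      by (rule integral_cong) (simp add: G_def h_def max_absorb2)
    ultimately show ?thesis using that by (simp add: eq_diff_eq add.commute)
  qed
  have cA: "continuous_on {0..t} A"
    unfolding A_def using integral_continuous_on_param[of "{0..t}" 0 t G] G2 by (simp add: case_prod_beta')
  have "continuous_on ({0..t} \<times> {0..t}) (\<lambda>p::real \<times> real. (snd p, fst p))"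
    by (intro continuous_intros)
  from continuous_on_compose2[OF G2 this]
  have "continuous_on ({0..t} \<times> {0..t}) (\<lambda>p. G (snd p) (fst p))"
    by (simp add: image_subset_iff)
  then have cB: "continuous_on {0..t} B"
    unfolding B_def using integral_continuous_on_param[of "{0..t}" 0 t "\<lambda>\<sigma> s. G s \<sigma>"] by (simp add: case_prod_beta')
  have "cbox (0, 0) (t, t) = {0..t} \<times> {0..t}" by (simp add: cbox_Pair_eq)
  then have AB: "integral {0..t} A = integral {0..t} B"
    using integral_swap_continuous[of 0 0 t t G] G2 by (simp add: A_def[abs_def] B_def[abs_def] case_prod_beta')
  have "integral {0..t} (\<lambda>s. integral {0..s} (g s)) = integral {0..t} (\<lambda>s. A s - E s)"
    by (rule integral_cong) (rule A)
  also have "\<dots> = integral {0..t} A - integral {0..t} E"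
    by (intro Henstock_Kurzweil_Integration.integral_diff integrable_continuous_real cA cE)
  also have "\<dots> = integral {0..t} (\<lambda>\<sigma>. B \<sigma> - \<sigma> *\<^sub>R h \<sigma>)"
    unfolding AB tri by (intro Henstock_Kurzweil_Integration.integral_diff[symmetric] integrable_continuous_real cB continuous_intros h)
  also have "\<dots> = integral {0..t} (\<lambda>\<sigma>. integral {\<sigma>..t} (\<lambda>s. g s \<sigma>))"
    by (rule integral_cong) (rule B[symmetric])
  finally show ?thesis .
qed

text \<open>Associativity \<open>H * (P * n) = (H * P) * n\<close>, with the operator convolution H
  * P known to be L on each fixed vector.\<close>

lemma tconv_assoc:
  assumes H: "strong_cont H" and P: "strong_cont P" and L: "strong_cont L"
    and n: "continuous_on {0..} n" and t: "0 \<le> t"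
    and HP: "\<And>t f. 0 \<le> t \<Longrightarrow> ((\<lambda>s. H (t - s) (P s f)) has_integral L t f) {0..t}"
  shows "tconv H (tconv P n) t = tconv L n t"
proof -
  define g where "g s \<sigma> = H (t - s) (P (s - \<sigma>) (n \<sigma>))" for s \<sigma>
  have cp: "continuous_on {0..} (tconv P n)"
    by (rule continuous_tconv[OF _ n]) (simp add: weak_singular_def strong_cont_sqrt P)
  have "tconv H (tconv P n) t = integral {0..t} (\<lambda>s. H (t - s) (tconv P n s))"
    using tconv_has_integral[OF H cp t] by (rule integral_unique[symmetric])
  also have "\<dots> = integral {0..t} (\<lambda>s. integral {0..s} (g s))"
  proof (rule integral_cong)
    fix s assume s: "s \<in> {0..t}"
    have "((\<lambda>\<sigma>. H (t - s) (P (s - \<sigma>) (n \<sigma>))) has_integral H (t - s) (tconv P n s)) {0..s}"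
      using has_integral_linear[OF tconv_has_integral[OF P n, of s] blinfun.bounded_linear_right] s
      by (simp add: o_def)
    then show "H (t - s) (tconv P n s) = integral {0..s} (g s)"
      unfolding g_def by (rule integral_unique[symmetric])
  qed
  also have "\<dots> = integral {0..t} (\<lambda>\<sigma>. integral {\<sigma>..t} (\<lambda>s. g s \<sigma>))"
  proof (rule integral_triangle_swap[OF t])
    show "continuous_on {(s, \<sigma>). 0 \<le> \<sigma> \<and> \<sigma> \<le> s \<and> s \<le> t} (\<lambda>(s, \<sigma>). g s \<sigma>)"
      unfolding g_def case_prod_beta'
      by (intro strong_cont_apply[OF H] strong_cont_apply[OF P] continuous_on_compose2[OF n])
        (auto intro!: continuous_intros)
  qed
  also have "\<dots> = integral {0..t} (\<lambda>\<sigma>. L (t - \<sigma>) (n \<sigma>))"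
  proof (rule integral_cong)
    fix \<sigma> assume \<sigma>: "\<sigma> \<in> {0..t}"
    have "((\<lambda>s. H (t - \<sigma> - s) (P s (n \<sigma>))) has_integral L (t - \<sigma>) (n \<sigma>)) {0..t - \<sigma>}"
      using HP[of "t - \<sigma>" "n \<sigma>"] \<sigma> by simp
    from has_integral_shift_real_ivl[OF this, of "- \<sigma>"]
    have "((\<lambda>s. g s \<sigma>) has_integral L (t - \<sigma>) (n \<sigma>)) {\<sigma>..t}" by (simp add: g_def)
    then show "integral {\<sigma>..t} (\<lambda>s. g s \<sigma>) = L (t - \<sigma>) (n \<sigma>)" by (rule integral_unique)
  qed
  also have "\<dots> = tconv L n t"
    using tconv_has_integral[OF L n t] by (rule integral_unique)
  finally show ?thesis .
qed

section \<open>Decay estimates\<close>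

text \<open>Replacing the larger of X and Y by the smaller bounds the product by a single inverse
  cube. It is applied to X = sqrt (1 + s) and Y = sqrt (1 + \<tau>).\<close>

lemma inverse_product_le:
  fixes X Y :: real
  assumes "0 < X" "0 < Y"
  shows "1 / (Y * X\<^sup>2) \<le> 1 / X ^ 3 + 1 / Y ^ 3"
proof (cases "X \<le> Y")
  case True
  then have "X ^ 3 \<le> Y * X\<^sup>2" using assms by (simp add: power3_eq_cube power2_eq_square)
  then have "1 / (Y * X\<^sup>2) \<le> 1 / X ^ 3" using assms by (intro divide_left_mono) auto
  moreover have "0 \<le> 1 / Y ^ 3" using assms by simp
  ultimately show ?thesis by linarith
next
  case False
  then have "Y ^ 3 \<le> Y * X\<^sup>2" using assms by (simp add: power3_eq_cube power2_eq_square mult_mono)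
  then have "1 / (Y * X\<^sup>2) \<le> 1 / Y ^ 3" using assms by (intro divide_left_mono) auto
  moreover have "0 \<le> 1 / X ^ 3" using assms by simp
  ultimately show ?thesis by linarith
qed

context
  fixes s \<tau> :: real
  assumes s: "0 \<le> s" and \<tau>: "0 < \<tau>"
begin

private lemma pos: "1 \<le> sqrt (1 + s)" "1 \<le> sqrt (1 + \<tau>)" "0 < sqrt \<tau>" "sqrt \<tau> \<le> sqrt (1 + \<tau>)"
  using s \<tau> by auto

private lemma k_ge: "1 / sqrt (1 + \<tau>) ^ 3 \<le> 1 / (sqrt \<tau> * (1 + \<tau>))"
proof -
  have "sqrt (1 + \<tau>) ^ 3 = sqrt (1 + \<tau>) * (1 + \<tau>)"
    using \<tau> by (simp add: power3_eq_cube)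
  then show ?thesis using pos \<tau> by (simp, intro divide_left_mono mult_right_mono) auto
qed

private lemma sqrt_T: "sqrt (1 + (s + \<tau>)) \<le> sqrt (1 + s) + sqrt (1 + \<tau>)"
proof -
  have "sqrt (1 + (s + \<tau>)) \<le> sqrt ((1 + s) + (1 + \<tau>))" by simp
  also have "\<dots> \<le> sqrt (1 + s) + sqrt (1 + \<tau>)" by (rule sqrt_add_le_add_sqrt) (use s \<tau> in auto)
  finally show ?thesis .
qed

text \<open>The weight satisfies \<open>sqrt (1 + t) \<le> X + Y\<close> for t = s + \<tau>, with X
  and Y the roots of 1 + s and 1 + \<tau>. Each summand cancels one factor of a denominator, and the
  rest is reduced to the model kernels.\<close>

lemma kernel_decay_half:
  "sqrt (1 + (s + \<tau>)) * (1 / (sqrt (1 + \<tau>) * sqrt (1 + s) ^ 3))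
    \<le> 2 * (1 / sqrt (1 + s) ^ 3 + 1 / (sqrt \<tau> * (1 + \<tau>)))"
proof -
  define X Y where XY: "X = sqrt (1 + s)" "Y = sqrt (1 + \<tau>)"
  have p: "0 < X" "0 < Y" using pos by (auto simp: XY)
  have "sqrt (1 + (s + \<tau>)) * (1 / (Y * X ^ 3)) \<le> (X + Y) * (1 / (Y * X ^ 3))"
    using sqrt_T p unfolding XY[symmetric] by (intro mult_right_mono) auto
  also have "\<dots> = 1 / (Y * X\<^sup>2) + 1 / X ^ 3" using p by (simp add: field_simps power2_eq_square power3_eq_cube)
  also have "\<dots> \<le> 2 * (1 / X ^ 3 + 1 / Y ^ 3)"
  proof -
    have "0 \<le> 1 / Y ^ 3" using p by simp
    moreover have "u + v \<le> 2 * (v + w)" if "u \<le> v + w" "0 \<le> w" for u v w :: real using that by simp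
    ultimately show ?thesis using inverse_product_le[OF p] by blast
  qed
  also have "\<dots> \<le> 2 * (1 / X ^ 3 + 1 / (sqrt \<tau> * (1 + \<tau>)))" using k_ge by (simp add: XY)
  finally show ?thesis by (simp only: XY)
qed

lemma kernel_decay_half':
  "sqrt (1 + (s + \<tau>)) * (1 / ((1 + \<tau>) * (1 + s)))
    \<le> 2 * (1 / sqrt (1 + s) ^ 3 + 1 / (sqrt \<tau> * (1 + \<tau>)))"
proof -
  define X Y where XY: "X = sqrt (1 + s)" "Y = sqrt (1 + \<tau>)"
  have p: "0 < X" "0 < Y" using pos by (auto simp: XY)
  have sq: "1 + \<tau> = Y\<^sup>2" "1 + s = X\<^sup>2" using s \<tau> by (auto simp: XY)
  have "sqrt (1 + (s + \<tau>)) * (1 / (Y\<^sup>2 * X\<^sup>2)) \<le> (X + Y) * (1 / (Y\<^sup>2 * X\<^sup>2))"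
    using sqrt_T p unfolding XY[symmetric] by (intro mult_right_mono) auto
  also have "\<dots> = 1 / (X * Y\<^sup>2) + 1 / (Y * X\<^sup>2)" using p by (simp add: field_simps power2_eq_square)
  also have "\<dots> \<le> 2 * (1 / X ^ 3 + 1 / Y ^ 3)"
  proof -
    have "u' + u \<le> 2 * (v + w)" if "u \<le> v + w" "u' \<le> w + v" for u u' v w :: real using that by simp
    then show ?thesis using inverse_product_le[OF p] inverse_product_le[OF p(2,1)] by blast
  qed
  also have "\<dots> \<le> 2 * (1 / X ^ 3 + 1 / (sqrt \<tau> * (1 + \<tau>)))" using k_ge by (simp add: XY)
  finally have "sqrt (1 + (s + \<tau>)) * (1 / ((1 + \<tau>) * (1 + s))) \<le> 2 * (1 / X ^ 3 + 1 / (sqrt \<tau> * (1 + \<tau>)))"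
    by (simp only: sq[symmetric])
  then show ?thesis by (simp only: XY)
qed

text \<open>For \<tau> at least 1 the singular root is comparable to Y and the weight is at most X^2
  + Y^2. For smaller \<tau> the weight is comparable to 1 + s, is absorbed by X^3, and leaves the
  singularity, which the second model kernel carries.\<close>

lemma kernel_decay_one:
  "(1 + (s + \<tau>)) * (1 / (sqrt \<tau> * sqrt (1 + \<tau>) * sqrt (1 + s) ^ 3))
    \<le> 4 * (1 / sqrt (1 + s) ^ 3 + 1 / (sqrt \<tau> * (1 + \<tau>)))"
proof -
  define X Y where XY: "X = sqrt (1 + s)" "Y = sqrt (1 + \<tau>)"
  have p: "0 < X" "0 < Y" "1 \<le> X" "1 \<le> Y" using pos by (auto simp: XY)
  have sq: "1 + \<tau> = Y\<^sup>2" "1 + s = X\<^sup>2" using s \<tau> by (auto simp: XY)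
  have "(1 + (s + \<tau>)) * (1 / (sqrt \<tau> * Y * X ^ 3)) \<le> 4 * (1 / X ^ 3 + 1 / (sqrt \<tau> * (1 + \<tau>)))"
  proof (cases "1 \<le> \<tau>")
    case True
    have "Y \<le> sqrt (4 * \<tau>)" unfolding XY using True by (intro real_sqrt_le_mono) simp
    then have Y: "Y \<le> 2 * sqrt \<tau>" by (simp add: real_sqrt_mult)
    have "(1 + (s + \<tau>)) * (1 / (sqrt \<tau> * Y * X ^ 3)) \<le> (X\<^sup>2 + Y\<^sup>2) * (1 / (Y / 2 * Y * X ^ 3))"
    proof (rule mult_mono)
      show "1 + (s + \<tau>) \<le> X\<^sup>2 + Y\<^sup>2" using sq by linarith
      show "1 / (sqrt \<tau> * Y * X ^ 3) \<le> 1 / (Y / 2 * Y * X ^ 3)"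
        using Y p pos(3) by (intro divide_left_mono mult_right_mono) auto
    qed (use p pos s \<tau> in auto)
    also have "\<dots> = 2 * (1 / (X * Y\<^sup>2) + 1 / X ^ 3)"
      using p by (simp add: field_simps power2_eq_square power3_eq_cube)
    also have "\<dots> \<le> 4 * (1 / X ^ 3 + 1 / Y ^ 3)"
    proof -
      have "0 \<le> 1 / Y ^ 3" using p by simp
      moreover have "2 * (u + v) \<le> 4 * (v + w)" if "u \<le> w + v" "0 \<le> w" for u v w :: real using that by simp
      ultimately show ?thesis using inverse_product_le[OF p(2,1)] by blast
    qed
    also have "\<dots> \<le> 4 * (1 / X ^ 3 + 1 / (sqrt \<tau> * (1 + \<tau>)))" using k_ge by (simp add: XY)
    finally show ?thesis .
  next
    case False
    have "(1 + (s + \<tau>)) * (1 / (sqrt \<tau> * Y * X ^ 3)) \<le> (2 * X ^ 3) * (1 / (sqrt \<tau> * 1 * X ^ 3))"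
    proof (rule mult_mono)
      have "1 + (s + \<tau>) \<le> 2 * (1 + s)" using False s by simp
      then have "1 + (s + \<tau>) \<le> 2 * X\<^sup>2" unfolding sq(2) .
      also have "\<dots> \<le> 2 * X ^ 3" using p by (simp add: power_increasing)
      finally show "1 + (s + \<tau>) \<le> 2 * X ^ 3" .
      show "1 / (sqrt \<tau> * Y * X ^ 3) \<le> 1 / (sqrt \<tau> * 1 * X ^ 3)"
        using p pos(3) by (intro divide_left_mono mult_right_mono mult_left_mono) auto
    qed (use p pos in auto)
    also have "\<dots> = 2 * (1 / sqrt \<tau>)" using p by simp
    also have "\<dots> \<le> 4 * (1 / (sqrt \<tau> * (1 + \<tau>)))"
      using False \<tau> pos(3) by (simp add: divide_simps)
    also have "\<dots> \<le> 4 * (1 / X ^ 3 + 1 / (sqrt \<tau> * (1 + \<tau>)))" using p by simp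
    finally show ?thesis .
  qed
  then show ?thesis by (simp only: XY)
qed

text \<open>Interpolates between a bound for short times and one for long times. The 2 comes from
  \<open>1 + \<tau> \<le> 4 \<tau>\<close> for \<tau> at least 1 and
  \<open>1 + \<tau> \<le> 4\<close> otherwise.\<close>

lemma min_decay:
  fixes A c :: real
  assumes "A \<le> c" "A \<le> c / sqrt \<tau>" "0 \<le> c"
  shows "A \<le> 2 * c / sqrt (1 + \<tau>)"
proof (cases "1 \<le> \<tau>")
  case True
  have "sqrt (1 + \<tau>) \<le> sqrt (4 * \<tau>)" using True by (intro real_sqrt_le_mono) simp
  then have "c * sqrt (1 + \<tau>) \<le> c * (2 * sqrt \<tau>)"
    using assms(3) by (intro mult_left_mono) (simp_all add: real_sqrt_mult)
  then have "c / sqrt \<tau> \<le> 2 * c / sqrt (1 + \<tau>)" using pos by (simp add: field_simps)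
  then show ?thesis using assms by linarith
next
  case False
  have "sqrt (1 + \<tau>) \<le> sqrt 4" using False by (intro real_sqrt_le_mono) simp
  then have "c * sqrt (1 + \<tau>) \<le> c * 2" using assms(3) by (intro mult_left_mono) auto
  then have "c \<le> 2 * c / sqrt (1 + \<tau>)" using pos(2) by (simp add: field_simps)
  then show ?thesis using assms by linarith
qed

end

context
  fixes P :: "real \<Rightarrow> buc \<Rightarrow>\<^sub>L buc" and n :: "real \<Rightarrow> buc" and t C :: real
  assumes P: "weak_singular P" and n: "continuous_on {0..} n" and t: "0 \<le> t" and C: "0 \<le> C"
begin

lemma tconv_bounded:
  assumes "\<And>s \<tau>. 0 \<le> s \<Longrightarrow> 0 < \<tau> \<Longrightarrow> norm (P \<tau> (n s)) \<le> C * (1 / sqrt (1 + s) ^ 3)"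
  shows "norm (tconv P n t) \<le> 6 * C"
proof (rule norm_tconv_le[OF P n t C])
  fix s \<tau> :: real assume st: "0 \<le> s" "0 < \<tau>"
  have "C * (1 / sqrt (1 + s) ^ 3) \<le> C * (1 / sqrt (1 + s) ^ 3 + 1 / (sqrt \<tau> * (1 + \<tau>)))"
    using C st by (intro mult_left_mono) auto
  then show "norm (P \<tau> (n s)) \<le> C * (1 / sqrt (1 + s) ^ 3 + 1 / (sqrt \<tau> * (1 + \<tau>)))"
    using assms[OF st] by linarith
qed

text \<open>For fixed t the decay weight T is a constant. It is moved inside the convolution and
  distributed over s and \<tau> by the kernel estimates.\<close>

lemma tconv_decay_aux:
  fixes \<kappa> :: "real \<Rightarrow> real \<Rightarrow> real" and T L :: real
  assumes b: "\<And>s \<tau>. 0 \<le> s \<Longrightarrow> 0 < \<tau> \<Longrightarrow> norm (P \<tau> (n s)) \<le> C * \<kappa> s \<tau>"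
    and k: "\<And>s \<tau>. 0 \<le> s \<Longrightarrow> 0 < \<tau> \<Longrightarrow> s + \<tau> = t \<Longrightarrow>
      T * \<kappa> s \<tau> \<le> L * (1 / sqrt (1 + s) ^ 3 + 1 / (sqrt \<tau> * (1 + \<tau>)))"
    and T: "0 < T" and L: "0 \<le> L"
  shows "norm (tconv P n t) \<le> 6 * (C * L / T)"
proof (rule norm_tconv_le[OF P n t])
  show "0 \<le> C * L / T" using C T L by simp
  fix s \<tau> :: real assume st: "0 \<le> s" "0 < \<tau>" "s + \<tau> = t"
  have "norm (P \<tau> (n s)) \<le> C * \<kappa> s \<tau>" by (rule b[OF st(1,2)])
  also have "\<dots> \<le> C * (L * (1 / sqrt (1 + s) ^ 3 + 1 / (sqrt \<tau> * (1 + \<tau>))) / T)"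
    using k[OF st] T by (intro mult_left_mono[OF _ C]) (simp add: pos_le_divide_eq mult.commute)
  finally show "norm (P \<tau> (n s)) \<le> C * L / T * (1 / sqrt (1 + s) ^ 3 + 1 / (sqrt \<tau> * (1 + \<tau>)))"
    by simp
qed

lemma tconv_decay_half:
  assumes "\<And>s \<tau>. 0 \<le> s \<Longrightarrow> 0 < \<tau> \<Longrightarrow> norm (P \<tau> (n s)) \<le> C * (1 / (sqrt (1 + \<tau>) * sqrt (1 + s) ^ 3))"
  shows "norm (tconv P n t) \<le> 12 * C / sqrt (1 + t)"
  using tconv_decay_aux[OF assms, of "sqrt (1 + t)" 2] kernel_decay_half t by force

lemma tconv_decay_half':
  assumes "\<And>s \<tau>. 0 \<le> s \<Longrightarrow> 0 < \<tau> \<Longrightarrow> norm (P \<tau> (n s)) \<le> C * (1 / ((1 + \<tau>) * (1 + s)))"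
  shows "norm (tconv P n t) \<le> 12 * C / sqrt (1 + t)"
  using tconv_decay_aux[OF assms, of "sqrt (1 + t)" 2] kernel_decay_half' t by force

lemma tconv_decay_one:
  assumes "\<And>s \<tau>. 0 \<le> s \<Longrightarrow> 0 < \<tau> \<Longrightarrow>
    norm (P \<tau> (n s)) \<le> C * (1 / (sqrt \<tau> * sqrt (1 + \<tau>) * sqrt (1 + s) ^ 3))"
  shows "norm (tconv P n t) \<le> 24 * C / (1 + t)"
  using tconv_decay_aux[OF assms, of "1 + t" 4] kernel_decay_one t by force

end

section \<open>Bounds and continuity of the entries of the Green matrix\<close>

context dyson
begin

abbreviation "D \<equiv> GS (dco a)"
abbreviation "E \<equiv> GS (eco a)"
abbreviation "R \<equiv> GS (fco a)"

text \<open>A common constant for all entries: K serves the phase entry, and the other term converts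
  weights in 1 + a t into weights in 1 + t.\<close>

definition M :: real where "M = 2 * K / min 1 a + K"

lemma min_1_a_pos: "0 < min 1 a"
  using a_pos by simp

lemma min_1_a_le: "0 \<le> t \<Longrightarrow> min 1 a * (1 + t) \<le> 1 + a * t"
  using a_pos by (simp add: distrib_left add_mono mult_right_mono)

lemma M_ge: "K \<le> M" "2 * K / min 1 a \<le> M" "0 \<le> M"
  using K_nonneg min_1_a_pos by (auto simp: M_def)

lemma norm_D0: "0 \<le> t \<Longrightarrow> norm (D 0 t) \<le> M"
  using norm_GS[OF dominated_dco, of 0 t] M_ge by simp

lemma norm_D: 
  assumes "0 < t" "j \<le> 2"
  shows "norm (D j t) \<le> M / sqrt t ^ j"
proof -
  have "norm (D j t) \<le> K / sqrt t ^ j" using norm_GS[OF dominated_dco, of j t] assms by simp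
  also have "\<dots> \<le> M / sqrt t ^ j" using M_ge assms by (intro divide_right_mono) auto
  finally show ?thesis .
qed

lemma norm_R:
  assumes t: "0 \<le> t" and j: "j \<le> 2"
  shows "norm (R j t) \<le> M / (1 + t) / sqrt t ^ j"
proof -
  have "2 / (1 + a * t) \<le> 2 / (min 1 a * (1 + t))"
    using min_1_a_le[OF t] min_1_a_pos a_pos t by (intro divide_left_mono mult_pos_pos) (auto intro: add_pos_nonneg)
  then have "K * (2 / (1 + a * t)) \<le> K * (2 / (min 1 a * (1 + t)))" using K_nonneg by (rule mult_left_mono)
  also have "\<dots> = 2 * K / min 1 a / (1 + t)" by simp
  also have "\<dots> \<le> M / (1 + t)" using M_ge t by (intro divide_right_mono) auto
  finally have "K * (2 / (1 + a * t)) / sqrt t ^ j \<le> M / (1 + t) / sqrt t ^ j"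
    using t by (intro divide_right_mono) auto
  then show ?thesis using norm_GS[OF dominated_fco j t] by linarith
qed

text \<open>With r^2 = t / (1 + t) the claim is r^2 \<le> r^j. The factor t of the mixed entry thus
  pays for up to two derivatives at time zero, which is why \<open>E\<close> remains bounded there
  while \<open>D\<close> and \<open>R\<close> become singular.\<close>

lemma eco_weight_le:
  assumes t: "0 \<le> t" and j: "j \<le> 2"
  shows "t / (1 + t) / sqrt t ^ j \<le> 1 / sqrt (1 + t) ^ j"
proof (cases "t = 0")
  case False
  then have t: "0 < t" using t by simp
  define r where "r = sqrt t / sqrt (1 + t)"
  have r: "0 < r" "r \<le> 1" using t by (auto simp: r_def)
  have "t / (1 + t) = r\<^sup>2" using t by (simp add: r_def power_divide)
  also have "\<dots> \<le> r ^ j" using r j by (intro power_decreasing) auto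
  finally have "t / (1 + t) / sqrt t ^ j \<le> r ^ j / sqrt t ^ j" using t by (intro divide_right_mono) auto
  also have "\<dots> = 1 / sqrt (1 + t) ^ j" using t by (simp add: r_def power_divide)
  finally show ?thesis .
qed simp

lemma norm_E:
  assumes t: "0 \<le> t" and j: "j \<le> 2"
  shows "norm (E j t) \<le> M / sqrt (1 + t) ^ j"
proof -
  have "2 * t / (1 + a * t) \<le> 2 * t / (min 1 a * (1 + t))"
    using min_1_a_le[OF t] min_1_a_pos a_pos t by (intro divide_left_mono mult_pos_pos) (auto intro: add_pos_nonneg)
  then have "K * (2 * t / (1 + a * t)) / sqrt t ^ j \<le> K * (2 * t / (min 1 a * (1 + t))) / sqrt t ^ j"
    using K_nonneg t by (intro divide_right_mono mult_left_mono) auto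
  also have "\<dots> = 2 * K / min 1 a * (t / (1 + t) / sqrt t ^ j)" by (simp add: mult_ac)
  also have "\<dots> \<le> M * (1 / sqrt (1 + t) ^ j)"
    using M_ge eco_weight_le[OF t j] t by (intro mult_mono) auto
  finally show ?thesis using norm_GS[OF dominated_eco j t] by simp
qed

lemma strong_cont_D: "strong_cont (D 0)"
  unfolding strong_cont_def
proof (intro conjI allI)
  show "continuous_on {0..} (\<lambda>t. D 0 t f)" for f
    using continuous_GS[OF dominated_dco, of 0 0 1 f] by simp
  show "\<exists>B. \<forall>t\<in>{0..T}. norm (D 0 t) \<le> B" for T using norm_D0 by (intro exI[of _ M]) auto
qed

lemma strong_cont_R: "strong_cont (R 0)"
  unfolding strong_cont_def
proof (intro conjI allI)
  have "2 / (1 + a * t) \<le> 2" if "0 \<le> t" for t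
    using a_pos that by (simp add: divide_le_eq add_pos_nonneg)
  then show "continuous_on {0..} (\<lambda>t. R 0 t f)" for f
    using continuous_GS[OF dominated_fco, of 0 0 2 f] by simp
  have "norm (R 0 t) \<le> M" if "0 \<le> t" for t
  proof -
    have "M / (1 + t) \<le> M / 1" using that M_ge by (intro divide_left_mono) auto
    then show ?thesis using norm_R[OF that, of 0] by simp
  qed
  then show "\<exists>B. \<forall>t\<in>{0..T}. norm (R 0 t) \<le> B" for T by (intro exI[of _ M]) auto
qed

lemma strong_cont_E:
  assumes j: "j \<le> 2"
  shows "strong_cont (E j)"
  unfolding strong_cont_def
proof (intro conjI allI)
  have le1: "1 / sqrt (1 + t) ^ j \<le> 1" if "0 \<le> t" for t using that by simp
  show "continuous_on {0..} (\<lambda>t. E j t f)" for f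
  proof -
    have "2 * t / (1 + a * t) / sqrt t ^ j \<le> 2 / min 1 a" if t: "0 \<le> t" for t
    proof -
      have "2 * t / (1 + a * t) \<le> 2 * t / (min 1 a * (1 + t))"
        using min_1_a_le[OF t] min_1_a_pos a_pos t by (intro divide_left_mono mult_pos_pos) (auto intro: add_pos_nonneg)
      then have "2 * t / (1 + a * t) / sqrt t ^ j \<le> 2 * t / (min 1 a * (1 + t)) / sqrt t ^ j"
        using t by (intro divide_right_mono) auto
      also have "\<dots> = 2 / min 1 a * (t / (1 + t) / sqrt t ^ j)" by (simp add: mult_ac)
      also have "\<dots> \<le> 2 / min 1 a * 1"
        using min_1_a_pos order_trans[OF eco_weight_le[OF t j] le1[OF t]] by (intro mult_left_mono) auto
      finally show ?thesis by simp
    qed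
    then show ?thesis using continuous_GS[OF dominated_eco j, of 0 "2 / min 1 a" f] by simp
  qed
  have "norm (E j t) \<le> M" if "0 \<le> t" for t
    using norm_E[OF that j] mult_left_mono[OF le1[OF that] M_ge(3)] by simp
  then show "\<exists>B. \<forall>t\<in>{0..T}. norm (E j t) \<le> B" for T by (intro exI[of _ M]) auto
qed

lemma weak_singular_D1: "weak_singular (D 1)"
  unfolding weak_singular_def strong_cont_def
proof (intro conjI allI)
  show "continuous_on {0..} (\<lambda>t. (sqrt t *\<^sub>R D 1 t) f)" for f
    using continuous_GS[OF dominated_dco, of 1 1 1 f] by (simp add: scaleR_blinfun.rep_eq)
  have "norm (sqrt t *\<^sub>R D 1 t) \<le> M" if "0 \<le> t" for t
  proof (cases "t = 0")
    case False
    then have "0 < t" using that by simp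
    then show ?thesis using norm_D[of t 1] by (simp add: field_simps)
  qed (use M_ge in simp)
  then show "\<exists>B. \<forall>t\<in>{0..T}. norm (sqrt t *\<^sub>R D 1 t) \<le> B" for T by (intro exI[of _ M]) auto
qed

lemma weak_singular_R1: "weak_singular (R 1)"
  unfolding weak_singular_def strong_cont_def
proof (intro conjI allI)
  have le: "2 / (1 + a * t) \<le> 2" if "0 \<le> t" for t
    using a_pos that by (simp add: divide_le_eq add_pos_nonneg)
  have "sqrt t ^ 1 * (2 / (1 + a * t)) / sqrt t ^ 1 \<le> 2" if "0 \<le> t" for t
    using le[OF that] by (cases "t = 0") auto
  then show "continuous_on {0..} (\<lambda>t. (sqrt t *\<^sub>R R 1 t) f)" for f
    using continuous_GS[OF dominated_fco, of 1 1 2 f] by (simp add: scaleR_blinfun.rep_eq)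
  have "norm (sqrt t *\<^sub>R R 1 t) \<le> M" if "0 \<le> t" for t
  proof (cases "t = 0")
    case False
    then have t: "0 < t" using that by simp
    have "sqrt t * norm (R 1 t) \<le> sqrt t * (M / (1 + t) / sqrt t)"
      using norm_R[of t 1] t by (intro mult_left_mono) auto
    also have "\<dots> = M / (1 + t)" using t by simp
    also have "\<dots> \<le> M / 1" using t M_ge by (intro divide_left_mono) auto
    finally show ?thesis using t by simp
  qed (use M_ge in simp)
  then show "\<exists>B. \<forall>t\<in>{0..T}. norm (sqrt t *\<^sub>R R 1 t) \<le> B" for T by (intro exI[of _ M]) auto
qed

lemma weak_singular_of_strong: "strong_cont P \<Longrightarrow> weak_singular P"
  unfolding weak_singular_def by (rule strong_cont_sqrt)

end

section \<open>The linear response\<close>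

lemma All_less_6: "(\<forall>i<6. P i) \<longleftrightarrow> P 0 \<and> P 1 \<and> P 2 \<and> P 3 \<and> P 4 \<and> P (5::nat)"
proof -
  have "{..<6::nat} = {0, 1, 2, 3, 4, 5}" by auto
  then have "(\<forall>i<6. P i) \<longleftrightarrow> (\<forall>i\<in>{0, 1, 2, 3, 4, 5}. P i)" by (metis lessThan_iff)
  then show ?thesis by simp
qed

lemma All_less_4: "(\<forall>i<4. P i) \<longleftrightarrow> P 0 \<and> P 1 \<and> P 2 \<and> P (3::nat)"
proof -
  have "{..<4::nat} = {0, 1, 2, 3}" by auto
  then have "(\<forall>i<4. P i) \<longleftrightarrow> (\<forall>i\<in>{0, 1, 2, 3}. P i)" by (metis lessThan_iff)
  then show ?thesis by simp
qed

text \<open>A state \<open>v\<close> lists \<open>r\<close>, \<open>r'\<close>, \<open>r''\<close>, \<open>\<phi>\<close>, \<open>\<phi>'\<close>, \<open>\<phi>''\<close>; its \<open>i\<close>-th entry decays like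
  \<open>(1 + t) powr (- wt i / 2)\<close>. A forcing \<open>g\<close> lists \<open>a\<close>, \<open>a'\<close>, \<open>c\<close>, \<open>c'\<close> for the nonlinearity \<open>a\<close> of the
  equation for \<open>\<phi>\<close> and the nonlinearity \<open>c\<close> of the equation for \<open>r\<close>.\<close>

definition wt :: "nat \<Rightarrow> nat" where "wt i = [1, 2, 2, 0, 1, 2] ! i"

text \<open>The exception is the nonlinearity of the r equation, because of the square of \<phi>';
  one derivative improves it to the common rate.\<close>

definition gwt :: "nat \<Rightarrow> nat" where "gwt i = (if i = 2 then 2 else 3)"

definition jet :: "(nat \<Rightarrow> buc) \<Rightarrow> bool" where
  "jet v \<longleftrightarrow> bderiv (v 0) (v 1) \<and> bderiv (v 1) (v 2) \<and> bderiv (v 3) (v 4) \<and> bderiv (v 4) (v 5)"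

definition jet_forcing :: "(nat \<Rightarrow> buc) \<Rightarrow> bool" where
  "jet_forcing v \<longleftrightarrow> bderiv (v 0) (v 1) \<and> bderiv (v 2) (v 3)"

definition forcing :: "real \<Rightarrow> (nat \<Rightarrow> real \<Rightarrow> buc) \<Rightarrow> bool" where
  "forcing N g \<longleftrightarrow> (\<forall>i<4. continuous_on {0..} (g i)) \<and> (\<forall>t\<ge>0. jet_forcing (\<lambda>i. g i t)) \<and>
     (\<forall>i<4. \<forall>t\<ge>0. norm (g i t) \<le> N / sqrt (1 + t) ^ gwt i)"

locale amplitude_phase = dyson a bt for a bt :: real +
  fixes q :: real
  assumes q: "q\<^sup>2 < 1 / 3" and a_eq: "a = 2 * (1 - q\<^sup>2)" and bt_eq: "bt = 4 * q\<^sup>2"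
begin

lemma abs_q: "\<bar>2 * q\<bar> \<le> 2"
proof -
  have "q\<^sup>2 \<le> 1\<^sup>2" using q by simp
  then show ?thesis using abs_le_square_iff[of q 1] by simp
qed

lemma norm_2q_le: "norm x \<le> c \<Longrightarrow> norm ((2 * q) *\<^sub>R x) \<le> 2 * c" for x :: buc
  using mult_mono[OF abs_q, of "norm x" c] by simp

text \<open>A derivative may be moved from the kernel to the datum and back (\<open>GS_deriv\<close>). The definitions put it
  where the operators are strongly continuous up to \<open>t = 0\<close> or weakly singular; the estimates use the form
  that decays.\<close>

definition lin :: "(nat \<Rightarrow> buc) \<Rightarrow> nat \<Rightarrow> real \<Rightarrow> buc" where
  "lin v i t =
    [R 0 t (v 0) - (2 * q) *\<^sub>R E 0 t (v 4), R 0 t (v 1) - (2 * q) *\<^sub>R E 0 t (v 5),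
     R 0 t (v 2) - (2 * q) *\<^sub>R E 1 t (v 5), D 0 t (v 3) + (2 * q) *\<^sub>R E 0 t (v 1),
     D 0 t (v 4) + (2 * q) *\<^sub>R E 1 t (v 1), D 0 t (v 5) + (2 * q) *\<^sub>R E 2 t (v 1)] ! i"

definition resp :: "(nat \<Rightarrow> real \<Rightarrow> buc) \<Rightarrow> nat \<Rightarrow> real \<Rightarrow> buc" where
  "resp g i t =
    [tconv (R 0) (g 2) t - (2 * q) *\<^sub>R tconv (E 0) (g 1) t, tconv (R 0) (g 3) t - (2 * q) *\<^sub>R tconv (E 1) (g 1) t,
     tconv (R 1) (g 3) t - (2 * q) *\<^sub>R tconv (E 2) (g 1) t, tconv (D 0) (g 0) t + (2 * q) *\<^sub>R tconv (E 0) (g 3) t,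
     tconv (D 0) (g 1) t + (2 * q) *\<^sub>R tconv (E 1) (g 3) t, tconv (D 1) (g 1) t + (2 * q) *\<^sub>R tconv (E 2) (g 3) t] ! i"

lemma strong_contD: "strong_cont P \<Longrightarrow> continuous_on {0..} (\<lambda>t. P t f)"
  by (simp add: strong_cont_def)

lemma continuous_lin: "i < 6 \<Longrightarrow> continuous_on {0..} (lin v i)"
proof -
  have "\<forall>i<6. continuous_on {0..} (lin v i)"
    unfolding All_less_6 lin_def
    by (simp add: continuous_on_add continuous_on_diff continuous_on_scaleR continuous_on_const
        strong_contD strong_cont_D strong_cont_R strong_cont_E)
  then show "i < 6 \<Longrightarrow> continuous_on {0..} (lin v i)" by blast
qed

lemmas kernels = strong_cont_D[THEN weak_singular_of_strong] strong_cont_R[THEN weak_singular_of_strong]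
  strong_cont_E[THEN weak_singular_of_strong] weak_singular_D1 weak_singular_R1

lemma continuous_resp:
  assumes "\<forall>i<4. continuous_on {0..} (g i)" "i < 6"
  shows "continuous_on {0..} (resp g i)"
proof -
  have "\<forall>i<6. continuous_on {0..} (resp g i)"
    using assms(1) kernels unfolding All_less_6 All_less_4 resp_def
    by (simp add: continuous_on_add continuous_on_diff continuous_on_scaleR continuous_on_const continuous_tconv)
  then show ?thesis using assms by blast
qed

text \<open>Time zero is included, since \<open>E\<close> vanishes there for every number of
  derivatives.\<close>

lemma bderiv_E: "0 \<le> t \<Longrightarrow> j < 2 \<Longrightarrow> bderiv (E j t f) (E (Suc j) t f)"
  using bderiv_GS[OF dominated_eco] GS_0_at_0[OF dominated_eco] GS_at_0[OF dominated_eco]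
  by (cases "t = 0"; cases j) (auto simp: eco_0)

lemma E_deriv: "0 \<le> t \<Longrightarrow> j < 2 \<Longrightarrow> bderiv f f' \<Longrightarrow> E j t f' = E (Suc j) t f"
  using bderiv_unique[OF bderiv_GS_commute[OF dominated_eco] bderiv_E] by simp

lemma jet_lin:
  assumes v: "jet v" and t: "0 \<le> t"
  shows "jet (\<lambda>i. lin v i t)"
  using v bderiv_E[OF t, of 0] bderiv_E[OF t, of 1] unfolding jet_def lin_def
  by (simp add: bderiv_add bderiv_diff bderiv_scaleR bderiv_GS_commute[OF dominated_dco _ t]
      bderiv_GS_commute[OF dominated_fco _ t] bderiv_GS_commute[OF dominated_eco _ t] numeral_2_eq_2)

lemma lin_0: "lin v 0 0 = v 0" "lin v 3 0 = v 3"
  by (simp_all add: lin_def GS_0_at_0[OF dominated_fco] GS_0_at_0[OF dominated_dco]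
      GS_0_at_0[OF dominated_eco] eco_0 fco_def)

text \<open>For short times the derivative stays on the datum, for long times it is moved to the
  kernel and gains \<open>1 / sqrt t\<close>.\<close>

lemma norm_D_half:
  assumes f: "bderiv f f'" "norm f \<le> c" "norm f' \<le> c" and t: "0 < t"
  shows "norm (D 0 t f') \<le> 2 * (M * c) / sqrt (1 + t)"
proof (rule min_decay[OF order_refl t])
  have c: "0 \<le> c" using f(2) norm_ge_zero order_trans by blast
  show "0 \<le> M * c" using c M_ge by simp
  show "norm (D 0 t f') \<le> M * c"
    using norm_D0[of t] f(3) t M_ge c norm_blinfun[of "D 0 t" f'] by (meson less_imp_le mult_mono norm_ge_zero order_trans)
  have "norm (D 0 t f') = norm (D 1 t f)" using GS_deriv[OF dominated_dco _ t f(1), of 0] by simp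
  also have "\<dots> \<le> norm (D 1 t) * norm f" by (rule norm_blinfun)
  also have "\<dots> \<le> (M / sqrt t) * c" using norm_D[OF t, of 1] f(2) M_ge t by (intro mult_mono) auto
  finally show "norm (D 0 t f') \<le> M * c / sqrt t" by simp
qed

text \<open>The same alternative as for \<open>D 0\<close>: only an integrable singularity at zero,
  but the full decay of two derivatives for large times.\<close>

lemma norm_D1_one:
  assumes f: "bderiv f f'" "norm f \<le> c" "norm f' \<le> c" and t: "0 < t"
  shows "norm (D 1 t f') \<le> 2 * (M * c) / (sqrt t * sqrt (1 + t))"
proof -
  have c: "0 \<le> c" using f(2) norm_ge_zero order_trans by blast
  have "sqrt t * norm (D 1 t f') \<le> 2 * (M * c) / sqrt (1 + t)"
  proof (rule min_decay[OF order_refl t])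
    show "0 \<le> M * c" using c M_ge by simp
    have "norm (D 1 t f') \<le> (M / sqrt t) * c"
      using norm_D[OF t, of 1] f(3) M_ge t norm_blinfun[of "D 1 t" f'] mult_mono[of "norm (D 1 t)" "M / sqrt t" "norm f'" c]
      by auto
    then show "sqrt t * norm (D 1 t f') \<le> M * c" using t by (simp add: field_simps)
    have "norm (D 1 t f') = norm (D 2 t f)"
      using GS_deriv[OF dominated_dco _ t f(1), of 1] by (simp add: numeral_2_eq_2)
    also have "\<dots> \<le> (M / sqrt t ^ 2) * c"
      using norm_D[OF t, of 2] f(2) M_ge t norm_blinfun[of "D 2 t" f] mult_mono[of "norm (D 2 t)" "M / sqrt t ^ 2" "norm f" c]
      by auto
    finally have "sqrt t * norm (D 1 t f') \<le> sqrt t * (M / sqrt t ^ 2 * c)" using t by (intro mult_left_mono) auto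
    moreover have "r * (M / r ^ 2 * c) = M * c / r" if "0 < r" for r :: real
      using that by (simp add: field_simps power2_eq_square)
    ultimately show "sqrt t * norm (D 1 t f') \<le> M * c / sqrt t" using t by (metis real_sqrt_gt_zero)
  qed
  then show ?thesis using t by (simp add: field_simps)
qed

lemma norm_apply_le: "norm (T :: buc \<Rightarrow>\<^sub>L buc) \<le> B \<Longrightarrow> norm f \<le> c \<Longrightarrow> norm (T f) \<le> B * c"
  by (meson mult_mono norm_blinfun norm_ge_zero order_trans)

text \<open>Each component decays at the rate given by the derivatives that can be moved to the
  kernel, except that \<open>R\<close> decays like 1 / (1 + t) by damping alone. The 4 is the
  largest sum that occurs: 2 from \<open>D\<close> on a derivative and 2 from the factor 2
  q.\<close>

lemma norm_lin:
  assumes v: "jet v" and b: "\<forall>i<6. norm (v i) \<le> \<epsilon>" and t: "0 \<le> t" and i: "i < 6"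
  shows "norm (lin v i t) \<le> 4 * M * \<epsilon> / sqrt (1 + t) ^ wt i"
proof -
  have "norm (v 0) \<le> \<epsilon>" using b by simp
  then have \<epsilon>: "0 \<le> \<epsilon>" by (rule order_trans[OF norm_ge_zero])
  define B where "B = M * \<epsilon>"
  have B: "0 \<le> B" using \<epsilon> M_ge by (simp add: B_def)
  define X where "X = sqrt (1 + t)"
  have X: "1 \<le> X" "1 + t = X\<^sup>2" using t by (auto simp: X_def)
  have bE: "norm (E j t f) \<le> B / X ^ j" if "norm f \<le> \<epsilon>" "j \<le> 2" for j f
    using norm_apply_le[OF norm_E[OF t that(2)] that(1)] by (simp add: B_def X_def)
  have bR: "norm (R 0 t f) \<le> B / X\<^sup>2" if "norm f \<le> \<epsilon>" for f
    using norm_apply_le[OF norm_R[OF t, of 0] that] X(2) by (simp add: B_def)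
  have bD: "norm (D 0 t f) \<le> B" if "norm f \<le> \<epsilon>" for f
    using norm_apply_le[OF norm_D0[OF t] that] by (simp add: B_def)
  have X2: "B / X\<^sup>2 + 2 * (B / X ^ 1) \<le> 4 * B / X ^ wt 0"
  proof -
    have "B / X\<^sup>2 \<le> B / X" using X B by (intro divide_left_mono) (auto simp: power2_eq_square)
    moreover have "0 \<le> B / X" using X B by simp
    moreover have "4 * B / X ^ wt 0 = 4 * (B / X)" by (simp add: wt_def)
    ultimately show ?thesis unfolding power_one_right by linarith
  qed
  have bD1: "norm (D 0 t f') \<le> 2 * B / X" if "bderiv f f'" "norm f \<le> \<epsilon>" "norm f' \<le> \<epsilon>" for f f'
  proof (cases "t = 0")
    case True
    then show ?thesis using bD[OF that(3)] B by (simp add: X_def)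
  next
    case False
    then show ?thesis using norm_D_half[OF that] t by (simp add: B_def X_def)
  qed
  \<comment> \<open>For t at most 1 the weight is bounded and no smoothing is used; for larger t
    both derivatives are moved to the kernel.\<close>
  have bD2: "norm (D 0 t f'') \<le> 2 * B / X\<^sup>2"
    if "bderiv f f'" "bderiv f' f''" "norm f \<le> \<epsilon>" "norm f' \<le> \<epsilon>" "norm f'' \<le> \<epsilon>" for f f' f''
  proof (cases "t \<le> 1")
    case True
    then have "B * X\<^sup>2 \<le> B * 2" using B X(2) by (intro mult_left_mono) auto
    then have "B \<le> 2 * B / X\<^sup>2" using X(1) by (simp add: field_simps)
    then show ?thesis using bD[OF that(5)] by linarith
  next
    case False
    then have t0: "0 < t" by simp
    have "D 0 t f'' = D 2 t f"
      using GS_deriv[OF dominated_dco _ t0 that(2), of 0] GS_deriv[OF dominated_dco _ t0 that(1), of 1] by (simp add: numeral_2_eq_2)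
    then have "norm (D 0 t f'') \<le> M / sqrt t ^ 2 * \<epsilon>" using norm_apply_le[OF norm_D[OF t0, of 2] that(3)] by simp
    also have "\<dots> = B / t" using t0 by (simp add: B_def)
    also have "\<dots> \<le> B * 2 / X\<^sup>2" using mult_left_mono[of 1 t B] False B unfolding X(2)[symmetric]
      by (simp add: divide_simps algebra_simps)
    finally show ?thesis by (simp only: mult.commute)
  qed
  have d: "bderiv (v 0) (v 1)" "bderiv (v 1) (v 2)" "bderiv (v 3) (v 4)" "bderiv (v 4) (v 5)"
    using v unfolding jet_def by auto
  have n: "norm (v 0) \<le> \<epsilon>" "norm (v 1) \<le> \<epsilon>" "norm (v 2) \<le> \<epsilon>" "norm (v 3) \<le> \<epsilon>" "norm (v 4) \<le> \<epsilon>" "norm (v 5) \<le> \<epsilon>"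
    using b unfolding All_less_6 by auto
  \<comment> \<open>In the r components all derivatives of the initial phase that \<open>E\<close>
    can take go to the kernel, at most two of them.\<close>
  have e04: "E 0 t (v 4) = E 1 t (v 3)" and e05: "E 0 t (v 5) = E 2 t (v 3)" and e15: "E 1 t (v 5) = E 2 t (v 4)"
    using E_deriv[OF t _ d(3), of 0] E_deriv[OF t _ d(4), of 0] E_deriv[OF t _ d(3), of 1] E_deriv[OF t _ d(4), of 1]
    by (auto simp: numeral_2_eq_2)
  have sc: "c * B / X ^ k \<le> c' * B / X ^ k" if "c \<le> c'" for c c' k
    using that B X by (intro divide_right_mono mult_right_mono) auto
  have "\<forall>i<6. norm (lin v i t) \<le> 4 * B / X ^ wt i"
    unfolding All_less_6
  proof (intro conjI)
    show "norm (lin v 0 t) \<le> 4 * B / X ^ wt 0"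
      using order_trans[OF norm_triangle_le_diff[OF add_mono[OF bR[OF n(1)] norm_2q_le[OF bE[OF n(4), of 1]]]] X2]
      by (simp add: lin_def e04)
    show "norm (lin v 1 t) \<le> 4 * B / X ^ wt 1"
      using norm_triangle_le_diff[OF add_mono[OF bR[OF n(2)] norm_2q_le[OF bE[OF n(4), of 2]]]] B X
      by (intro order_trans[OF _ sc[of 3 4 "wt 1"]]) (simp_all add: lin_def wt_def e05)
    show "norm (lin v 2 t) \<le> 4 * B / X ^ wt 2"
      using norm_triangle_le_diff[OF add_mono[OF bR[OF n(3)] norm_2q_le[OF bE[OF n(5), of 2]]]] B X
      by (intro order_trans[OF _ sc[of 3 4 "wt 2"]]) (simp_all add: lin_def wt_def e15[unfolded One_nat_def])
    show "norm (lin v 3 t) \<le> 4 * B / X ^ wt 3"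
      using norm_triangle_le[OF add_mono[OF bD[OF n(4)] norm_2q_le[OF bE[OF n(2), of 0]]]] B X
      by (intro order_trans[OF _ sc[of 3 4 "wt 3"]]) (simp_all add: lin_def wt_def)
    show "norm (lin v 4 t) \<le> 4 * B / X ^ wt 4"
      using norm_triangle_le[OF add_mono[OF bD1[OF d(3) n(4,5)] norm_2q_le[OF bE[OF n(2), of 1]]]] B X
      by (simp add: lin_def wt_def)
    show "norm (lin v 5 t) \<le> 4 * B / X ^ wt 5"
      using norm_triangle_le[OF add_mono[OF bD2[OF d(3,4) n(4,5,6)] norm_2q_le[OF bE[OF n(2), of 2]]]] B X
      by (simp add: lin_def wt_def)
  qed
  then show ?thesis using i by (simp add: B_def X_def mult.assoc)
qed

lemma resp_diff:
  assumes g: "\<forall>i<4. continuous_on {0..} (g i)" and h: "\<forall>i<4. continuous_on {0..} (h i)"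
    and t: "0 \<le> t" and i: "i < 6"
  shows "resp (\<lambda>i t. g i t - h i t) i t = resp g i t - resp h i t"
proof -
  have "\<forall>i<6. resp (\<lambda>i t. g i t - h i t) i t = resp g i t - resp h i t"
    using g h kernels unfolding All_less_6 All_less_4 resp_def
    by (simp add: tconv_diff t scaleR_diff_right)
  then show ?thesis using i by blast
qed

lemma jet_resp:
  assumes g: "forcing N g" and t: "0 \<le> t"
  shows "jet (\<lambda>i. resp g i t)"
proof -
  have c: "continuous_on {0..} (g 0)" "continuous_on {0..} (g 1)" "continuous_on {0..} (g 2)" "continuous_on {0..} (g 3)"
    and d: "\<And>s. 0 \<le> s \<Longrightarrow> bderiv (g 0 s) (g 1 s)" "\<And>s. 0 \<le> s \<Longrightarrow> bderiv (g 2 s) (g 3 s)"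
    using g unfolding forcing_def All_less_4 jet_forcing_def by auto
  have 1: "bderiv (tconv (R 0) (g 2) t) (tconv (R 0) (g 3) t)" "bderiv (tconv (D 0) (g 0) t) (tconv (D 0) (g 1) t)"
    using c d kernels
    by (auto intro!: bderiv_tconv t bderiv_GS_commute[OF dominated_dco] bderiv_GS_commute[OF dominated_fco])
  have 2: "bderiv (tconv (R 0) n t) (tconv (R 1) n t)" "bderiv (tconv (D 0) n t) (tconv (D 1) n t)"
    "bderiv (tconv (E 0) n t) (tconv (E 1) n t)" "bderiv (tconv (E 1) n t) (tconv (E 2) n t)"
    if "continuous_on {0..} n" for n
    using that kernels bderiv_GS[OF dominated_dco, of 0] bderiv_GS[OF dominated_fco, of 0]
      bderiv_GS[OF dominated_eco, of 0] bderiv_GS[OF dominated_eco, of 1]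
    by (auto intro!: bderiv_tconv t simp: numeral_2_eq_2)
  show ?thesis unfolding jet_def resp_def
    using 1 2 c by (simp add: bderiv_add bderiv_diff bderiv_scaleR)
qed

text \<open>The slowly decaying forcing \<open>g 2\<close> meets only \<open>R\<close>, whose own
  decay compensates; in the phase components only its derivative \<open>g 3\<close> enters, with
  decay 3 / 2. The 96 is attained in the last component: 48 from \<open>D 1\<close> and twice 24
  from \<open>E 2\<close>.\<close>

lemma norm_resp:
  assumes g: "forcing N g" and t: "0 \<le> t" and i: "i < 6"
  shows "norm (resp g i t) \<le> 96 * M * N / sqrt (1 + t) ^ wt i"
proof -
  have c: "continuous_on {0..} (g 0)" "continuous_on {0..} (g 1)" "continuous_on {0..} (g 2)" "continuous_on {0..} (g 3)"
    and d: "\<And>s. 0 \<le> s \<Longrightarrow> bderiv (g 0 s) (g 1 s)" "\<And>s. 0 \<le> s \<Longrightarrow> bderiv (g 2 s) (g 3 s)"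
    and n: "\<And>s. 0 \<le> s \<Longrightarrow> norm (g 0 s) \<le> N / sqrt (1 + s) ^ 3" "\<And>s. 0 \<le> s \<Longrightarrow> norm (g 1 s) \<le> N / sqrt (1 + s) ^ 3"
      "\<And>s. 0 \<le> s \<Longrightarrow> norm (g 2 s) \<le> N / (1 + s)" "\<And>s. 0 \<le> s \<Longrightarrow> norm (g 3 s) \<le> N / sqrt (1 + s) ^ 3"
    using g unfolding forcing_def All_less_4 jet_forcing_def by (auto simp: gwt_def)
  have "norm (g 0 0) \<le> N" using n(1)[of 0] by simp
  then have N: "0 \<le> N" by (rule order_trans[OF norm_ge_zero])
  define B where "B = M * N"
  have B: "0 \<le> B" using N M_ge by (simp add: B_def)
  define X where "X = sqrt (1 + t)"
  have X: "1 \<le> X" "1 + t = X\<^sup>2" using t by (auto simp: X_def)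
  note kn = kernels
  have sy: "sqrt \<tau> * sqrt (1 + \<tau>) \<le> 1 + \<tau>" if "0 < \<tau>" for \<tau>
  proof -
    have "sqrt \<tau> * sqrt (1 + \<tau>) \<le> sqrt (1 + \<tau>) * sqrt (1 + \<tau>)" using that by (intro mult_right_mono) auto
    then show ?thesis using that by simp
  qed
  have one: "norm (P \<tau> (n s)) \<le> B * (1 / (sqrt \<tau> * sqrt (1 + \<tau>) * sqrt (1 + s) ^ 3))"
    if P: "norm (P \<tau>) \<le> M / (sqrt \<tau> * sqrt (1 + \<tau>))" and n: "norm (n s) \<le> N / sqrt (1 + s) ^ 3"
    for P :: "real \<Rightarrow> buc \<Rightarrow>\<^sub>L buc" and n :: "real \<Rightarrow> buc" and s \<tau>
    using norm_apply_le[OF P n] by (simp add: B_def)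
  have le1: "M / (1 + \<tau>) \<le> M / (sqrt \<tau> * sqrt (1 + \<tau>))" if "0 < \<tau>" for \<tau>
    using sy[OF that] M_ge that by (intro divide_left_mono) auto
  have kE2: "norm (E 2 \<tau>) \<le> M / (sqrt \<tau> * sqrt (1 + \<tau>))" if "0 < \<tau>" for \<tau>
    using norm_E[of \<tau> 2] le1[OF that] that by simp
  have kR0: "norm (R 0 \<tau>) \<le> M / (sqrt \<tau> * sqrt (1 + \<tau>))" if "0 < \<tau>" for \<tau>
    using norm_R[of \<tau> 0] le1[OF that] that by simp
  have kR1: "norm (R 1 \<tau>) \<le> M / (sqrt \<tau> * sqrt (1 + \<tau>))" if "0 < \<tau>" for \<tau>
  proof -
    have "M / ((1 + \<tau>) * sqrt \<tau>) \<le> M / (sqrt \<tau> * sqrt (1 + \<tau>))"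
    proof (rule divide_left_mono[OF _ M_ge(3)])
      have "sqrt (1 + \<tau>) * 1 \<le> sqrt (1 + \<tau>) * sqrt (1 + \<tau>)" using that by (intro mult_left_mono) auto
      then show "sqrt \<tau> * sqrt (1 + \<tau>) \<le> (1 + \<tau>) * sqrt \<tau>" using that by simp
    qed (use that in auto)
    then show ?thesis using norm_R[of \<tau> 1] that by simp
  qed
  \<comment> \<open>\<open>E 1\<close> decays only like the inverse root of 1 + \<tau>. Trading the
    derivative in \<open>g 1\<close> for one on the kernel gives the full rate, and
    \<open>g 0\<close> decays as fast as \<open>g 1\<close>.\<close>
  have E1_eq: "tconv (E 1) (g 1) t = tconv (E 2) (g 0) t"
    by (rule tconv_cong[OF t]) (use E_deriv[OF _ _ d(1), of _ 1] in \<open>simp add: numeral_2_eq_2\<close>)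
  have E0_eq: "tconv (E 0) (g 1) t = tconv (E 1) (g 0) t"
    by (rule tconv_cong[OF t]) (use E_deriv[OF _ _ d(1), of _ 0] in simp)
  have b2: "norm (tconv (E 2) (g 0) t) \<le> 24 * B / X\<^sup>2" "norm (tconv (E 2) (g 1) t) \<le> 24 * B / X\<^sup>2"
    "norm (tconv (E 2) (g 3) t) \<le> 24 * B / X\<^sup>2" "norm (tconv (R 0) (g 3) t) \<le> 24 * B / X\<^sup>2"
    "norm (tconv (R 1) (g 3) t) \<le> 24 * B / X\<^sup>2"
    unfolding X(2)[symmetric] using kn c
    by (auto intro!: tconv_decay_one t B one kE2 kR0 kR1 n kR1[unfolded One_nat_def] n[unfolded One_nat_def])
  have bD1: "norm (tconv (D 1) (g 1) t) \<le> 24 * (2 * B) / X\<^sup>2"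
    unfolding X(2)[symmetric]
  proof (rule tconv_decay_one[OF weak_singular_D1 c(2) t])
    show "norm (D 1 \<tau> (g 1 s)) \<le> 2 * B * (1 / (sqrt \<tau> * sqrt (1 + \<tau>) * sqrt (1 + s) ^ 3))" if "0 \<le> s" "0 < \<tau>" for s \<tau>
      using norm_D1_one[OF d(1)[OF that(1)] n(1,2)[OF that(1)] that(2)] by (simp add: B_def mult_ac)
  qed (use B in simp)
  have bD0: "norm (tconv (D 0) (g 1) t) \<le> 12 * (2 * B) / X"
    unfolding X_def
  proof (rule tconv_decay_half[OF kn(1) c(2) t])
    show "norm (D 0 \<tau> (g 1 s)) \<le> 2 * B * (1 / (sqrt (1 + \<tau>) * sqrt (1 + s) ^ 3))" if "0 \<le> s" "0 < \<tau>" for s \<tau>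
      using norm_D_half[OF d(1)[OF that(1)] n(1,2)[OF that(1)] that(2)] by (simp add: B_def mult_ac)
  qed (use B in simp)
  have bE1: "norm (tconv (E 1) h t) \<le> 12 * B / X"
    if h: "continuous_on {0..} h" "\<And>s. 0 \<le> s \<Longrightarrow> norm (h s) \<le> N / sqrt (1 + s) ^ 3" for h
    unfolding X_def
  proof (rule tconv_decay_half[OF kn(3) h(1) t B])
    show "norm (E 1 \<tau> (h s)) \<le> B * (1 / (sqrt (1 + \<tau>) * sqrt (1 + s) ^ 3))" if "0 \<le> s" "0 < \<tau>" for s \<tau>
      using norm_apply_le[OF norm_E[of \<tau> 1] h(2)[OF that(1)]] that by (simp add: B_def)
  qed simp
  have bR0: "norm (tconv (R 0) (g 2) t) \<le> 12 * B / X"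
    unfolding X_def
  proof (rule tconv_decay_half'[OF kn(2) c(3) t B])
    show "norm (R 0 \<tau> (g 2 s)) \<le> B * (1 / ((1 + \<tau>) * (1 + s)))" if "0 \<le> s" "0 < \<tau>" for s \<tau>
      using norm_apply_le[OF norm_R[of \<tau> 0] n(3)[OF that(1)]] that by (simp add: B_def)
  qed
  have b0: "norm (tconv (D 0) (g 0) t) \<le> 6 * B"
  proof (rule tconv_bounded[OF kn(1) c(1) t B])
    show "norm (D 0 \<tau> (g 0 s)) \<le> B * (1 / sqrt (1 + s) ^ 3)" if "0 \<le> s" "0 < \<tau>" for s \<tau>
      using norm_apply_le[OF norm_D0[of \<tau>] n(1)[OF that(1)]] that by (simp add: B_def)
  qed
  have b0': "norm (tconv (E 0) (g 3) t) \<le> 6 * B"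
  proof (rule tconv_bounded[OF kn(3) c(4) t B])
    show "norm (E 0 \<tau> (g 3 s)) \<le> B * (1 / sqrt (1 + s) ^ 3)" if "0 \<le> s" "0 < \<tau>" for s \<tau>
      using norm_apply_le[OF norm_E[of \<tau> 0] n(4)[OF that(1)]] that by (simp add: B_def)
  qed simp
  have sc: "c * B / X ^ k \<le> c' * B / X ^ k" if "c \<le> c'" for c c' k
    using that B X by (intro divide_right_mono mult_right_mono) auto
  have "\<forall>i<6. norm (resp g i t) \<le> 96 * B / X ^ wt i"
    unfolding All_less_6
  proof (intro conjI)
    show "norm (resp g 0 t) \<le> 96 * B / X ^ wt 0"
      using norm_triangle_le_diff[OF add_mono[OF bR0 norm_2q_le[OF bE1[OF c(1) n(1)]]]] B X
      by (intro order_trans[OF _ sc[of 36 96 "wt 0"]]) (simp_all add: resp_def wt_def E0_eq[unfolded One_nat_def])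
    show "norm (resp g 1 t) \<le> 96 * B / X ^ wt 1"
      using norm_triangle_le_diff[OF add_mono[OF b2(4) norm_2q_le[OF b2(1)]]] B X
      by (intro order_trans[OF _ sc[of 72 96 "wt 1"]]) (simp_all add: resp_def wt_def E1_eq[unfolded One_nat_def])
    show "norm (resp g 2 t) \<le> 96 * B / X ^ wt 2"
      using norm_triangle_le_diff[OF add_mono[OF b2(5) norm_2q_le[OF b2(2)]]] B X
      by (intro order_trans[OF _ sc[of 72 96 "wt 2"]]) (simp_all add: resp_def wt_def)
    show "norm (resp g 3 t) \<le> 96 * B / X ^ wt 3"
      using norm_triangle_le[OF add_mono[OF b0 norm_2q_le[OF b0']]] B X
      by (intro order_trans[OF _ sc[of 18 96 "wt 3"]]) (simp_all add: resp_def wt_def)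
    show "norm (resp g 4 t) \<le> 96 * B / X ^ wt 4"
      using norm_triangle_le[OF add_mono[OF bD0 norm_2q_le[OF bE1[OF c(4) n(4)]]]] B X
      by (intro order_trans[OF _ sc[of 48 96 "wt 4"]]) (simp_all add: resp_def wt_def)
    show "norm (resp g 5 t) \<le> 96 * B / X ^ wt 5"
      using norm_triangle_le[OF add_mono[OF bD1 norm_2q_le[OF b2(3)]]] B X
      by (simp add: resp_def wt_def)
  qed
  then show ?thesis using i by (simp add: B_def X_def mult.assoc)
qed

end

section \<open>The nonlinearity\<close>

lemma exp_Lipschitz:
  fixes x y :: real
  assumes "\<bar>x\<bar> \<le> 1" "\<bar>y\<bar> \<le> 1"
  shows "\<bar>exp x - exp y\<bar> \<le> 3 * \<bar>x - y\<bar>"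
proof -
  have *: "\<bar>exp y - exp x\<bar> \<le> 3 * \<bar>y - x\<bar>" if xy: "x < y" "y \<le> 1" for x y :: real
  proof -
    obtain z where z: "x < z" "z < y" "exp y - exp x = (y - x) * exp z"
      using MVT2[OF xy(1), of exp exp] by (auto intro!: derivative_eq_intros)
    have "exp z \<le> 3" using exp_le order_trans[of "exp z" "exp 1" 3] z xy by simp
    then have "\<bar>y - x\<bar> * exp z \<le> \<bar>y - x\<bar> * 3" by (intro mult_left_mono) auto
    then show ?thesis unfolding z(3) by (simp only: abs_mult abs_exp_cancel mult.commute)
  qed
  show ?thesis using *[of x y] *[of y x] assms by (cases x y rule: linorder_cases) (auto simp: abs_minus_commute)
qed

text \<open>By the mean value theorem the slope is \<open>exp z - 1\<close>, itself of size at most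
  3 m; this small slope makes the remainder quadratic.\<close>

lemma exp_remainder_Lipschitz:
  fixes x y m :: real
  assumes m: "m \<le> 1" "\<bar>x\<bar> \<le> m" "\<bar>y\<bar> \<le> m"
  shows "\<bar>(exp x - 1 - x) - (exp y - 1 - y)\<bar> \<le> 3 * m * \<bar>x - y\<bar>"
proof -
  have *: "\<bar>(exp y - 1 - y) - (exp x - 1 - x)\<bar> \<le> 3 * m * \<bar>y - x\<bar>" if xy: "x < y" "\<bar>x\<bar> \<le> m" "\<bar>y\<bar> \<le> m" for x y :: real
  proof -
    have D: "((\<lambda>z. exp z - 1 - z) has_real_derivative exp z - 1) (at z)" for z :: real
      by (auto intro!: derivative_eq_intros)
    obtain z where z: "x < z" "z < y" "(exp y - 1 - y) - (exp x - 1 - x) = (y - x) * (exp z - 1)"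
      using MVT2[OF xy(1) D] by blast
    have "\<bar>z\<bar> \<le> m" using z xy by auto
    then have "\<bar>exp z - 1\<bar> \<le> 3 * m" using exp_Lipschitz[of z 0] m by auto
    then have "\<bar>y - x\<bar> * \<bar>exp z - 1\<bar> \<le> \<bar>y - x\<bar> * (3 * m)" by (intro mult_left_mono) auto
    then show ?thesis unfolding z(3) by (simp add: abs_mult mult_ac)
  qed
  show ?thesis using *[of x y] *[of y x] m by (cases x y rule: linorder_cases) (auto simp: abs_minus_commute)
qed

lemma norm_exp_diff:
  fixes f g :: buc
  assumes "norm f \<le> 1" "norm g \<le> 1"
  shows "norm (exp f - exp g) \<le> 3 * norm (f - g)"
proof (rule norm_buc_le)
  fix x
  have "\<bar>exp (app f x) - exp (app g x)\<bar> \<le> 3 * \<bar>app f x - app g x\<bar>"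
    using abs_app_le_norm[of f x] abs_app_le_norm[of g x] assms by (intro exp_Lipschitz) auto
  also have "\<dots> \<le> 3 * norm (f - g)" using abs_app_le_norm[of "f - g" x] by simp
  finally show "\<bar>app (exp f - exp g) x\<bar> \<le> 3 * norm (f - g)" by (simp add: app_exp)
qed

lemma norm_exp_remainder_diff:
  fixes f g :: buc
  assumes "m \<le> 1" "norm f \<le> m" "norm g \<le> m"
  shows "norm ((exp f - 1 - f) - (exp g - 1 - g)) \<le> 3 * m * norm (f - g)"
proof (rule norm_buc_le)
  fix x
  have m: "0 \<le> m" using assms(2) norm_ge_zero order_trans by blast
  have "\<bar>(exp (app f x) - 1 - app f x) - (exp (app g x) - 1 - app g x)\<bar> \<le> 3 * m * \<bar>app f x - app g x\<bar>"
    using abs_app_le_norm[of f x] abs_app_le_norm[of g x] assms by (intro exp_remainder_Lipschitz) auto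
  also have "\<dots> \<le> 3 * m * norm (f - g)" using abs_app_le_norm[of "f - g" x] m by (intro mult_left_mono) auto
  finally show "\<bar>app ((exp f - 1 - f) - (exp g - 1 - g)) x\<bar> \<le> 3 * m * norm (f - g)" by (simp add: app_exp)
qed

lemma continuous_on_exp_buc:
  fixes f :: "'a::topological_space \<Rightarrow> buc"
  assumes f: "continuous_on S f" and b: "\<And>x. x \<in> S \<Longrightarrow> norm (f x) \<le> 1"
  shows "continuous_on S (\<lambda>x. exp (f x))"
  unfolding continuous_on_def
proof
  fix x assume x: "x \<in> S"
  have "(f \<longlongrightarrow> f x) (at x within S)" using f x by (simp add: continuous_on_def)
  then have "((\<lambda>y. 3 * norm (f y - f x)) \<longlongrightarrow> 0) (at x within S)"
    by (intro tendsto_mult_right_zero tendsto_norm_zero) (simp add: LIM_zero)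
  then have "((\<lambda>y. exp (f y) - exp (f x)) \<longlongrightarrow> 0) (at x within S)"
    by (rule Lim_null_comparison[rotated]) (use norm_exp_diff b x in \<open>auto simp: eventually_at_filter\<close>)
  then show "((\<lambda>y. exp (f y)) \<longlongrightarrow> exp (f x)) (at x within S)" by (rule LIM_zero_cancel)
qed

lemma norm_prod_diff_le:
  fixes f g f' g' :: "'a::real_normed_algebra"
  assumes "norm f' \<le> A" "norm g \<le> B" "norm (f - f') \<le> A'" "norm (g - g') \<le> B'"
  shows "norm (f * g - f' * g') \<le> A' * B + A * B'"
proof -
  have "f * g - f' * g' = (f - f') * g + f' * (g - g')" by (simp add: algebra_simps)
  then have "norm (f * g - f' * g') \<le> norm (f - f') * norm g + norm f' * norm (g - g')"
    by (metis norm_triangle_le add_mono norm_mult_ineq)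
  also have "\<dots> \<le> A' * B + A * B'"
    using assms by (intro add_mono mult_mono) (auto intro: order_trans[OF norm_ge_zero])
  finally show ?thesis .
qed

context amplitude_phase
begin

text \<open>The linear part 2 r of \<open>exp (2 r) - 1\<close> is subtracted, since with its
  coefficient it is the damping a r built into the kernels. Entries 1 and 3 are the spatial
  derivatives of entries 0 and 2.\<close>

definition nl :: "(nat \<Rightarrow> buc) \<Rightarrow> nat \<Rightarrow> buc" where
  "nl v i =
    [2 *\<^sub>R (v 1 * v 4), 2 *\<^sub>R (v 2 * v 4 + v 1 * v 5),
     (- (1 - q\<^sup>2)) *\<^sub>R (exp (2 *\<^sub>R v 0) - 1 - 2 *\<^sub>R v 0) + v 1 * v 1 - v 4 * v 4,
     (- (1 - q\<^sup>2)) *\<^sub>R (2 *\<^sub>R (v 1 * (exp (2 *\<^sub>R v 0) - 1))) + 2 *\<^sub>R (v 1 * v 2) - 2 *\<^sub>R (v 4 * v 5)] ! i"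

lemma nl_0: "i < 4 \<Longrightarrow> nl (\<lambda>_. 0) i = 0"
proof -
  have "\<forall>i<4. nl (\<lambda>_. 0) i = 0" unfolding All_less_4 by (simp add: nl_def)
  then show "i < 4 \<Longrightarrow> nl (\<lambda>_. 0) i = 0" by blast
qed

lemma jet_forcing_nl:
  assumes "jet v"
  shows "jet_forcing (nl v)"
proof -
  have d: "bderiv (v 0) (v 1)" "bderiv (v 1) (v 2)" "bderiv (v 3) (v 4)" "bderiv (v 4) (v 5)"
    using assms unfolding jet_def by auto
  have "bderiv (1::buc) 0" unfolding bderiv_def by (simp add: one_buc.rep_eq zero_buc.rep_eq)
  moreover have "nl v 2 = (- (1 - q\<^sup>2)) *\<^sub>R (exp (2 *\<^sub>R v 0) - 1 - 2 *\<^sub>R v 0) + v 1 * v 1 - v 4 * v 4"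
    by (simp add: nl_def)
  ultimately have "bderiv (nl v 2) ((- (1 - q\<^sup>2)) *\<^sub>R ((2 *\<^sub>R v 1) * exp (2 *\<^sub>R v 0) - 0 - 2 *\<^sub>R v 1)
      + (v 2 * v 1 + v 1 * v 2) - (v 5 * v 4 + v 4 * v 5))"
    using d by (simp only:) (intro bderiv_add bderiv_diff bderiv_scaleR bderiv_mult bderiv_exp)
  also have "(- (1 - q\<^sup>2)) *\<^sub>R ((2 *\<^sub>R v 1) * exp (2 *\<^sub>R v 0) - 0 - 2 *\<^sub>R v 1)
      + (v 2 * v 1 + v 1 * v 2) - (v 5 * v 4 + v 4 * v 5) = nl v 3"
  proof -
    have "v 2 * v 1 + v 1 * v 2 = 2 *\<^sub>R (v 1 * v 2)" "v 5 * v 4 + v 4 * v 5 = 2 *\<^sub>R (v 4 * v 5)"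
      by (simp_all add: scaleR_2 mult.commute)
    moreover have "(2 *\<^sub>R v 1) * exp (2 *\<^sub>R v 0) - 0 - 2 *\<^sub>R v 1 = 2 *\<^sub>R (v 1 * (exp (2 *\<^sub>R v 0) - 1))"
      by (simp add: right_diff_distrib scaleR_diff_right)
    ultimately show ?thesis by (simp add: nl_def)
  qed
  finally have "bderiv (nl v 2) (nl v 3)" .
  moreover have "bderiv (nl v 0) (nl v 1)"
    using d unfolding nl_def by (simp add: bderiv_scaleR bderiv_mult)
  ultimately show ?thesis unfolding jet_forcing_def by blast
qed

text \<open>Pure counting of weights at X = sqrt (1 + t): in every product they add up to at least
  \<open>gwt\<close>. The 32 is the sum 24 + 4 + 4 for the last entry; the bound on d keeps the
  exponent 2 r in the unit ball.\<close>

lemma norm_nl_diff: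
  assumes X: "1 \<le> X" and d: "0 \<le> d" "d \<le> 1 / 2"
    and v: "\<forall>i<6. norm (v i) \<le> d / X ^ wt i" and w: "\<forall>i<6. norm (w i) \<le> d / X ^ wt i"
    and e: "\<forall>i<6. norm (v i - w i) \<le> e / X ^ wt i" and i: "i < 4"
  shows "norm (nl v i - nl w i) \<le> 32 * d * e / X ^ gwt i"
proof -
  have "norm (v 3 - w 3) \<le> e" using e[rule_format, of 3] by (simp add: wt_def)
  then have e0: "0 \<le> e" by (rule order_trans[OF norm_ge_zero])
  define B where "B = d * e"
  have B: "0 \<le> B" using d e0 by (simp add: B_def)
  have mono: "c * B / X ^ l \<le> c * B / X ^ k" if "k \<le> l" "0 \<le> c" for c k l
    using that X B by (intro divide_left_mono power_increasing) auto
  have prod: "norm (v i * v j - w i * w j) \<le> 2 * B / X ^ k" if "i < 6" "j < 6" "k \<le> wt i + wt j" for i j k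
  proof -
    have "norm (v i * v j - w i * w j) \<le> e / X ^ wt i * (d / X ^ wt j) + d / X ^ wt i * (e / X ^ wt j)"
      by (rule norm_prod_diff_le) (use v w e that in auto)
    also have "\<dots> = 2 * B / X ^ (wt i + wt j)" by (simp add: B_def power_add)
    also have "\<dots> \<le> 2 * B / X ^ k" using mono[OF that(3), of 2] by simp
    finally show ?thesis .
  qed
  have X0: "0 < X" using X by simp
  have small: "2 * d / X \<le> 1" using d X by (simp add: divide_le_eq)
  have b0: "norm (2 *\<^sub>R v 0) \<le> 2 * d / X" "norm (2 *\<^sub>R w 0) \<le> 2 * d / X" "norm (2 *\<^sub>R v 0 - 2 *\<^sub>R w 0) \<le> 2 * e / X"
    using v[rule_format, of 0] w[rule_format, of 0] e[rule_format, of 0]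
    by (auto simp: wt_def scaleR_diff_right[symmetric])
  have h: "norm ((exp (2 *\<^sub>R v 0) - 1 - 2 *\<^sub>R v 0) - (exp (2 *\<^sub>R w 0) - 1 - 2 *\<^sub>R w 0)) \<le> 12 * B / X ^ 2"
  proof -
    have "norm ((exp (2 *\<^sub>R v 0) - 1 - 2 *\<^sub>R v 0) - (exp (2 *\<^sub>R w 0) - 1 - 2 *\<^sub>R w 0))
        \<le> 3 * (2 * d / X) * norm (2 *\<^sub>R v 0 - 2 *\<^sub>R w 0)"
      by (rule norm_exp_remainder_diff[OF small b0(1,2)])
    also have "\<dots> \<le> 3 * (2 * d / X) * (2 * e / X)"
      using b0(3) d X0 by (intro mult_left_mono) auto
    also have "\<dots> = 12 * B / X ^ 2" by (simp add: B_def power2_eq_square)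
    finally show ?thesis .
  qed
  have ex: "norm (exp (2 *\<^sub>R v 0) - 1) \<le> 6 * d / X"
    using norm_exp_diff[of "2 *\<^sub>R v 0" 0] b0(1) small by simp
  have exd: "norm ((exp (2 *\<^sub>R v 0) - 1) - (exp (2 *\<^sub>R w 0) - 1)) \<le> 6 * e / X"
    using norm_exp_diff[of "2 *\<^sub>R v 0" "2 *\<^sub>R w 0"] b0 small by simp
  have p: "norm (v 1 * (exp (2 *\<^sub>R v 0) - 1) - w 1 * (exp (2 *\<^sub>R w 0) - 1)) \<le> 12 * B / X ^ 3"
  proof -
    have "norm (v 1 * (exp (2 *\<^sub>R v 0) - 1) - w 1 * (exp (2 *\<^sub>R w 0) - 1))
        \<le> e / X ^ 2 * (6 * d / X) + d / X ^ 2 * (6 * e / X)"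
      using w[rule_format, of 1] e[rule_format, of 1] ex exd by (intro norm_prod_diff_le) (auto simp: wt_def)
    also have "\<dots> = 12 * B / X ^ 3" using X0 by (simp add: B_def power2_eq_square power3_eq_cube)
    finally show ?thesis .
  qed
  have q1: "\<bar>- (1 - q\<^sup>2)\<bar> \<le> 1" using q zero_le_power2[of q] by auto
  have sq: "norm ((- (1 - q\<^sup>2)) *\<^sub>R x) \<le> c" if "norm x \<le> c" for x :: buc and c
    using mult_mono[OF q1 that] by simp
  have s2: "norm (2 *\<^sub>R x) \<le> 2 * c" if "norm x \<le> c" for x :: buc and c using that by simp
  have sc: "c * B / X ^ k \<le> 32 * B / X ^ k" if "c \<le> 32" for c k
    using that B X0 by (intro divide_right_mono mult_right_mono) auto
  have "\<forall>i<4. norm (nl v i - nl w i) \<le> 32 * B / X ^ gwt i"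
    unfolding All_less_4
  proof (intro conjI)
    have "nl v 0 - nl w 0 = 2 *\<^sub>R (v 1 * v 4 - w 1 * w 4)"
      by (simp add: nl_def scaleR_diff_right)
    then show "norm (nl v 0 - nl w 0) \<le> 32 * B / X ^ gwt 0"
      using s2[OF prod[of 1 4 3]] by (intro order_trans[OF _ sc[of 4]]) (simp_all add: wt_def gwt_def)
    have "nl v 1 - nl w 1 = 2 *\<^sub>R ((v 2 * v 4 - w 2 * w 4) + (v 1 * v 5 - w 1 * w 5))"
      by (simp add: nl_def scaleR_diff_right scaleR_add_right)
    then show "norm (nl v 1 - nl w 1) \<le> 32 * B / X ^ gwt 1"
      using s2[OF norm_triangle_le[OF add_mono[OF prod[of 2 4 3] prod[of 1 5 3]]]]
      by (intro order_trans[OF _ sc[of 8]]) (simp_all add: wt_def gwt_def)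
    have "nl v 2 - nl w 2 = (- (1 - q\<^sup>2)) *\<^sub>R ((exp (2 *\<^sub>R v 0) - 1 - 2 *\<^sub>R v 0) - (exp (2 *\<^sub>R w 0) - 1 - 2 *\<^sub>R w 0))
        + (v 1 * v 1 - w 1 * w 1) - (v 4 * v 4 - w 4 * w 4)"
      unfolding nl_def by (simp only: scaleR_diff_right) (simp add: algebra_simps)
    then show "norm (nl v 2 - nl w 2) \<le> 32 * B / X ^ gwt 2"
      using norm_triangle_le_diff[OF add_mono[OF norm_triangle_le[OF add_mono[OF sq[OF h] prod[of 1 1 2]]] prod[of 4 4 2]]]
      by (intro order_trans[OF _ sc[of 16]]) (simp_all add: wt_def gwt_def)
    have "nl v 3 - nl w 3 = (- (1 - q\<^sup>2)) *\<^sub>R (2 *\<^sub>R (v 1 * (exp (2 *\<^sub>R v 0) - 1) - w 1 * (exp (2 *\<^sub>R w 0) - 1)))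
        + 2 *\<^sub>R (v 1 * v 2 - w 1 * w 2) - 2 *\<^sub>R (v 4 * v 5 - w 4 * w 5)"
      unfolding nl_def by (simp only: scaleR_diff_right) (simp add: algebra_simps)
    then show "norm (nl v 3 - nl w 3) \<le> 32 * B / X ^ gwt 3"
      using norm_triangle_le_diff[OF add_mono[OF norm_triangle_le[OF add_mono[OF sq[OF s2[OF p]] s2[OF prod[of 1 2 3]]]] s2[OF prod[of 4 5 3]]]]
      by (simp add: wt_def gwt_def)
  qed
  then show ?thesis using i by (simp add: B_def mult.assoc)
qed

section \<open>The contraction argument\<close>

definition force :: "(nat \<Rightarrow> real \<Rightarrow> buc) \<Rightarrow> nat \<Rightarrow> real \<Rightarrow> buc" where
  "force u i t = nl (\<lambda>j. u j t) i"

definition state :: "real \<Rightarrow> (nat \<Rightarrow> real \<Rightarrow> buc) \<Rightarrow> bool" where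
  "state d u \<longleftrightarrow> (\<forall>i<6. continuous_on {0..} (u i)) \<and> (\<forall>t\<ge>0. jet (\<lambda>i. u i t)) \<and>
     (\<forall>i<6. \<forall>t\<ge>0. norm (u i t) \<le> d / sqrt (1 + t) ^ wt i)"

text \<open>A ball of the weighted metric, expressed by its radius, so that no Banach space of
  functions of time has to be constructed.\<close>

definition near :: "real \<Rightarrow> (nat \<Rightarrow> real \<Rightarrow> buc) \<Rightarrow> (nat \<Rightarrow> real \<Rightarrow> buc) \<Rightarrow> bool" where
  "near e u w \<longleftrightarrow> (\<forall>i<6. \<forall>t\<ge>0. norm (u i t - w i t) \<le> e / sqrt (1 + t) ^ wt i)"

lemma continuous_force:
  assumes "state d u" "0 \<le> d" "d \<le> 1 / 2"
  shows "\<forall>i<4. continuous_on {0..} (force u i)"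
proof -
  have c: "continuous_on {0..} (u 0)" "continuous_on {0..} (u 1)" "continuous_on {0..} (u 2)"
    "continuous_on {0..} (u 4)" "continuous_on {0..} (u 5)"
    using assms(1) unfolding state_def by auto
  have "norm (u 0 t) \<le> 1 / 2" if "0 \<le> t" for t
  proof -
    have "norm (u 0 t) \<le> d / sqrt (1 + t)" using assms(1) that unfolding state_def All_less_6 by (auto simp: wt_def)
    also have "\<dots> \<le> d / 1" using that assms by (intro divide_left_mono) auto
    finally show ?thesis using assms by simp
  qed
  then have "continuous_on {0..} (\<lambda>t. exp (2 *\<^sub>R u 0 t))"
    by (intro continuous_on_exp_buc continuous_on_scaleR continuous_on_const c) (simp add: mult.commute)
  then show ?thesis
    unfolding All_less_4 force_def nl_def by (simp, intro conjI continuous_on_add continuous_on_diff continuous_on_minus continuous_on_scaleR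
        continuous_on_mult continuous_on_const c c[unfolded One_nat_def])
qed

lemma forcing_diff:
  assumes u: "state d u" and w: "state d w" and uw: "near e u w" and d: "0 \<le> d" "d \<le> 1 / 2"
  shows "forcing (32 * d * e) (\<lambda>i t. force u i t - force w i t)"
  unfolding forcing_def
proof (intro conjI allI impI)
  show "continuous_on {0..} (\<lambda>t. force u i t - force w i t)" if "i < 4" for i
    using continuous_force[OF u d] continuous_force[OF w d] that by (intro continuous_on_diff) auto
  show "jet_forcing (\<lambda>i. force u i t - force w i t)" if "0 \<le> t" for t
    using jet_forcing_nl[of "\<lambda>j. u j t"] jet_forcing_nl[of "\<lambda>j. w j t"] u w that
    unfolding state_def jet_forcing_def force_def by (auto intro: bderiv_diff)
  show "norm (force u i t - force w i t) \<le> 32 * d * e / sqrt (1 + t) ^ gwt i" if "i < 4" "0 \<le> t" for i t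
    unfolding force_def using u w uw that unfolding state_def near_def
    by (intro norm_nl_diff[OF _ d]) auto
qed

lemma state_0: "0 \<le> d \<Longrightarrow> state d (\<lambda>i t. 0)"
  by (auto simp: state_def jet_def)

text \<open>The difference estimate against the zero state, for which the nonlinearity
  vanishes.\<close>

lemma forcing_force:
  assumes u: "state d u" and d: "0 \<le> d" "d \<le> 1 / 2"
  shows "forcing (32 * d * d) (force u)"
proof -
  have "forcing (32 * d * d) (\<lambda>i t. force u i t - force (\<lambda>i t. 0) i t)"
    by (rule forcing_diff[OF u state_0 _ d]) (use u d in \<open>auto simp: near_def state_def\<close>)
  then show ?thesis
    unfolding forcing_def jet_forcing_def force_def All_less_4 by (simp add: nl_0 nl_0[of "Suc 0"])
qed

definition step :: "(nat \<Rightarrow> buc) \<Rightarrow> (nat \<Rightarrow> real \<Rightarrow> buc) \<Rightarrow> nat \<Rightarrow> real \<Rightarrow> buc" where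
  "step v u i t = lin v i t + resp (force u) i t"

context
  fixes v :: "nat \<Rightarrow> buc" and \<epsilon> d :: real
  assumes v: "jet v" and v\<epsilon>: "\<forall>i<6. norm (v i) \<le> \<epsilon>" and d: "0 \<le> d" "d \<le> 1 / 2"
    and d_ge: "8 * M * \<epsilon> \<le> d" and d_small: "96 * M * 32 * d \<le> 1 / 2"
begin

text \<open>The Lipschitz constant is the product of 96 M for the response and 32 d for the
  nonlinearity, at most one half by the choice of d; the contribution of the initial data
  cancels.\<close>

lemma near_step:
  assumes "state d u" "state d w" "near e u w"
  shows "near (e / 2) (step v u) (step v w)"
  unfolding near_def
proof (intro allI impI)
  fix i :: nat and t :: real assume i: "i < 6" and t: "0 \<le> t"
  have "norm (u 3 0 - w 3 0) \<le> e" using assms(3)[unfolded near_def, rule_format, of 3 0] by (simp add: wt_def)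
  then have e: "0 \<le> e" by (rule order_trans[OF norm_ge_zero])
  have "step v u i t - step v w i t = resp (\<lambda>i t. force u i t - force w i t) i t"
    unfolding step_def using resp_diff[OF continuous_force[OF assms(1) d] continuous_force[OF assms(2) d] t i] by simp
  then have "norm (step v u i t - step v w i t) \<le> 96 * M * (32 * d * e) / sqrt (1 + t) ^ wt i"
    using norm_resp[OF forcing_diff[OF assms d] t i] by simp
  also have "\<dots> = (96 * M * 32 * d) * e / sqrt (1 + t) ^ wt i" by simp
  also have "\<dots> \<le> 1 / 2 * e / sqrt (1 + t) ^ wt i"
    using d_small e t by (intro divide_right_mono mult_right_mono) auto
  finally show "norm (step v u i t - step v w i t) \<le> e / 2 / sqrt (1 + t) ^ wt i" by simp
qed

text \<open>The initial data use up one half of the radius d, the quadratic forcing the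
  other.\<close>

lemma state_step:
  assumes u: "state d u"
  shows "state d (step v u)"
  unfolding state_def
proof (intro conjI allI impI)
  note g = forcing_force[OF u d]
  show "continuous_on {0..} (step v u i)" if "i < 6" for i
    unfolding step_def[abs_def]
    by (intro continuous_on_add continuous_lin continuous_resp that continuous_force[OF u d])
  show "jet (\<lambda>i. step v u i t)" if "0 \<le> t" for t
    using jet_lin[OF v that] jet_resp[OF g that] unfolding jet_def step_def by (auto intro: bderiv_add)
  show "norm (step v u i t) \<le> d / sqrt (1 + t) ^ wt i" if "i < 6" "0 \<le> t" for i t
  proof -
    have "norm (step v u i t) \<le> 4 * M * \<epsilon> / sqrt (1 + t) ^ wt i + 96 * M * (32 * d * d) / sqrt (1 + t) ^ wt i"
      unfolding step_def
      by (intro norm_triangle_le add_mono norm_lin[OF v v\<epsilon> that(2,1)] norm_resp[OF g that(2,1)])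
    also have "\<dots> = (4 * M * \<epsilon> + (96 * M * 32 * d) * d) / sqrt (1 + t) ^ wt i" by (simp add: add_divide_distrib)
    also have "\<dots> \<le> d / sqrt (1 + t) ^ wt i"
    proof (rule divide_right_mono)
      have "(96 * M * 32 * d) * d \<le> 1 / 2 * d" using d_small d by (intro mult_right_mono)
      then show "4 * M * \<epsilon> + (96 * M * 32 * d) * d \<le> d" using d_ge by linarith
    qed (use that in simp)
    finally show ?thesis .
  qed
qed

definition iter :: "nat \<Rightarrow> nat \<Rightarrow> real \<Rightarrow> buc" where
  "iter k = (step v ^^ k) (\<lambda>i t. 0)"

lemma state_iter: "state d (iter k)"
  unfolding iter_def by (induction k) (auto intro: state_step state_0 d)

lemma near_iter_Suc: "near (d / 2 ^ k) (iter (Suc k)) (iter k)"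
proof (induction k)
  case 0
  show ?case using state_iter[of 1] by (simp add: near_def state_def iter_def)
next
  case (Suc k)
  have "iter (Suc j) = step v (iter j)" for j by (simp add: iter_def)
  then show ?case using near_step[OF state_iter state_iter Suc.IH] by (simp add: mult.commute)
qed

lemma near_iter: "near (2 * d / 2 ^ k) (iter (k + n)) (iter k)"
proof -
  \<comment> \<open>The exact partial geometric sum makes the induction work; the bound 2 alone
    would not be preserved.\<close>
  have "near ((2 - 2 / 2 ^ n) * (d / 2 ^ k)) (iter (k + n)) (iter k)"
  proof (induction n)
    case 0
    then show ?case by (simp add: near_def)
  next
    case (Suc n)
    show ?case
      unfolding near_def
    proof (intro allI impI)
      fix i :: nat and t :: real assume it: "i < 6" "0 \<le> t"
      let ?X = "sqrt (1 + t) ^ wt i"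
      have "norm (iter (k + Suc n) i t - iter k i t)
          \<le> norm (iter (Suc (k + n)) i t - iter (k + n) i t) + norm (iter (k + n) i t - iter k i t)"
        by (rule order_trans[OF _ norm_triangle_ineq]) simp
      also have "\<dots> \<le> d / 2 ^ (k + n) / ?X + (2 - 2 / 2 ^ n) * (d / 2 ^ k) / ?X"
        using near_iter_Suc[of "k + n"] Suc it unfolding near_def by (intro add_mono) auto
      also have "\<dots> = (2 - 2 / 2 ^ Suc n) * (d / 2 ^ k) / ?X"
      proof -
        have "d / 2 ^ (k + n) + (2 - 2 / 2 ^ n) * (d / 2 ^ k) = (2 - 2 / 2 ^ Suc n) * (d / 2 ^ k)"
          by (simp add: power_add field_simps)
        then show ?thesis by (simp only: add_divide_distrib[symmetric])
      qed
      finally show "norm (iter (k + Suc n) i t - iter k i t) \<le> (2 - 2 / 2 ^ Suc n) * (d / 2 ^ k) / ?X" .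
    qed
  qed
  moreover have "(2 - 2 / 2 ^ n) * (d / 2 ^ k) \<le> 2 * d / 2 ^ k"
    using d by (simp add: field_simps)
  ultimately show ?thesis
    unfolding near_def by (meson divide_right_mono order_trans real_sqrt_ge_zero zero_le_power add_nonneg_nonneg zero_le_one)
qed

text \<open>The contraction principle carried out by hand: limits are taken at each time, the
  weights are at least 1 so that convergence is uniform in time, and the derivative relations pass
  to the limit. \<open>near_step\<close> between an iterate and the limit identifies the limit as a
  fixed point.\<close>

lemma fixed_point_exists:
  "\<exists>u. state d u \<and> (\<forall>i<6. \<forall>t\<ge>0. u i t = step v u i t)"
proof -
  have lim0: "(\<lambda>k. c / 2 ^ k) \<longlonglongrightarrow> 0" for c :: real
    using tendsto_mult[OF tendsto_const[of c] LIMSEQ_inverse_realpow_zero[of 2]] by (simp add: divide_inverse)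
  have X1: "x / sqrt (1 + t) ^ n \<le> x" if "0 \<le> x" "0 \<le> t" for x t n
    using divide_left_mono[of 1 "sqrt (1 + t) ^ n" x] that by simp
  have dist: "norm (iter (k + n) i t - iter k i t) \<le> 2 * d / 2 ^ k / sqrt (1 + t) ^ wt i" if "i < 6" "0 \<le> t" for i t k n
    using near_iter[of k n] that by (simp add: near_def)
  have conv: "convergent (\<lambda>k. iter k i t)" if it: "i < 6" "0 \<le> t" for i t
  proof (rule Cauchy_convergent, rule CauchyI')
    fix e :: real assume "e > 0"
    then obtain N where N: "\<And>k. k \<ge> N \<Longrightarrow> norm (2 * d / 2 ^ k - 0) < e"
      using lim0[of "2 * d"] LIMSEQ_D by blast
    have "norm (iter m i t - iter n i t) < e" if "N \<le> m" "m < n" for m n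
    proof -
      have "norm (iter (m + (n - m)) i t - iter m i t) \<le> 2 * d / 2 ^ m"
        using order_trans[OF dist[OF it, of m "n - m"] X1[OF _ it(2)]] d by simp
      also have "\<dots> < e" using N[OF that(1)] d by simp
      finally show ?thesis using that by (simp add: norm_minus_commute)
    qed
    then show "\<exists>M. \<forall>m\<ge>M. \<forall>n>m. dist (iter m i t) (iter n i t) < e" unfolding dist_norm by blast
  qed
  define u where "u i t = lim (\<lambda>k. iter k i t)" for i t
  have tends: "(\<lambda>k. iter k i t) \<longlonglongrightarrow> u i t" if "i < 6" "0 \<le> t" for i t
    using conv[OF that] by (simp add: u_def convergent_LIMSEQ_iff)
  have nu: "near (2 * d / 2 ^ k) (iter k) u" for k
    unfolding near_def
  proof (intro allI impI)
    fix i :: nat and t :: real assume it: "i < 6" "0 \<le> t"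
    have "(\<lambda>n. norm (iter (n + k) i t - iter k i t)) \<longlonglongrightarrow> norm (u i t - iter k i t)"
      by (intro tendsto_intros LIMSEQ_ignore_initial_segment tends it)
    then have "norm (u i t - iter k i t) \<le> 2 * d / 2 ^ k / sqrt (1 + t) ^ wt i"
      by (rule LIMSEQ_le_const2) (use dist[OF it, of k] in \<open>auto simp: add.commute\<close>)
    then show "norm (iter k i t - u i t) \<le> 2 * d / 2 ^ k / sqrt (1 + t) ^ wt i" by (simp add: norm_minus_commute)
  qed
  have su: "state d u"
    unfolding state_def
  proof (intro conjI allI impI)
    show "norm (u i t) \<le> d / sqrt (1 + t) ^ wt i" if "i < 6" "0 \<le> t" for i t
      by (rule LIMSEQ_le_const2[OF tendsto_norm[OF tends[OF that]]]) (use state_iter that in \<open>auto simp: state_def\<close>)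
    show "jet (\<lambda>i. u i t)" if "0 \<le> t" for t
      unfolding jet_def
      by (intro conjI; rule bderiv_lim[OF _ tends tends]) (use state_iter that in \<open>auto simp: state_def jet_def\<close>)
    show "continuous_on {0..} (u i)" if i: "i < 6" for i
    proof (rule uniform_limit_theorem)
      show "uniform_limit {0..} (\<lambda>k. iter k i) (u i) sequentially"
      proof (rule uniform_limitI)
        fix e :: real assume "e > 0"
        then have "eventually (\<lambda>k. 2 * d / 2 ^ k < e) sequentially" by (rule order_tendstoD[OF lim0])
        then show "\<forall>\<^sub>F k in sequentially. \<forall>t\<in>{0..}. dist (iter k i t) (u i t) < e"
        proof eventually_elim
          case (elim k)
          have "dist (iter k i t) (u i t) \<le> 2 * d / 2 ^ k" if "0 \<le> t" for t
            using nu[of k] X1[OF _ that, of "2 * d / 2 ^ k" "wt i"] i that d unfolding near_def dist_norm by (meson order_trans divide_nonneg_nonneg mult_nonneg_nonneg zero_le_numeral zero_le_power)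
          then show ?case using elim by fastforce
        qed
      qed
      show "\<forall>\<^sub>F k in sequentially. continuous_on {0..} (iter k i)"
        using state_iter i by (auto simp: state_def)
    qed simp
  qed
  have "u i t = step v u i t" if it: "i < 6" "0 \<le> t" for i t
  proof -
    have "(\<lambda>k. iter (Suc k) i t) \<longlonglongrightarrow> step v u i t"
    proof (rule LIM_zero_cancel, rule Lim_null_comparison[OF _ lim0[of d]])
      show "\<forall>\<^sub>F k in sequentially. norm (iter (Suc k) i t - step v u i t) \<le> d / 2 ^ k"
      proof (rule always_eventually, rule allI)
        fix k
        have "norm (step v (iter k) i t - step v u i t) \<le> 2 * d / 2 ^ k / 2 / sqrt (1 + t) ^ wt i"
          using near_step[OF state_iter su nu] it by (simp add: near_def)
        also have "\<dots> \<le> 2 * d / 2 ^ k / 2" by (rule X1[OF _ it(2)]) (use d in simp)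
        finally show "norm (iter (Suc k) i t - step v u i t) \<le> d / 2 ^ k" by (simp add: iter_def)
      qed
    qed
    then show ?thesis using LIMSEQ_Suc[OF tends[OF it]] LIMSEQ_unique by blast
  qed
  then show ?thesis using su by blast
qed

end

end

section \<open>The fixed point is a mild solution\<close>

lemma strong_cont_heat: "strong_cont (dheat 0)"
  unfolding strong_cont_def
proof (intro conjI allI)
  show "continuous_on {0..} (\<lambda>t. dheat 0 t f)" for f
    using continuous_hconv[of 0 f] by (simp add: dheat_0)
  show "\<exists>B. \<forall>t\<in>{0..T}. norm (dheat 0 t) \<le> B" for T
    using norm_dheat[of 0] by (intro exI[of _ 1]) simp
qed

lemma strong_cont_scaleR: "strong_cont P \<Longrightarrow> strong_cont (\<lambda>t. c *\<^sub>R P t)"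
  unfolding strong_cont_def
proof (intro conjI allI)
  assume P: "(\<forall>f. continuous_on {0..} (\<lambda>t. P t f)) \<and> (\<forall>T. \<exists>B. \<forall>t\<in>{0..T}. norm (P t) \<le> B)"
  show "continuous_on {0..} (\<lambda>t. (c *\<^sub>R P t) f)" for f
    unfolding scaleR_blinfun.rep_eq using P by (intro continuous_on_scaleR continuous_on_const) blast
  show "\<exists>B. \<forall>t\<in>{0..T}. norm (c *\<^sub>R P t) \<le> B" for T
  proof -
    obtain B where "\<forall>t\<in>{0..T}. norm (P t) \<le> B" using P by blast
    then have "\<forall>t\<in>{0..T}. norm (c *\<^sub>R P t) \<le> \<bar>c\<bar> * B" by (auto intro: mult_left_mono)
    then show ?thesis by blast
  qed
qed

lemma strong_cont_diff: "strong_cont P \<Longrightarrow> strong_cont Q \<Longrightarrow> strong_cont (\<lambda>t. P t - Q t)"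
  unfolding strong_cont_def
proof (intro conjI allI)
  assume P: "(\<forall>f. continuous_on {0..} (\<lambda>t. P t f)) \<and> (\<forall>T. \<exists>B. \<forall>t\<in>{0..T}. norm (P t) \<le> B)"
    and Q: "(\<forall>f. continuous_on {0..} (\<lambda>t. Q t f)) \<and> (\<forall>T. \<exists>B. \<forall>t\<in>{0..T}. norm (Q t) \<le> B)"
  show "continuous_on {0..} (\<lambda>t. (P t - Q t) f)" for f
    unfolding minus_blinfun.rep_eq using P Q by (intro continuous_on_diff) blast+
  show "\<exists>B. \<forall>t\<in>{0..T}. norm (P t - Q t) \<le> B" for T
  proof -
    obtain B C where "\<forall>t\<in>{0..T}. norm (P t) \<le> B" "\<forall>t\<in>{0..T}. norm (Q t) \<le> C" using P Q by meson
    then have "\<forall>t\<in>{0..T}. norm (P t - Q t) \<le> B + C" by (auto intro!: norm_triangle_le_diff add_mono)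
    then show ?thesis by blast
  qed
qed

lemma tconv_scaleR_kernel:
  assumes "strong_cont P" "continuous_on {0..} n" "0 \<le> t"
  shows "tconv (\<lambda>s. c *\<^sub>R P s) n t = c *\<^sub>R tconv P n t"
  using has_integral_unique[OF tconv_has_integral[OF strong_cont_scaleR[OF assms(1), of c] assms(2,3)]]
    has_integral_cmul[OF tconv_has_integral[OF assms], of c]
  by (simp add: scaleR_blinfun.rep_eq)

lemma tconv_diff_kernel:
  assumes "strong_cont P" "strong_cont Q" "continuous_on {0..} n" "0 \<le> t"
  shows "tconv (\<lambda>s. P s - Q s) n t = tconv P n t - tconv Q n t"
  using has_integral_unique[OF tconv_has_integral[OF strong_cont_diff[OF assms(1,2)] assms(3,4)]]
    has_integral_diff[OF tconv_has_integral[OF assms(1,3,4)] tconv_has_integral[OF assms(2,3,4)]]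
  by (simp add: minus_blinfun.rep_eq)

context amplitude_phase
begin

text \<open>The forced form of \<open>heat_convolution_fco\<close>, obtained from
  associativity.\<close>

lemma heat_tconv_R:
  assumes n: "continuous_on {0..} n" and t: "0 \<le> t"
  shows "((\<lambda>s. dheat 0 (t - s) (tconv (R 0) n s)) has_integral tconv (E 0) n t) {0..t}"
  using tconv_has_integral[OF strong_cont_heat continuous_tconv[OF kernels(2) n] t]
    tconv_assoc[OF strong_cont_heat strong_cont_R strong_cont_E n t heat_convolution_fco]
  by simp

text \<open>The forced form of \<open>heat_convolution_eco\<close>: the heat kernel convolved with
  \<open>bt E 2\<close> is the heat kernel minus \<open>D 0\<close>.\<close>

lemma heat_tconv_E2:
  assumes n: "continuous_on {0..} n" and t: "0 \<le> t"
  shows "((\<lambda>s. bt *\<^sub>R dheat 0 (t - s) (tconv (E 2) n s)) has_integral (tconv (dheat 0) n t - tconv (D 0) n t)) {0..t}"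
proof -
  have E2: "strong_cont (E 2)" by (rule strong_cont_E) simp
  note P = strong_cont_scaleR[OF E2, of bt]
  note L = strong_cont_diff[OF strong_cont_heat strong_cont_D]
  have conv: "((\<lambda>s. dheat 0 (t - s) ((bt *\<^sub>R E 2 s) f)) has_integral (dheat 0 t - D 0 t) f) {0..t}" if "0 \<le> t" for t f
    using heat_convolution_eco[OF that, of f]
    by (simp add: scaleR_blinfun.rep_eq minus_blinfun.rep_eq blinfun.scaleR_right)
  have "((\<lambda>s. dheat 0 (t - s) (tconv (\<lambda>s. bt *\<^sub>R E 2 s) n s)) has_integral tconv (\<lambda>t. dheat 0 t - D 0 t) n t) {0..t}"
    using tconv_has_integral[OF strong_cont_heat continuous_tconv[OF weak_singular_of_strong[OF P] n] t]
      tconv_assoc[OF strong_cont_heat P L n t conv] by simp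
  then have "((\<lambda>s. dheat 0 (t - s) (tconv (\<lambda>s. bt *\<^sub>R E 2 s) n s)) has_integral (tconv (dheat 0) n t - tconv (D 0) n t)) {0..t}"
    by (simp only: tconv_diff_kernel[OF strong_cont_heat strong_cont_D n t])
  then show ?thesis
    by (rule has_integral_eq[rotated]) (simp add: tconv_scaleR_kernel[OF E2 n] blinfun.scaleR_right)
qed

lemma tconv_R:
  assumes n: "continuous_on {0..} n" and t: "0 \<le> t"
  shows "tconv (R 0) n t = tconv (D 0) n t - a *\<^sub>R tconv (E 0) n t"
proof -
  have E0: "strong_cont (E 0)" by (rule strong_cont_E) simp
  have "tconv (R 0) n t = tconv (\<lambda>s. D 0 s - a *\<^sub>R E 0 s) n t"
  proof (rule tconv_cong[OF t])
    show "R 0 \<tau> (n s) = (D 0 \<tau> - a *\<^sub>R E 0 \<tau>) (n s)" if "0 < \<tau>" for s \<tau>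
      using GS_fco[of 0 \<tau> "n s"] that by (simp add: minus_blinfun.rep_eq scaleR_blinfun.rep_eq)
  qed
  then show ?thesis
    by (simp add: tconv_diff_kernel[OF strong_cont_D strong_cont_scaleR[OF E0] n t] tconv_scaleR_kernel[OF E0 n t])
qed

context
  fixes v :: "nat \<Rightarrow> buc" and g u :: "nat \<Rightarrow> real \<Rightarrow> buc" and N t :: real
  assumes v: "jet v" and g: "forcing N g" and t: "0 \<le> t"
    and u: "\<And>i s. i < 6 \<Longrightarrow> 0 \<le> s \<Longrightarrow> u i s = lin v i s + resp g i s"
begin

private lemma gc: "continuous_on {0..} (g 0)" "continuous_on {0..} (g 1)" "continuous_on {0..} (g 2)" "continuous_on {0..} (g 3)"
  using g unfolding forcing_def All_less_4 by auto

private lemma E_shift: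
  assumes s: "0 \<le> s"
  shows "E 0 s (v 5) = E 2 s (v 3)" "E 1 s (v 1) = E 2 s (v 0)"
    "tconv (E 1) (g 1) s = tconv (E 2) (g 0) s" "tconv (E 1) (g 3) s = tconv (E 2) (g 2) s"
proof -
  have d: "bderiv (v 0) (v 1)" "bderiv (v 3) (v 4)" "bderiv (v 4) (v 5)" using v unfolding jet_def by auto
  have dg: "bderiv (g 0 s) (g 1 s)" "bderiv (g 2 s) (g 3 s)" if "0 \<le> s" for s
    using g that unfolding forcing_def jet_forcing_def by auto
  show "E 0 s (v 5) = E 2 s (v 3)"
    using E_deriv[OF s _ d(3), of 0] E_deriv[OF s _ d(2), of 1] by (simp add: numeral_2_eq_2)
  show "E 1 s (v 1) = E 2 s (v 0)" using E_deriv[OF s _ d(1), of 1] by (simp add: numeral_2_eq_2)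
  show "tconv (E 1) (g 1) s = tconv (E 2) (g 0) s" "tconv (E 1) (g 3) s = tconv (E 2) (g 2) s"
    using E_deriv[OF _ _ dg(1), of _ 1] E_deriv[OF _ _ dg(2), of _ 1]
    by (auto intro!: tconv_cong s simp: numeral_2_eq_2)
qed

text \<open>No differentiation in time is needed. The coupling term is expanded into pieces with
  kernels \<open>R 0\<close> and \<open>E 2\<close>, whose convolutions with the heat semigroup are
  known; their sum telescopes to the solution.\<close>

lemma mild_phi:
  "((\<lambda>s. dheat 0 (t - s) ((2 * q) *\<^sub>R u 1 s + g 0 s)) has_integral (u 3 t - dheat 0 t (v 3))) {0..t}"
proof -
  let ?H = "\<lambda>s. dheat 0 (t - s)"
  have I: "((\<lambda>s. (2 * q) *\<^sub>R ?H s (R 0 s (v 1)) - bt *\<^sub>R ?H s (E 2 s (v 3)) + (2 * q) *\<^sub>R ?H s (tconv (R 0) (g 3) s)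
        - bt *\<^sub>R ?H s (tconv (E 2) (g 0) s) + ?H s (g 0 s)) has_integral
      ((2 * q) *\<^sub>R E 0 t (v 1) - (dheat 0 t (v 3) - D 0 t (v 3)) + (2 * q) *\<^sub>R tconv (E 0) (g 3) t
        - (tconv (dheat 0) (g 0) t - tconv (D 0) (g 0) t) + tconv (dheat 0) (g 0) t)) {0..t}"
    by (intro has_integral_add has_integral_diff has_integral_cmul heat_convolution_fco heat_convolution_eco
        heat_tconv_R heat_tconv_E2 tconv_has_integral strong_cont_heat gc t)
  have J: "(2 * q) *\<^sub>R E 0 t (v 1) - (dheat 0 t (v 3) - D 0 t (v 3)) + (2 * q) *\<^sub>R tconv (E 0) (g 3) t
        - (tconv (dheat 0) (g 0) t - tconv (D 0) (g 0) t) + tconv (dheat 0) (g 0) t = u 3 t - dheat 0 t (v 3)"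
    using u[of 3 t] t by (simp add: lin_def resp_def algebra_simps)
  show ?thesis
    unfolding J[symmetric]
  proof (rule has_integral_eq[OF _ I])
    fix s assume s: "s \<in> {0..t}"
    have u1: "u 1 s = R 0 s (v 1) - (2 * q) *\<^sub>R E 2 s (v 3) + (tconv (R 0) (g 3) s - (2 * q) *\<^sub>R tconv (E 2) (g 0) s)"
      using u[of 1 s] E_shift[of s] s by (simp add: lin_def resp_def)
    \<comment> \<open>One factor 2 q comes from the coupling in the equation, the other from the
      mixed entry of the Green matrix.\<close>
    have b: "(2 * q) *\<^sub>R (2 * q) *\<^sub>R x = bt *\<^sub>R x" for x :: buc
      by (simp add: bt_eq power2_eq_square)
    show "(2 * q) *\<^sub>R ?H s (R 0 s (v 1)) - bt *\<^sub>R ?H s (E 2 s (v 3)) + (2 * q) *\<^sub>R ?H s (tconv (R 0) (g 3) s)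
        - bt *\<^sub>R ?H s (tconv (E 2) (g 0) s) + ?H s (g 0 s) = ?H s ((2 * q) *\<^sub>R u 1 s + g 0 s)"
      unfolding u1 scaleR_add_right scaleR_diff_right b
      by (simp add: blinfun.add_right blinfun.diff_right blinfun.scaleR_right)
  qed
qed

text \<open>As for the phase, but the damping term also has to be expanded; here the relation R = D
  - a E is used, once in the integrand and once in the value of the integral.\<close>

lemma mild_r:
  "((\<lambda>s. dheat 0 (t - s) (- ((2 * q) *\<^sub>R u 4 s) - a *\<^sub>R u 0 s + g 2 s)) has_integral (u 0 t - dheat 0 t (v 0))) {0..t}"
proof -
  let ?H = "\<lambda>s. dheat 0 (t - s)"
  have I: "((\<lambda>s. - ((2 * q) *\<^sub>R ?H s (R 0 s (v 4))) - bt *\<^sub>R ?H s (E 2 s (v 0)) - a *\<^sub>R ?H s (R 0 s (v 0))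
        - (2 * q) *\<^sub>R ?H s (tconv (R 0) (g 1) s) - bt *\<^sub>R ?H s (tconv (E 2) (g 2) s)
        - a *\<^sub>R ?H s (tconv (R 0) (g 2) s) + ?H s (g 2 s)) has_integral
      (- ((2 * q) *\<^sub>R E 0 t (v 4)) - (dheat 0 t (v 0) - D 0 t (v 0)) - a *\<^sub>R E 0 t (v 0)
        - (2 * q) *\<^sub>R tconv (E 0) (g 1) t - (tconv (dheat 0) (g 2) t - tconv (D 0) (g 2) t)
        - a *\<^sub>R tconv (E 0) (g 2) t + tconv (dheat 0) (g 2) t)) {0..t}"
    by (intro has_integral_add has_integral_diff has_integral_neg has_integral_cmul heat_convolution_fco heat_convolution_eco
        heat_tconv_R heat_tconv_E2 tconv_has_integral strong_cont_heat gc t)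
  have J: "- ((2 * q) *\<^sub>R E 0 t (v 4)) - (dheat 0 t (v 0) - D 0 t (v 0)) - a *\<^sub>R E 0 t (v 0)
        - (2 * q) *\<^sub>R tconv (E 0) (g 1) t - (tconv (dheat 0) (g 2) t - tconv (D 0) (g 2) t)
        - a *\<^sub>R tconv (E 0) (g 2) t + tconv (dheat 0) (g 2) t = u 0 t - dheat 0 t (v 0)"
    using u[of 0 t] t by (simp add: lin_def resp_def tconv_R[OF gc(3) t] GS_fco algebra_simps)
  show ?thesis
    unfolding J[symmetric]
  proof (rule has_integral_eq[OF _ I])
    fix s assume "s \<in> {0..t}"
    then have s: "0 \<le> s" by simp
    have u4: "u 4 s = D 0 s (v 4) + (2 * q) *\<^sub>R E 2 s (v 0) + (tconv (D 0) (g 1) s + (2 * q) *\<^sub>R tconv (E 2) (g 2) s)"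
      using u[of 4 s] E_shift[OF s] s by (simp add: lin_def resp_def)
    have u0: "u 0 s = R 0 s (v 0) - (2 * q) *\<^sub>R E 0 s (v 4) + (tconv (R 0) (g 2) s - (2 * q) *\<^sub>R tconv (E 0) (g 1) s)"
      using u[of 0 s] s by (simp add: lin_def resp_def)
    have b: "(2 * q) *\<^sub>R (2 * q) *\<^sub>R x = bt *\<^sub>R x" for x :: buc
      by (simp add: bt_eq power2_eq_square)
    \<comment> \<open>Writing D as R + a E produces terms with \<open>E 0\<close> that cancel
      against those in \<open>- a *\<^sub>R u 0 s\<close>, leaving only \<open>R 0\<close>,
      \<open>E 2\<close> and the forcing itself.\<close>
    have D0: "D 0 s (v 4) = R 0 s (v 4) + a *\<^sub>R E 0 s (v 4)"
      "tconv (D 0) (g 1) s = tconv (R 0) (g 1) s + a *\<^sub>R tconv (E 0) (g 1) s"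
      using GS_fco[of 0 s "v 4"] tconv_R[OF gc(2) s] s by simp_all
    have c: "a *\<^sub>R (2 * q) *\<^sub>R x = (2 * q) *\<^sub>R a *\<^sub>R x" for x :: buc by simp
    have "- ((2 * q) *\<^sub>R u 4 s) - a *\<^sub>R u 0 s + g 2 s
      = - ((2 * q) *\<^sub>R R 0 s (v 4)) - bt *\<^sub>R E 2 s (v 0) - a *\<^sub>R R 0 s (v 0)
        - (2 * q) *\<^sub>R tconv (R 0) (g 1) s - bt *\<^sub>R tconv (E 2) (g 2) s
        - a *\<^sub>R tconv (R 0) (g 2) s + g 2 s"
      unfolding u4 u0 D0 scaleR_add_right scaleR_diff_right b c by simp
    then show "- ((2 * q) *\<^sub>R ?H s (R 0 s (v 4))) - bt *\<^sub>R ?H s (E 2 s (v 0)) - a *\<^sub>R ?H s (R 0 s (v 0))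
        - (2 * q) *\<^sub>R ?H s (tconv (R 0) (g 1) s) - bt *\<^sub>R ?H s (tconv (E 2) (g 2) s)
        - a *\<^sub>R ?H s (tconv (R 0) (g 2) s) + ?H s (g 2 s) = ?H s (- ((2 * q) *\<^sub>R u 4 s) - a *\<^sub>R u 0 s + g 2 s)"
      by (simp add: blinfun.add_right blinfun.diff_right blinfun.minus_right blinfun.scaleR_right)
  qed
qed

end

end

section \<open>Back to functions\<close>

lemma Dx_app:
  assumes "bderiv f g"
  shows "Dx (app f) = app g" "app f differentiable (at x)"
proof -
  have d: "(app f has_vector_derivative app g x) (at x)" for x
    using assms by (simp add: bderiv_def has_real_derivative_iff_has_vector_derivative)
  show "Dx (app f) = app g" unfolding Dx_def using d vector_derivative_at by blast
  show "app f differentiable (at x)" using d differentiableI_vector by blast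
qed

lemma Cub_2_iff:
  "f \<in> Cub 2 \<longleftrightarrow> (\<forall>x. f differentiable (at x)) \<and> (\<forall>x. Dx f differentiable (at x)) \<and>
    (\<forall>h\<in>{f, Dx f, Dx (Dx f)}. bounded (range h) \<and> uniformly_continuous_on UNIV h)"
proof -
  have "{..<2::nat} = {0, 1}" "{..2::nat} = {0, 1, 2}" by auto
  then have "(\<forall>k<2. P k) \<longleftrightarrow> P 0 \<and> P (1::nat)" "(\<forall>k\<le>2. P k) \<longleftrightarrow> P 0 \<and> P 1 \<and> P (2::nat)" for P
    by (metis (no_types, lifting) insert_iff lessThan_iff empty_iff, metis (no_types, lifting) insert_iff atMost_iff empty_iff)
  then show ?thesis unfolding Cub_def by (simp add: numeral_2_eq_2 conj_assoc)
qed

lemma Cub_2_obtain_buc: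
  fixes f :: "real \<Rightarrow> real"
  assumes "f \<in> Cub 2"
  obtains F G H where "app F = f" "app G = Dx f" "app H = Dx (Dx f)" "bderiv F G" "bderiv G H"
proof -
  have b: "app (Buc h) = h" if "h \<in> {f, Dx f, Dx (Dx f)}" for h
    using assms that unfolding Cub_2_iff by (intro Buc_inverse) auto
  have d: "(h has_real_derivative Dx h x) (at x)" if "h differentiable (at x)" for h :: "real \<Rightarrow> real" and x
    using that unfolding Dx_def vector_derivative_works has_real_derivative_iff_has_vector_derivative .
  show thesis
    by (rule that[of "Buc f" "Buc (Dx f)" "Buc (Dx (Dx f))"])
      (use b d assms in \<open>auto simp: bderiv_def Cub_2_iff\<close>)
qed

lemma Cub_2_app:
  assumes "bderiv f g" "bderiv g h"
  shows "app f \<in> Cub 2"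
  unfolding Cub_2_iff using assms by (simp add: Dx_app bounded_app uc_app)

lemma Dx_pair:
  assumes "\<And>x. f differentiable (at x)" "\<And>x. g differentiable (at x)"
  shows "Dx (\<lambda>x. (f x, g x)) = (\<lambda>x. (Dx f x, Dx g x))"
    "(\<lambda>x. (f x, g x)) differentiable (at x)"
proof -
  have d: "((\<lambda>x. (f x, g x)) has_vector_derivative (Dx f x, Dx g x)) (at x)" for x
    using assms unfolding Dx_def vector_derivative_works by (intro has_vector_derivative_Pair)
  show "Dx (\<lambda>x. (f x, g x)) = (\<lambda>x. (Dx f x, Dx g x))"
    unfolding Dx_def[of "\<lambda>x. (f x, g x)"] using vector_derivative_at[OF d] by blast
  show "(\<lambda>x. (f x, g x)) differentiable (at x)" using d differentiableI_vector by blast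
qed

lemma differentiable_pairD:
  fixes f g :: "real \<Rightarrow> real"
  assumes "(\<lambda>x. (f x, g x)) differentiable (at x)"
  shows "f differentiable (at x)" "g differentiable (at x)"
proof -
  obtain D where D: "((\<lambda>x. (f x, g x)) has_vector_derivative D) (at x)"
    using assms vector_derivative_works by blast
  show "f differentiable (at x)"
    using bounded_linear.has_vector_derivative[OF bounded_linear_fst D] by (auto intro: differentiableI_vector)
  show "g differentiable (at x)"
    using bounded_linear.has_vector_derivative[OF bounded_linear_snd D] by (auto intro: differentiableI_vector)
qed

lemma bounded_uniformly_continuous_pair_iff:
  fixes f g :: "real \<Rightarrow> real"
  shows "bounded (range (\<lambda>x. (f x, g x))) \<and> uniformly_continuous_on UNIV (\<lambda>x. (f x, g x)) \<longleftrightarrow>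
    (bounded (range f) \<and> uniformly_continuous_on UNIV f) \<and> (bounded (range g) \<and> uniformly_continuous_on UNIV g)"
    (is "?P \<longleftrightarrow> ?Q")
proof
  assume P: ?P
  have "range f = fst ` range (\<lambda>x. (f x, g x))" "range g = snd ` range (\<lambda>x. (f x, g x))"
    by (auto simp: image_image)
  then show ?Q
    using P bounded_linear.uniformly_continuous_on[OF bounded_linear_fst, of UNIV "\<lambda>x. (f x, g x)"]
      bounded_linear.uniformly_continuous_on[OF bounded_linear_snd, of UNIV "\<lambda>x. (f x, g x)"]
    by (simp add: bounded_fst bounded_snd)
next
  assume Q: ?Q
  have "range (\<lambda>x. (f x, g x)) \<subseteq> range f \<times> range g" by auto
  then have "bounded (range (\<lambda>x. (f x, g x)))" using Q bounded_Times bounded_subset by blast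
  moreover have "uniformly_continuous_on UNIV (\<lambda>x. (f x, g x))"
    unfolding uniformly_continuous_on_def
  proof (intro allI impI)
    fix e :: real assume e: "e > 0"
    obtain d1 where d1: "d1 > 0" "\<And>x y. dist y x < d1 \<Longrightarrow> dist (f y) (f x) < e / 2"
      using Q e unfolding uniformly_continuous_on_def by (metis UNIV_I half_gt_zero)
    obtain d2 where d2: "d2 > 0" "\<And>x y. dist y x < d2 \<Longrightarrow> dist (g y) (g x) < e / 2"
      using Q e unfolding uniformly_continuous_on_def by (metis UNIV_I half_gt_zero)
    have "dist (f y, g y) (f x, g x) < e" if "dist y x < min d1 d2" for x y
    proof -
      have "dist (f y, g y) (f x, g x) \<le> dist (f y) (f x) + dist (g y) (g x)"
        unfolding dist_Pair_Pair by (rule sqrt_sum_squares_le_sum) auto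
      then show ?thesis using d1(2)[of y x] d2(2)[of y x] that by auto
    qed
    then show "\<exists>d>0. \<forall>x\<in>UNIV. \<forall>x'\<in>UNIV. dist x' x < d \<longrightarrow> dist (f x', g x') (f x, g x) < e"
      using d1(1) d2(1) by (intro exI[of _ "min d1 d2"]) auto
  qed
  ultimately show ?P by blast
qed

text \<open>\<open>Dx\<close> has an unspecified value where a function is not differentiable, so it
  can be taken componentwise only once both components are known to be differentiable; hence the
  case distinction.\<close>

lemma Cub_2_pair_iff:
  fixes f g :: "real \<Rightarrow> real"
  shows "(\<lambda>x. (f x, g x)) \<in> Cub 2 \<longleftrightarrow> f \<in> Cub 2 \<and> g \<in> Cub 2"
proof (cases "(\<forall>x. f differentiable (at x) \<and> g differentiable (at x)) \<and> (\<forall>x. Dx f differentiable (at x) \<and> Dx g differentiable (at x))")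
  case True
  then show ?thesis
    unfolding Cub_2_iff by (simp add: Dx_pair bounded_uniformly_continuous_pair_iff) blast
next
  case False
  have "f differentiable (at x)" "g differentiable (at x)" if "(\<lambda>x. (f x, g x)) \<in> Cub 2" for x
    using that differentiable_pairD unfolding Cub_2_iff by blast+
  moreover from this have "Dx f differentiable (at x)" "Dx g differentiable (at x)" if "(\<lambda>x. (f x, g x)) \<in> Cub 2" for x
    using that differentiable_pairD[of "Dx f" "Dx g" x] unfolding Cub_2_iff by (simp_all add: Dx_pair)
  ultimately show ?thesis using False unfolding Cub_2_iff by blast
qed

lemma Linf_norm_app: "Linf_norm (app f) = norm f"
  by (simp add: Linf_norm_def norm_buc_def)

lemma Winf_norm_2: "Winf_norm 2 f = Linf_norm f + Linf_norm (Dx f) + Linf_norm (Dx (Dx f))"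
proof -
  have "{..2::nat} = {0, 1, 2}" by auto
  then show ?thesis by (simp add: Winf_norm_def numeral_2_eq_2)
qed

lemma Winf_norm_1: "Winf_norm 1 f = Linf_norm f + Linf_norm (Dx f)"
proof -
  have "{..1::nat} = {0, 1}" by auto
  then show ?thesis by (simp add: Winf_norm_def)
qed

lemma Linf_norm_pair_app: "Linf_norm (\<lambda>x. (app f x, app g x)) \<le> norm f + norm g"
  unfolding Linf_norm_def
proof (rule cSUP_least)
  fix x
  have "norm (app f x, app g x) \<le> \<bar>app f x\<bar> + \<bar>app g x\<bar>" using norm_Pair_le[of "app f x" "app g x"] by simp
  then show "norm (app f x, app g x) \<le> norm f + norm g"
    using abs_app_le_norm[of f x] abs_app_le_norm[of g x] by linarith
qed simp

lemma Linf_norm_pair_app_nonneg: "0 \<le> Linf_norm (\<lambda>x. (app f x, app g x))"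
proof -
  have "norm (app f x, app g x) \<le> norm f + norm g" for x
    using norm_Pair_le[of "app f x" "app g x"] abs_app_le_norm[of f x] abs_app_le_norm[of g x] by simp
  then have "bdd_above (range (\<lambda>x. norm (app f x, app g x)))" by (intro bdd_aboveI[of _ "norm f + norm g"]) auto
  then have "norm (app f 0, app g 0) \<le> Linf_norm (\<lambda>x. (app f x, app g x))"
    unfolding Linf_norm_def by (rule cSUP_upper[OF UNIV_I])
  then show ?thesis by (rule order_trans[OF norm_ge_zero])
qed

section \<open>Transfer of the heat semigroup and the Duhamel equation\<close>

lemma heat_app:
  assumes "0 \<le> t"
  shows "heat t (app f) = app (dheat 0 t f)"
proof (cases "t = 0")
  case False
  then have t: "0 < t" using assms by simp
  show ?thesis
  proof
    fix x
    have n: "normal_density 0 (sqrt (2 * t)) (y - x) = exp (- (x - y)\<^sup>2 / (4 * t)) / sqrt (4 * pi * t)" for y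
      using t by (simp add: normal_density_def power2_commute[of y x] mult_ac)
    have "app (dheat 0 t f) x = (LINT y|lborel. normal_density 0 (sqrt (2 * t)) y * app f (x + y))"
      by (simp add: dheat_0 app_hconv_density[OF t])
    also have "\<dots> = (LINT y|lborel. normal_density 0 (sqrt (2 * t)) (y - x) * app f y)"
      using lborel_integral_real_affine[of 1 "\<lambda>y. normal_density 0 (sqrt (2 * t)) (y - x) * app f y" x] by simp
    finally show "heat t (app f) x = app (dheat 0 t f) x" using t by (simp add: heat_def n)
  qed
qed (simp add: heat_def)

lemma apply_Bcontfun_app: "apply_bcontfun (Bcontfun (app f)) = app f"
  by (rule Bcontfun_inverse) (simp add: bcontfun_def continuous_app bounded_app)

text \<open>Bounded linear maps commute with the integral, so this embedding carries an integral in
  \<open>buc\<close> to the one that \<open>duhamel\<close> demands.\<close>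

lemma bounded_linear_Bcontfun_app: "bounded_linear (\<lambda>f. Bcontfun (app f))"
proof (rule bounded_linear_intro[where K=1])
  show "Bcontfun (app (f + g)) = Bcontfun (app f) + Bcontfun (app g)" for f g
    by (rule bcontfun_eqI) (simp add: apply_Bcontfun_app)
  show "Bcontfun (app (c *\<^sub>R f)) = c *\<^sub>R Bcontfun (app f)" for f c
    by (rule bcontfun_eqI) (simp add: apply_Bcontfun_app)
  show "norm (Bcontfun (app f)) \<le> norm f * 1" for f
    by (rule norm_bound) (simp add: apply_Bcontfun_app abs_app_le_norm)
qed

lemma duhamel_app:
  assumes "\<And>t. 0 \<le> t \<Longrightarrow> ((\<lambda>s. dheat 0 (t - s) (F s)) has_integral (w t - dheat 0 t w0)) {0..t}"
    and H: "\<And>s. 0 \<le> s \<Longrightarrow> H s = app (F s)"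
  shows "duhamel (\<lambda>t. app (w t)) (app w0) H"
  unfolding duhamel_def
proof (intro allI impI)
  fix t :: real assume t: "0 \<le> t"
  have "((\<lambda>s. Bcontfun (app (dheat 0 (t - s) (F s)))) has_integral Bcontfun (app (w t - dheat 0 t w0))) {0..t}"
    using has_integral_linear[OF assms(1)[OF t] bounded_linear_Bcontfun_app] by (simp add: o_def)
  moreover have "Bcontfun (app (w t - dheat 0 t w0)) = Bcontfun (app (w t)) - Bcontfun (heat t (app w0))"
    unfolding heat_app[OF t] by (rule linear_diff[OF bounded_linear.linear[OF bounded_linear_Bcontfun_app]])
  ultimately have "((\<lambda>s. Bcontfun (app (dheat 0 (t - s) (F s)))) has_integral
      (Bcontfun (app (w t)) - Bcontfun (heat t (app w0)))) {0..t}" by simp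
  then show "((\<lambda>s. Bcontfun (heat (t - s) (H s))) has_integral
      (Bcontfun (app (w t)) - Bcontfun (heat t (app w0)))) {0..t}"
    by (rule has_integral_eq[rotated]) (simp add: H heat_app)
qed

lemma continuous_into_Cub_app:
  assumes c: "\<forall>i<6. continuous_on {0..} (u i)" and j: "\<And>t. 0 \<le> t \<Longrightarrow> jet (\<lambda>i. u i t)"
  shows "(\<lambda>t x. (app (u 0 t) x, app (u 3 t) x)) \<in> continuous_into_Cub 2"
  unfolding continuous_into_Cub_def mem_Collect_eq
proof (intro conjI allI impI)
  fix t :: real assume t: "0 \<le> t"
  show "(\<lambda>x. (app (u 0 t) x, app (u 3 t) x)) \<in> Cub 2"
    using j[OF t] unfolding jet_def Cub_2_pair_iff by (auto intro: Cub_2_app)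
  have W: "0 \<le> Winf_norm 2 (\<lambda>x. (app (u 0 s) x, app (u 3 s) x) - (app (u 0 t) x, app (u 3 t) x)) \<and>
    Winf_norm 2 (\<lambda>x. (app (u 0 s) x, app (u 3 s) x) - (app (u 0 t) x, app (u 3 t) x))
      \<le> (norm (u 0 s - u 0 t) + norm (u 3 s - u 3 t)) + (norm (u 1 s - u 1 t) + norm (u 4 s - u 4 t))
        + (norm (u 2 s - u 2 t) + norm (u 5 s - u 5 t))" if s: "0 \<le> s" for s
  proof -
    have d: "bderiv (u 0 s - u 0 t) (u 1 s - u 1 t)" "bderiv (u 1 s - u 1 t) (u 2 s - u 2 t)"
      "bderiv (u 3 s - u 3 t) (u 4 s - u 4 t)" "bderiv (u 4 s - u 4 t) (u 5 s - u 5 t)"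
      using j[OF s] j[OF t] unfolding jet_def by (auto intro: bderiv_diff)
    have e: "(\<lambda>x. (app (u 0 s) x, app (u 3 s) x) - (app (u 0 t) x, app (u 3 t) x))
        = (\<lambda>x. (app (u 0 s - u 0 t) x, app (u 3 s - u 3 t) x))" by simp
    have D1: "Dx (\<lambda>x. (app (u 0 s - u 0 t) x, app (u 3 s - u 3 t) x))
        = (\<lambda>x. (app (u 1 s - u 1 t) x, app (u 4 s - u 4 t) x))"
      by (subst Dx_pair(1)) (simp_all only: Dx_app[OF d(1)] Dx_app[OF d(3)])
    have D2: "Dx (\<lambda>x. (app (u 1 s - u 1 t) x, app (u 4 s - u 4 t) x))
        = (\<lambda>x. (app (u 2 s - u 2 t) x, app (u 5 s - u 5 t) x))"
      by (subst Dx_pair(1)) (simp_all only: Dx_app[OF d(2)] Dx_app[OF d(4)])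
    show ?thesis unfolding e Winf_norm_2 D1 D2
      by (intro conjI add_mono add_nonneg_nonneg Linf_norm_pair_app Linf_norm_pair_app_nonneg)
  qed
  have l: "((\<lambda>s. norm (u i s - u i t)) \<longlongrightarrow> 0) (at t within {0..})" if "i < 6" for i
    using c that t unfolding continuous_on_def by (intro tendsto_norm_zero) (simp add: LIM_zero)
  have "((\<lambda>s. (norm (u 0 s - u 0 t) + norm (u 3 s - u 3 t)) + (norm (u 1 s - u 1 t) + norm (u 4 s - u 4 t))
        + (norm (u 2 s - u 2 t) + norm (u 5 s - u 5 t))) \<longlongrightarrow> (0 + 0) + (0 + 0) + (0 + 0)) (at t within {0..})"
    by (intro tendsto_add l) auto
  then have "((\<lambda>s. (norm (u 0 s - u 0 t) + norm (u 3 s - u 3 t)) + (norm (u 1 s - u 1 t) + norm (u 4 s - u 4 t))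
        + (norm (u 2 s - u 2 t) + norm (u 5 s - u 5 t))) \<longlongrightarrow> 0) (at t within {0..})" by simp
  then show "((\<lambda>s. Winf_norm 2 (\<lambda>x. (app (u 0 s) x, app (u 3 s) x) - (app (u 0 t) x, app (u 3 t) x))) \<longlongrightarrow> 0) (at t within {0..})"
    by (rule tendsto_sandwich[OF _ _ tendsto_const, rotated 2]) (use W in \<open>auto simp: eventually_at_filter\<close>)
qed

context amplitude_phase
begin

lemma nonlin_app:
  assumes "jet v"
  shows "nonlin_r q (app (v 0)) (app (v 3)) = app (- ((2 * q) *\<^sub>R v 4) - a *\<^sub>R v 0 + nl v 2)"
    "nonlin_phi q (app (v 0)) (app (v 3)) = app ((2 * q) *\<^sub>R v 1 + nl v 0)"
proof -
  have d: "Dx (app (v 0)) = app (v 1)" "Dx (app (v 3)) = app (v 4)"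
    using assms unfolding jet_def by (auto intro: Dx_app)
  show "nonlin_r q (app (v 0)) (app (v 3)) = app (- ((2 * q) *\<^sub>R v 4) - a *\<^sub>R v 0 + nl v 2)"
    unfolding nonlin_r_def d
    by (rule ext) (simp add: nl_def app_exp a_eq power2_eq_square algebra_simps)
  show "nonlin_phi q (app (v 0)) (app (v 3)) = app ((2 * q) *\<^sub>R v 1 + nl v 0)"
    unfolding nonlin_phi_def d by (rule ext) (simp add: nl_def)
qed

text \<open>The radius is d = 8 (M + 1) \<epsilon>. The bound on \<epsilon> says
  \<open>2 d (1 + 96 * 32 * M) < 1\<close>, which contains both smallness conditions of the
  contraction; M + 1 keeps the constants positive, as M is only known to be nonnegative. The 24 is 3
  times 8, since the last estimate adds three norms, each at most d / (1 + t).\<close>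

lemma global_solution:
  fixes r0 \<phi>0 :: "real \<Rightarrow> real"
  assumes \<epsilon>: "0 < \<epsilon>" "\<epsilon> < 1 / (16 * (M + 1) * (1 + 96 * 32 * M))"
    and init: "(\<lambda>x. (r0 x, \<phi>0 x)) \<in> Cub 2" "Winf_norm 2 r0 + Winf_norm 2 \<phi>0 < \<epsilon>"
  shows "\<exists>r \<phi>. global_mild_solution q r0 \<phi>0 r \<phi> \<and>
      (\<forall>t\<ge>0.
        Linf_norm (\<phi> t) \<le> 24 * (M + 1) * \<epsilon> \<and>
        Linf_norm (r t) + Linf_norm (Dx (\<phi> t)) \<le> 24 * (M + 1) * \<epsilon> / sqrt (1 + t) \<and>
        Winf_norm 1 (Dx (r t)) + Linf_norm (Dx (Dx (\<phi> t))) \<le> 24 * (M + 1) * \<epsilon> / (1 + t))"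
proof -
  obtain R0 R1 R2 where R: "app R0 = r0" "app R1 = Dx r0" "app R2 = Dx (Dx r0)" "bderiv R0 R1" "bderiv R1 R2"
    using init(1) Cub_2_obtain_buc unfolding Cub_2_pair_iff by metis
  obtain P0 P1 P2 where P: "app P0 = \<phi>0" "app P1 = Dx \<phi>0" "app P2 = Dx (Dx \<phi>0)" "bderiv P0 P1" "bderiv P1 P2"
    using init(1) Cub_2_obtain_buc unfolding Cub_2_pair_iff by metis
  define v where "v i = [R0, R1, R2, P0, P1, P2] ! i" for i
  define d where "d = 8 * (M + 1) * \<epsilon>"
  have jv: "jet v" using R P by (simp add: jet_def v_def)
  have "norm R0 + norm R1 + norm R2 + (norm P0 + norm P1 + norm P2) < \<epsilon>"
    using init(2) unfolding Winf_norm_2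
      Linf_norm_app[of R0, unfolded R(1)] Linf_norm_app[of R1, unfolded R(2)] Linf_norm_app[of R2, unfolded R(3)]
      Linf_norm_app[of P0, unfolded P(1)] Linf_norm_app[of P1, unfolded P(2)] Linf_norm_app[of P2, unfolded P(3)] .
  then have "norm R0 \<le> \<epsilon> \<and> norm R1 \<le> \<epsilon> \<and> norm R2 \<le> \<epsilon> \<and> norm P0 \<le> \<epsilon> \<and> norm P1 \<le> \<epsilon> \<and> norm P2 \<le> \<epsilon>"
    using norm_ge_zero[of R0] norm_ge_zero[of R1] norm_ge_zero[of R2] norm_ge_zero[of P0] norm_ge_zero[of P1] norm_ge_zero[of P2]
    by linarith
  then have v\<epsilon>: "\<forall>i<6. norm (v i) \<le> \<epsilon>" unfolding All_less_6 v_def by simp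
  have M1: "0 < M + 1" "0 < 1 + 96 * 32 * M" using M_ge by auto
  have d0: "0 \<le> d" using \<epsilon> M1 by (simp add: d_def)
  have "0 < 16 * (M + 1) * (1 + 96 * 32 * M)" using M1 by simp
  then have "\<epsilon> * (16 * (M + 1) * (1 + 96 * 32 * M)) < 1" using \<epsilon>(2) by (simp only: pos_less_divide_eq)
  moreover have "\<epsilon> * (16 * (M + 1) * (1 + 96 * 32 * M)) = 2 * d * (1 + 96 * 32 * M)" by (simp add: d_def)
  ultimately have "2 * d * (1 + 96 * 32 * M) < 1" by (simp only:)
  then have "2 * d + 2 * (96 * M * 32 * d) < 1" by (simp add: algebra_simps)
  moreover have "0 \<le> 96 * M * 32 * d" using d0 M_ge by simp
  ultimately have ds: "d \<le> 1 / 2" "96 * M * 32 * d \<le> 1 / 2" using d0 by linarith+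
  have dge: "8 * M * \<epsilon> \<le> d" using \<epsilon> by (simp add: d_def)
  obtain u where su: "state d u" and fu: "\<And>i t. i < 6 \<Longrightarrow> 0 \<le> t \<Longrightarrow> u i t = step v u i t"
    using fixed_point_exists[OF jv v\<epsilon> d0 ds(1) dge ds(2)] by blast
  have j: "jet (\<lambda>i. u i t)" if "0 \<le> t" for t using su that by (simp add: state_def)
  have b: "norm (u 0 t) \<le> d / sqrt (1 + t)" "norm (u 1 t) \<le> d / (1 + t)" "norm (u 2 t) \<le> d / (1 + t)"
    "norm (u 3 t) \<le> d" "norm (u 4 t) \<le> d / sqrt (1 + t)" "norm (u 5 t) \<le> d / (1 + t)" if "0 \<le> t" for t
    using su that unfolding state_def All_less_6 by (auto simp: wt_def)
  note gf = forcing_force[OF su d0 ds(1)]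
  have lr: "u i s = lin v i s + resp (force u) i s" if "i < 6" "0 \<le> s" for i s
    using fu[OF that] by (simp add: step_def)
  have "resp g 0 0 = 0" "resp g 3 0 = 0" for g by (simp_all add: resp_def)
  then have u00: "u 0 0 = R0" "u 3 0 = P0" using lr[of 0 0] lr[of 3 0] by (simp_all add: lin_0 v_def)
  have sol: "global_mild_solution q r0 \<phi>0 (\<lambda>t. app (u 0 t)) (\<lambda>t. app (u 3 t))"
    unfolding global_mild_solution_def
  proof (intro conjI)
    show "(\<lambda>t x. (app (u 0 t) x, app (u 3 t) x)) \<in> continuous_into_Cub 2"
      by (rule continuous_into_Cub_app[OF _ j]) (use su in \<open>auto simp: state_def\<close>)
    show "app (u 0 0) = r0" "app (u 3 0) = \<phi>0" by (simp_all add: u00 R P)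
    have "duhamel (\<lambda>t. app (u 0 t)) (app (v 0)) (\<lambda>s. nonlin_r q (app (u 0 s)) (app (u 3 s)))"
      by (rule duhamel_app[OF mild_r[OF jv gf _ lr]]) (auto simp: nonlin_app[OF j] force_def)
    then show "duhamel (\<lambda>t. app (u 0 t)) r0 (\<lambda>s. nonlin_r q (app (u 0 s)) (app (u 3 s)))"
      by (simp add: v_def R)
    have "duhamel (\<lambda>t. app (u 3 t)) (app (v 3)) (\<lambda>s. nonlin_phi q (app (u 0 s)) (app (u 3 s)))"
      by (rule duhamel_app[OF mild_phi[OF jv gf _ lr]]) (auto simp: nonlin_app[OF j] force_def)
    then show "duhamel (\<lambda>t. app (u 3 t)) \<phi>0 (\<lambda>s. nonlin_phi q (app (u 0 s)) (app (u 3 s)))"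
      by (simp add: v_def P)
  qed
  have "Linf_norm (app (u 3 t)) \<le> 24 * (M + 1) * \<epsilon> \<and>
      Linf_norm (app (u 0 t)) + Linf_norm (Dx (app (u 3 t))) \<le> 24 * (M + 1) * \<epsilon> / sqrt (1 + t) \<and>
      Winf_norm 1 (Dx (app (u 0 t))) + Linf_norm (Dx (Dx (app (u 3 t)))) \<le> 24 * (M + 1) * \<epsilon> / (1 + t)"
    if t: "0 \<le> t" for t
  proof -
    have D: "Dx (app (u 0 t)) = app (u 1 t)" "Dx (app (u 1 t)) = app (u 2 t)"
      "Dx (app (u 3 t)) = app (u 4 t)" "Dx (app (u 4 t)) = app (u 5 t)"
      using j[OF t] unfolding jet_def by (auto intro: Dx_app)
    have e: "24 * (M + 1) * \<epsilon> = 3 * d" by (simp add: d_def)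
    have p: "0 \<le> d / sqrt (1 + t)" using d0 t by simp
    show ?thesis
      unfolding D Winf_norm_1 Linf_norm_app e times_divide_eq_right[symmetric]
      using b[OF t] p d0 by (intro conjI; linarith)
  qed
  then show ?thesis using sol by blast
qed

end

theorem theorem4p1:
  fixes q :: real
  assumes "q\<^sup>2 < 1 / 3"
  shows "\<exists>M0>0. \<exists>\<epsilon>0>0. \<forall>\<epsilon> \<in> {0<..<\<epsilon>0}. \<forall>r0 \<phi>0 :: real \<Rightarrow> real.
    (\<lambda>x. (r0 x, \<phi>0 x)) \<in> Cub 2 \<and> Winf_norm 2 r0 + Winf_norm 2 \<phi>0 < \<epsilon> \<longrightarrow>
    (\<exists>r \<phi>. global_mild_solution q r0 \<phi>0 r \<phi> \<and>
      (\<forall>t\<ge>0.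
        Linf_norm (\<phi> t) \<le> M0 * \<epsilon> \<and>
        Linf_norm (r t) + Linf_norm (Dx (\<phi> t)) \<le> M0 * \<epsilon> / sqrt (1 + t) \<and>
        Winf_norm 1 (Dx (r t)) + Linf_norm (Dx (Dx (\<phi> t))) \<le> M0 * \<epsilon> / (1 + t)))"
proof -
  \<comment> \<open>The condition \<open>bt < a\<close> reads \<open>4 q^2 < 2 (1 - q^2)\<close>,
    which is the hypothesis on q.\<close>
  interpret amplitude_phase "2 * (1 - q\<^sup>2)" "4 * q\<^sup>2" q
    by unfold_locales (use assms in auto)
  have pos: "0 < 24 * (M + 1)" "0 < 1 / (16 * (M + 1) * (1 + 96 * 32 * M))" using M_ge by simp_all
  show ?thesis
  proof (rule exI[of _ "24 * (M + 1)"], rule conjI[OF pos(1)],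
      rule exI[of _ "1 / (16 * (M + 1) * (1 + 96 * 32 * M))"], rule conjI[OF pos(2)], intro ballI allI impI)
    fix \<epsilon> :: real and r0 \<phi>0 :: "real \<Rightarrow> real"
    assume "\<epsilon> \<in> {0<..<1 / (16 * (M + 1) * (1 + 96 * 32 * M))}"
      and init: "(\<lambda>x. (r0 x, \<phi>0 x)) \<in> Cub 2 \<and> Winf_norm 2 r0 + Winf_norm 2 \<phi>0 < \<epsilon>"
    then have "0 < \<epsilon>" "\<epsilon> < 1 / (16 * (M + 1) * (1 + 96 * 32 * M))" by (simp_all only: greaterThanLessThan_iff)
    from global_solution[OF this conjunct1[OF init] conjunct2[OF init]]
    show "\<exists>r \<phi>. global_mild_solution q r0 \<phi>0 r \<phi> \<and>
      (\<forall>t\<ge>0.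
        Linf_norm (\<phi> t) \<le> 24 * (M + 1) * \<epsilon> \<and>
        Linf_norm (r t) + Linf_norm (Dx (\<phi> t)) \<le> 24 * (M + 1) * \<epsilon> / sqrt (1 + t) \<and>
        Winf_norm 1 (Dx (r t)) + Linf_norm (Dx (Dx (\<phi> t))) \<le> 24 * (M + 1) * \<epsilon> / (1 + t))" .
  qed
qed

end
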